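(* Let $0<\alpha<\frac12$. Let $\mathcal{F}_j$, $j=1,\ldots,k$, be convex parameter spaces with $\mathcal{F}_i\cap\mathcal{F}_j\ne\varnothing$ for all $i,j$ and let $\mathcal{G}=\bigcup_{j=1}^k\mathcal{F}_j$. Let $CI^*=\bigcap_{j=1}^kCI^*_{j,\alpha/k}$, where the intervals $CI^*_{j,\beta}$ are defined in the context. Then $CI^*\in\mathcal{I}_{\alpha,\mathcal{G}}$ and $$L^*_\alpha(\mathcal{F}_j,\mathcal{G})\ \le\ L(CI^*,\mathcal{F}_j)\ \le\ \frac{12\,z_{\alpha/(2k)}}{(1/2-\alpha)\,z_\alpha}\,L^*_\alpha(\mathcal{F}_j,\mathcal{G})$$ for all $1\le j\le k$.
   Context: Model. One observes, for a given $n$, either the white noise model $dY(t)=f(t)\,dt+n^{-1/2}\,dW(t)$, $-\frac12\le t\le\frac12$, with $W$ standard Brownian motion, or the Gaussian sequence model $Y(i)=f(i)+n^{-1/2}z_i$, $i\in\mathcal{M}$, with $z_i$ i.i.d. standard normal and $\mathcal{M}$ a finite or countably infinite index set. The result is for either model. $P_f,E_f$ denote probability and expectation when $f$ is the truth. $\|\cdot\|_2$ is the $L_2(-\frac12,\frac12)$ norm, respectively the $\ell_2(\mathcal{M})$ norm. A parameter space is a (nonempty) set of possible $f$, and $T$ is a linear functional. Confidence intervals. A confidence interval $CI$ is a data-dependent interval, with length $L(CI)$ (an empty interval has length $0$). $\mathcal{I}_{\alpha,\mathcal{F}}$ is the collection of all confidence intervals with $\inf_{f\in\mathcal{F}}P_f(Tf\in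 CI)\ge1-\alpha$. $L(CI,\mathcal{H})=\sup_{f\in\mathcal{H}}E_f(L(CI))$ and $L_\alpha^*(\mathcal{H},\mathcal{F})=\inf_{CI\in\mathcal{I}_{\alpha,\mathcal{F}}}L(CI,\mathcal{H})$. Ordered modulus: $\omega(\varepsilon,\mathcal{F},\mathcal{H})=\sup\{Tg-Tf:\|g-f\|_2\le\varepsilon,\ f\in\mathcal{F},\ g\in\mathcal{H}\}$. $z_\alpha=\Phi^{-1}(1-\alpha)$, with $\Phi$ the standard normal distribution function. Construction. A linear estimator has the form $c+\int h\,dY$, respectively $c+\sum_i h(i)Y(i)$, with $c$ constant and $h$ square integrable/summable. For $0<\beta<1$ and $1\le i,j\le k$ put $\omega_{i,j}=\omega(z_{\beta/2}/\sqrt n,\mathcal{F}_i,\mathcal{F}_j)$ and let $\hat T_{i,j}$ be a linear estimator (both depend on $\beta$) with $$\mathrm{Var}(\hat T_{i,j})\le\frac{\omega_{i,j}^2}{z_{\beta/2}^2},\quad \inf_{f\in\mathcal{F}_j}(E_f\hat T_{i,j}-Tf)\ge-\tfrac12\omega_{i,j},\quad \sup_{f\in\mathcal{F}_i}(E_f\hat T_{i,j}-Tf)\le\tfrac12\omega_{i,j}.$$ (Such estimators are known to exist, by earlier work.) Define $$CI^*_{j,\beta}=\Big[\min_{1\le i\le k}\{\hat T_{i,j}-\tfrac32\omega_{i,j}\},\ \max_{1\le i\le k}\{\hat T_{j,i}+\tfrac32\omega_{j,i}\}\Big].$$ *)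

theory Defs
  imports "HOL-Probability.Probability"
begin

section \<open>Square integrable parameters\<close>

text \<open>
  The base measure \<open>\<mu>\<close> is Lebesgue measure on \<open>[-1/2, 1/2]\<close> for the white noise model and counting
  measure on the index set for the sequence model.  Parameters are genuine functions rather than
  classes modulo null sets, so that functionals such as point evaluation are covered.
\<close>

definition L2 :: "'i measure \<Rightarrow> ('i \<Rightarrow> real) set" where
  "L2 \<mu> = {f \<in> borel_measurable \<mu>. integrable \<mu> (\<lambda>x. (f x)\<^sup>2)}"

definition norm2 :: "'i measure \<Rightarrow> ('i \<Rightarrow> real) \<Rightarrow> real" where
  "norm2 \<mu> f = sqrt (integral\<^sup>L \<mu> (\<lambda>x. (f x)\<^sup>2))"

definition convex_space :: "('i \<Rightarrow> real) set \<Rightarrow> bool" where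
  "convex_space A \<longleftrightarrow>
     (\<forall>f\<in>A. \<forall>g\<in>A. \<forall>u\<in>{0..1}. (\<lambda>x. (1 - u) * f x + u * g x) \<in> A)"

text \<open>The domain \<open>D\<close> need not be all of \<open>L\<^sub>2\<close>, and \<open>T\<close> need not be bounded.\<close>

definition linear_functional_on :: "('i \<Rightarrow> real) set \<Rightarrow> (('i \<Rightarrow> real) \<Rightarrow> real) \<Rightarrow> bool" where
  "linear_functional_on D T \<longleftrightarrow> (\<lambda>x. 0) \<in> D \<and>
     (\<forall>f\<in>D. \<forall>g\<in>D. \<forall>a b. (\<lambda>x. a * f x + b * g x) \<in> D \<and>
        T (\<lambda>x. a * f x + b * g x) = a * T f + b * T g)"


section \<open>Observation models\<close>

text \<open>
  In both models an observation is a real function on the space of the base measure, with the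
  \<open>\<sigma>\<close>-algebra generated by the coordinates.  \<open>law m f\<close> is the distribution of the observation when
  \<open>f\<close> is the truth, and \<open>stoch_int m h X\<close> says that the statistic \<open>X\<close> is (a version of) \<open>\<integral>h dY\<close>,
  respectively \<open>\<Sum>\<^sub>i h(i) Y(i)\<close>.
\<close>

record 'i gaussian_model =
  base :: "'i measure"
  law :: "('i \<Rightarrow> real) \<Rightarrow> ('i \<Rightarrow> real) measure"
  stoch_int :: "('i \<Rightarrow> real) \<Rightarrow> (('i \<Rightarrow> real) \<Rightarrow> real) \<Rightarrow> bool"

definition obs_space :: "'i measure \<Rightarrow> ('i \<Rightarrow> real) measure" where
  "obs_space \<mu> = Pi\<^sub>M (space \<mu>) (\<lambda>_. borel)"

definition linear_estimator :: "'i gaussian_model \<Rightarrow> (('i \<Rightarrow> real) \<Rightarrow> real) \<Rightarrow> bool" where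
  "linear_estimator m X \<longleftrightarrow>
     (\<exists>c h. h \<in> L2 (base m) \<and> stoch_int m h (\<lambda>y. X y - c))"


subsection \<open>White noise\<close>

abbreviation unit_base :: "real measure" where
  "unit_base \<equiv> lebesgue_on {-1/2..1/2}"

definition brownian_motion :: "'w measure \<Rightarrow> (real \<Rightarrow> 'w \<Rightarrow> real) \<Rightarrow> bool" where
  "brownian_motion \<Omega> W \<longleftrightarrow>
     prob_space \<Omega> \<and>
     (\<forall>t\<in>{-1/2..1/2}. W t \<in> borel_measurable \<Omega>) \<and>
     (AE \<omega> in \<Omega>. W (-1/2) \<omega> = 0) \<and>
     (\<forall>s\<in>{-1/2..1/2}. \<forall>t\<in>{-1/2..1/2}. s < t \<longrightarrow>
        distributed \<Omega> lborel (\<lambda>\<omega>. W t \<omega> - W s \<omega>) (normal_density 0 (sqrt (t - s)))) \<and>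
     (\<forall>(N::nat) (t :: nat \<Rightarrow> real). t ` {..N} \<subseteq> {-1/2..1/2} \<and> strict_mono_on {..N} t \<longrightarrow>
        prob_space.indep_vars \<Omega> (\<lambda>_. borel) (\<lambda>i \<omega>. W (t (Suc i)) \<omega> - W (t i) \<omega>) {..<N}) \<and>
     (AE \<omega> in \<Omega>. continuous_on {-1/2..1/2} (\<lambda>t. W t \<omega>))"

text \<open>The distribution of the path \<open>Y(t) = \<integral>\<^bsub>-1/2\<^esub>\<^bsup>t\<^esup> f(s) ds + W(t) / sqrt n\<close>.\<close>

definition white_noise_law ::
  "nat \<Rightarrow> 'w measure \<Rightarrow> (real \<Rightarrow> 'w \<Rightarrow> real) \<Rightarrow> (real \<Rightarrow> real) \<Rightarrow> (real \<Rightarrow> real) measure" where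
  "white_noise_law n \<Omega> W f =
     distr \<Omega> (obs_space unit_base)
       (\<lambda>\<omega>. \<lambda>t\<in>{-1/2..1/2}. integral\<^sup>L (lebesgue_on {-1/2..t}) f + W t \<omega> / sqrt (real n))"

text \<open>A list of triples \<open>(a, u, v)\<close> encodes the step function \<open>\<Sum> a 1\<^bsub>(u,v]\<^esub>\<close>.\<close>

type_synonym step = "(real \<times> real \<times> real) list"

definition valid_step :: "step \<Rightarrow> bool" where
  "valid_step s \<longleftrightarrow> (\<forall>(a, u, v) \<in> set s. -1/2 \<le> u \<and> u \<le> v \<and> v \<le> 1/2)"

definition step_fun :: "step \<Rightarrow> real \<Rightarrow> real" where
  "step_fun s x = (\<Sum>(a, u, v)\<leftarrow>s. a * indicator {u<..v} x)"

definition step_int :: "step \<Rightarrow> (real \<Rightarrow> real) \<Rightarrow> real" where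
  "step_int s y = (\<Sum>(a, u, v)\<leftarrow>s. a * (y v - y u))"

text \<open>
  The Wiener integral, as the mean square limit of the integrals of step functions that tend to
  \<open>h\<close> in \<open>L\<^sub>2\<close>.  It is one statistic which serves for all \<open>f\<close> simultaneously.
\<close>

definition wiener_int ::
  "nat \<Rightarrow> 'w measure \<Rightarrow> (real \<Rightarrow> 'w \<Rightarrow> real) \<Rightarrow> (real \<Rightarrow> real) \<Rightarrow> ((real \<Rightarrow> real) \<Rightarrow> real) \<Rightarrow> bool" where
  "wiener_int n \<Omega> W h X \<longleftrightarrow>
     X \<in> borel_measurable (obs_space unit_base) \<and>
     (\<exists>s :: nat \<Rightarrow> step. (\<forall>r. valid_step (s r)) \<and>
        (\<lambda>r. norm2 unit_base (\<lambda>x. h x - step_fun (s r) x)) \<longlonglongrightarrow> 0 \<and>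
        (\<forall>f \<in> L2 unit_base.
           (\<lambda>r. \<integral>\<^sup>+y. ennreal ((X y - step_int (s r) y)\<^sup>2) \<partial>white_noise_law n \<Omega> W f) \<longlonglongrightarrow> 0))"

definition white_noise :: "nat \<Rightarrow> 'w measure \<Rightarrow> (real \<Rightarrow> 'w \<Rightarrow> real) \<Rightarrow> real gaussian_model" where
  "white_noise n \<Omega> W =
     \<lparr>base = unit_base, law = white_noise_law n \<Omega> W, stoch_int = wiener_int n \<Omega> W\<rparr>"


subsection \<open>Gaussian sequences\<close>

text \<open>The distribution of \<open>(f(i) + z(i) / sqrt n)\<close>, with \<open>z\<close> on its canonical product space.\<close>

definition sequence_law :: "nat \<Rightarrow> 'i set \<Rightarrow> ('i \<Rightarrow> real) \<Rightarrow> ('i \<Rightarrow> real) measure" where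
  "sequence_law n M f =
     distr (Pi\<^sub>M M (\<lambda>_. density lborel std_normal_density)) (obs_space (count_space M))
       (\<lambda>z. \<lambda>i\<in>M. f i + z i / sqrt (real n))"

text \<open>
  For square summable \<open>h\<close> the series \<open>\<Sum>\<^sub>i h(i) Y(i)\<close> need not converge absolutely; it converges
  unconditionally in mean square.
\<close>

definition sequence_int ::
  "nat \<Rightarrow> 'i set \<Rightarrow> ('i \<Rightarrow> real) \<Rightarrow> (('i \<Rightarrow> real) \<Rightarrow> real) \<Rightarrow> bool" where
  "sequence_int n M h X \<longleftrightarrow>
     X \<in> borel_measurable (obs_space (count_space M)) \<and>
     (\<forall>f \<in> L2 (count_space M).
        ((\<lambda>A. \<integral>\<^sup>+y. ennreal ((X y - (\<Sum>i\<in>A. h i * y i))\<^sup>2) \<partial>sequence_law n M f) \<longlongrightarrow> 0)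
          (finite_subsets_at_top M))"

definition gaussian_sequence :: "nat \<Rightarrow> 'i set \<Rightarrow> 'i gaussian_model" where
  "gaussian_sequence n M =
     \<lparr>base = count_space M, law = sequence_law n M, stoch_int = sequence_int n M\<rparr>"


section \<open>Confidence intervals\<close>

text \<open>
  The length is Lebesgue measure, hence \<open>0\<close> for the empty interval and \<open>\<infinity>\<close> for an unbounded one.
\<close>

definition interval_length :: "real set \<Rightarrow> ennreal" where
  "interval_length I = emeasure lborel I"

text \<open>
  Intervals may be open, closed, half-open, empty or unbounded.  The measurability conditions are
  exactly those needed for coverage probabilities and expected length to be defined.
\<close>

definition random_interval :: "'i gaussian_model \<Rightarrow> (('i \<Rightarrow> real) \<Rightarrow> real set) \<Rightarrow> bool" where
  "random_interval m C \<longleftrightarrow>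
     (\<forall>y \<in> space (obs_space (base m)). is_interval (C y)) \<and>
     (\<forall>\<theta>. {y \<in> space (obs_space (base m)). \<theta> \<in> C y} \<in> sets (obs_space (base m))) \<and>
     (\<lambda>y. interval_length (C y)) \<in> borel_measurable (obs_space (base m))"

definition conf_intervals ::
  "'i gaussian_model \<Rightarrow> (('i \<Rightarrow> real) \<Rightarrow> real) \<Rightarrow> real \<Rightarrow> ('i \<Rightarrow> real) set
     \<Rightarrow> (('i \<Rightarrow> real) \<Rightarrow> real set) set" where
  "conf_intervals m T \<alpha> A = {C. random_interval m C \<and>
     (INF f\<in>A. ereal (measure (law m f) {y \<in> space (law m f). T f \<in> C y})) \<ge> ereal (1 - \<alpha>)}"

definition max_length ::
  "'i gaussian_model \<Rightarrow> (('i \<Rightarrow> real) \<Rightarrow> real set) \<Rightarrow> ('i \<Rightarrow> real) set \<Rightarrow> ennreal" where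
  "max_length m C H = (SUP f\<in>H. \<integral>\<^sup>+y. interval_length (C y) \<partial>law m f)"

definition minimax_length ::
  "'i gaussian_model \<Rightarrow> (('i \<Rightarrow> real) \<Rightarrow> real) \<Rightarrow> real \<Rightarrow> ('i \<Rightarrow> real) set \<Rightarrow> ('i \<Rightarrow> real) set
     \<Rightarrow> ennreal" where
  "minimax_length m T \<alpha> H A = (INF C\<in>conf_intervals m T \<alpha> A. max_length m C H)"


section \<open>Modulus of continuity and the adaptive interval\<close>

definition z_quantile :: "real \<Rightarrow> real" where
  "z_quantile \<alpha> = inv (cdf (density lborel std_normal_density)) (1 - \<alpha>)"

definition ordered_modulus ::
  "'i gaussian_model \<Rightarrow> (('i \<Rightarrow> real) \<Rightarrow> real) \<Rightarrow> real \<Rightarrow> ('i \<Rightarrow> real) set \<Rightarrow> ('i \<Rightarrow> real) set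
     \<Rightarrow> ereal" where
  "ordered_modulus m T \<epsilon> A B =
     Sup {ereal (T g - T f) | f g. norm2 (base m) (\<lambda>x. g x - f x) \<le> \<epsilon> \<and> f \<in> A \<and> g \<in> B}"

definition modulus_at ::
  "'i gaussian_model \<Rightarrow> nat \<Rightarrow> (('i \<Rightarrow> real) \<Rightarrow> real) \<Rightarrow> (nat \<Rightarrow> ('i \<Rightarrow> real) set) \<Rightarrow> real
     \<Rightarrow> nat \<Rightarrow> nat \<Rightarrow> ereal" where
  "modulus_at m n T F \<beta> i j =
     ordered_modulus m T (z_quantile (\<beta> / 2) / sqrt (real n)) (F i) (F j)"

text \<open>The conditions on \<open>X = T\<^sub>i\<^sub>,\<^sub>j\<close>; the variance does not depend on \<open>f\<close>.\<close>

definition admissible_estimator ::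
  "'i gaussian_model \<Rightarrow> nat \<Rightarrow> (('i \<Rightarrow> real) \<Rightarrow> real) \<Rightarrow> (nat \<Rightarrow> ('i \<Rightarrow> real) set) \<Rightarrow> real
     \<Rightarrow> nat \<Rightarrow> nat \<Rightarrow> (('i \<Rightarrow> real) \<Rightarrow> real) \<Rightarrow> bool" where
  "admissible_estimator m n T F \<beta> i j X \<longleftrightarrow>
     linear_estimator m X \<and>
     (\<forall>f \<in> L2 (base m).
        ereal (integral\<^sup>L (law m f) (\<lambda>y. (X y - integral\<^sup>L (law m f) X)\<^sup>2))
          \<le> (modulus_at m n T F \<beta> i j)\<^sup>2 / ereal ((z_quantile (\<beta> / 2))\<^sup>2)) \<and>
     (INF f\<in>F j. ereal (integral\<^sup>L (law m f) X - T f)) \<ge> - (ereal (1/2) * modulus_at m n T F \<beta> i j) \<and>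
     (SUP f\<in>F i. ereal (integral\<^sup>L (law m f) X - T f)) \<le> ereal (1/2) * modulus_at m n T F \<beta> i j"

definition CI_star_component ::
  "'i gaussian_model \<Rightarrow> nat \<Rightarrow> (('i \<Rightarrow> real) \<Rightarrow> real) \<Rightarrow> nat \<Rightarrow> (nat \<Rightarrow> ('i \<Rightarrow> real) set)
     \<Rightarrow> real \<Rightarrow> (nat \<Rightarrow> nat \<Rightarrow> ('i \<Rightarrow> real) \<Rightarrow> real) \<Rightarrow> nat \<Rightarrow> ('i \<Rightarrow> real) \<Rightarrow> real set" where
  "CI_star_component m n T k F \<beta> Th j y = {x.
     (MIN i\<in>{1..k}. ereal (Th i j y) - ereal (3/2) * modulus_at m n T F \<beta> i j) \<le> ereal x \<and>
     ereal x \<le> (MAX i\<in>{1..k}. ereal (Th j i y) + ereal (3/2) * modulus_at m n T F \<beta> j i)}"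

definition CI_star ::
  "'i gaussian_model \<Rightarrow> nat \<Rightarrow> (('i \<Rightarrow> real) \<Rightarrow> real) \<Rightarrow> nat \<Rightarrow> (nat \<Rightarrow> ('i \<Rightarrow> real) set)
     \<Rightarrow> real \<Rightarrow> (nat \<Rightarrow> nat \<Rightarrow> ('i \<Rightarrow> real) \<Rightarrow> real) \<Rightarrow> ('i \<Rightarrow> real) \<Rightarrow> real set" where
  "CI_star m n T k F \<alpha> Th y = (\<Inter>j\<in>{1..k}. CI_star_component m n T k F (\<alpha> / real k) Th j y)"

text \<open>Taking \<open>i = j\<close> in the last condition shows that each \<open>F j\<close> is nonempty.\<close>

definition parameter_setting ::
  "'i gaussian_model \<Rightarrow> ('i \<Rightarrow> real) set \<Rightarrow> (('i \<Rightarrow> real) \<Rightarrow> real) \<Rightarrow> nat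
     \<Rightarrow> (nat \<Rightarrow> ('i \<Rightarrow> real) set) \<Rightarrow> bool" where
  "parameter_setting m D T k F \<longleftrightarrow>
     linear_functional_on D T \<and>
     (\<forall>j\<in>{1..k}. F j \<subseteq> L2 (base m) \<inter> D \<and> convex_space (F j)) \<and>
     (\<forall>i\<in>{1..k}. \<forall>j\<in>{1..k}. F i \<inter> F j \<noteq> {})"

end

theory Submission
  imports Defs
begin

text \<open>
  Coverage: for \<open>f \<in> F l\<close> each of the \<open>2 k\<close> relevant end points fails with probability at most
  \<open>\<alpha> / (2 k)\<close>, because the bias is at most \<open>\<omega> / 2\<close> and the standard deviation at most \<open>\<omega> / z\<close>, where
  \<open>z = z_quantile (\<alpha> / (2 k))\<close>.  Lower bound: an interval that covers both \<open>T f\<close> and \<open>T g\<close> has length at least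
  \<open>\<bar>T g - T f\<bar>\<close>, and under \<open>g\<close> the event of missing \<open>T f\<close> is a level \<open>\<alpha>\<close> test of \<open>f\<close> against \<open>g\<close>, whose power
  is at most \<open>1/2\<close> if \<open>f\<close> and \<open>g\<close> are within \<open>z\<^sub>\<alpha> / sqrt n\<close>.  So the minimax length is at least
  \<open>1/2 - \<alpha>\<close> times the moduli at \<open>z\<^sub>\<alpha> / sqrt n\<close>, and by convexity passing to \<open>z / sqrt n\<close> costs at most
  the factor \<open>z / z\<^sub>\<alpha>\<close>.  Upper bound: the expected length is at most a constant times the largest modulus,
  since the expected overshoots of the \<open>k\<close> estimators sum up to a constant multiple of it.

  Girsanov's theorem is avoided: the testing bound is proved for finitely many coordinates, which
  are affine images of independent standard normal variables in both models, and transferred by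
  approximating events by cylinder sets.
\<close>

section \<open>The standard normal distribution\<close>

text \<open>Coverage is demanded on the whole union, length is measured on a single
  \<open>F j\<close>. So the moduli that matter are those between \<open>F j\<close> and every
  \<open>F i\<close>, in both directions, and each two-point comparison must place one of its points
  in \<open>F j\<close>, where the length counts. The value 1/2 is the power of the Neyman-Pearson
  test at distance exactly \<open>z_quantile \<alpha> / sqrt n\<close>; missing \<open>T f\<close>
  with probability 1/2 or \<open>T g\<close> with probability \<alpha> leaves 1/2 - \<alpha>. A
  maximum over \<open>k\<close> estimators would normally cost a factor growing with
  \<open>k\<close>. Here it is already paid for: standard deviations are at most the modulus divided
  by \<open>z\<close>, and \<open>z\<close> grows with \<open>k\<close>. Up to the excesses, each
  end of the interval lies within 1 + 1/2 + 3/2 = 3 moduli of \<open>T f\<close>, and all excesses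
  together have expectation at most 2 moduli. The argument thus yields the constant 8, which the
  stated 12 dominates. Infinite moduli are harmless: a finite minimax length forces the relevant
  moduli to be finite.\<close>

interpretation std_normal: real_distribution std_normal_distribution
  by (rule real_dist_normal_dist)

definition normal_tail :: "real \<Rightarrow> real" where
  "normal_tail z = measure std_normal_distribution {z<..}"

lemma cdf_std_normal: "cdf std_normal_distribution z = 1 - normal_tail z"
proof -
  have "measure std_normal_distribution (UNIV - {z<..}) = 1 - measure std_normal_distribution {z<..}"
    using std_normal.prob_compl[of "{z<..}"] by simp
  moreover have "UNIV - {z<..} = {..z}" by auto
  ultimately show ?thesis by (simp add: cdf_def normal_tail_def)
qed

lemma normal_tail_mono: "y \<le> z \<Longrightarrow> normal_tail z \<le> normal_tail y"
  unfolding normal_tail_def by (intro std_normal.finite_measure_mono) auto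

text \<open>The density never exceeds \<open>1 / sqrt (2 * pi)\<close>, hence 1/2. This crude bound
  gives both the absence of atoms and the numerical bound on quantiles in
  \<open>z_quantile_ge_half\<close>.\<close>

lemma measure_std_normal_le:
  assumes "a \<le> b" shows "measure std_normal_distribution {a<..b} \<le> (b - a) / 2"
proof -
  have "std_normal_density x \<le> 1 / 2" for x
  proof -
    have "2 \<le> sqrt (2 * pi)" using pi_ge_two by (intro real_le_rsqrt) auto
    hence "1 / sqrt (2 * pi) \<le> 1 / 2" by (intro divide_left_mono) auto
    moreover have "exp (- x\<^sup>2 / 2) \<le> 1" by simp
    ultimately have "(1 / sqrt (2 * pi)) * exp (- x\<^sup>2 / 2) \<le> (1/2) * 1" by (intro mult_mono) auto
    thus ?thesis by (simp add: std_normal_density_def)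
  qed
  hence le: "ennreal (std_normal_density x) \<le> ennreal (1/2)" for x by (rule ennreal_leI)
  have "emeasure std_normal_distribution {a<..b} \<le> (\<integral>\<^sup>+x. ennreal (1/2) * indicator {a<..b} x \<partial>lborel)"
    by (subst emeasure_density) (auto intro!: nn_integral_mono mult_right_mono le simp del: ennreal_half)
  also have "\<dots> = ennreal ((b - a) / 2)"
    using assms by (simp add: nn_integral_cmult_indicator ennreal_mult[symmetric] del: ennreal_half)
  finally show ?thesis unfolding measure_def using assms by (intro enn2real_leI) auto
qed

lemma measure_std_normal_singleton: "measure std_normal_distribution {x} = 0"
proof -
  have "measure std_normal_distribution {x} \<le> e" if "e > 0" for e
  proof -
    have "measure std_normal_distribution {x} \<le> measure std_normal_distribution {x - e<..x}"
      using that by (intro std_normal.finite_measure_mono) auto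
    also have "\<dots> \<le> e" using measure_std_normal_le[of "x - e" x] that by simp
    finally show ?thesis .
  qed
  thus ?thesis by (metis field_le_epsilon add_0 measure_nonneg order_antisym)
qed

text \<open>\<open>z_quantile\<close> is built with \<open>inv\<close>, which is informative only
  once \<open>1 - a\<close> is known to be a value of the distribution function. Continuity and the
  limits at both ends provide this by the intermediate value theorem; which preimage
  \<open>inv\<close> picks does not matter.\<close>

lemma normal_tail_z_quantile:
  assumes "0 < a" "a < 1" shows "normal_tail (z_quantile a) = a"
proof -
  let ?F = "cdf std_normal_distribution"
  have "eventually (\<lambda>x. ?F x < 1 - a) at_bot"
    using std_normal.cdf_lim_at_bot assms by (intro order_tendstoD) auto
  then obtain l where l: "?F l < 1 - a" by (meson eventually_at_bot_linorder order_refl)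
  have "eventually (\<lambda>x. ?F x > 1 - a) at_top"
    using std_normal.cdf_lim_at_top_prob assms by (intro order_tendstoD) auto
  then obtain u where u: "?F u > 1 - a" by (meson eventually_at_top_linorder order_refl)
  have "l \<le> u" using std_normal.cdf_nondecreasing[of u l] l u by force
  then obtain x where x: "?F x = 1 - a"
    using IVT'[of ?F l "1 - a" u] l u
    by (auto simp: continuous_at_imp_continuous_on std_normal.isCont_cdf measure_std_normal_singleton)
  hence "?F (z_quantile a) = 1 - a" unfolding z_quantile_def by (metis f_inv_into_f rangeI)
  thus ?thesis by (simp add: cdf_std_normal)
qed

text \<open>Normal laws are identified below through this formula and Levy's uniqueness theorem. It
  covers \<sigma> = 0, the point mass at \<mu>.\<close>

lemma char_std_normal_affine:
  "char (distr std_normal_distribution borel (\<lambda>z. \<mu> + \<sigma> * z)) t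
    = iexp (t * \<mu>) * of_real (exp (- (t * \<sigma>)\<^sup>2 / 2))"
proof -
  have "char (distr std_normal_distribution borel (\<lambda>z. \<mu> + \<sigma> * z)) t
      = (CLINT z|std_normal_distribution. iexp (t * \<mu>) * iexp ((t * \<sigma>) * z))"
    unfolding char_def by (subst integral_distr) (auto simp: exp_add[symmetric] algebra_simps)
  also have "\<dots> = iexp (t * \<mu>) * char std_normal_distribution (t * \<sigma>)"
    unfolding char_def by simp
  finally show ?thesis by (simp add: char_std_normal_distribution)
qed

text \<open>The characteristic function is even.\<close>

lemma distr_std_normal_uminus: "distr std_normal_distribution borel uminus = std_normal_distribution"
proof (rule Levy_uniqueness)
  show "char (distr std_normal_distribution borel uminus) = char std_normal_distribution"
    using char_std_normal_affine[of 0 "-1"] by (auto simp: char_std_normal_distribution)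
qed (auto intro!: std_normal.real_distribution_distr real_dist_normal_dist)

lemma measure_std_normal_lessThan: "measure std_normal_distribution {..<z} = normal_tail (- z)"
proof -
  have "measure std_normal_distribution {..<z} = measure (distr std_normal_distribution borel uminus) {..<z}"
    by (simp add: distr_std_normal_uminus)
  also have "\<dots> = normal_tail (- z)"
    unfolding normal_tail_def by (subst measure_distr) (auto intro!: arg_cong2[where f = measure])
  finally show ?thesis .
qed

text \<open>By symmetry both half lines have equal mass, and the origin has none. This value is the
  1/2 in the factor 1/2 - \<alpha> of the theorem.\<close>

lemma normal_tail_0: "normal_tail 0 = 1/2"
proof -
  have "{..<0} = {..0::real} - {0}" by auto
  hence "measure std_normal_distribution {..<0} = 1 - normal_tail 0 - measure std_normal_distribution {0}"
    by (metis (no_types) atMost_iff borel_singleton cdf_def2 cdf_std_normal empty_subsetI insert_subset order_refl sets.empty_sets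
          sets_density sets_lborel std_normal.finite_measure_Diff std_normal.sets_M atMost_borel)
  thus ?thesis using measure_std_normal_lessThan[of 0] by (simp add: measure_std_normal_singleton)
qed

lemma z_quantile_pos: assumes "0 < a" "a < 1/2" shows "0 < z_quantile a"
  using normal_tail_z_quantile[of a] normal_tail_mono[of "z_quantile a" 0] normal_tail_0 assms by force

lemma z_quantile_antimono:
  assumes "0 < a" "a \<le> b" "b < 1" shows "z_quantile b \<le> z_quantile a"
  using normal_tail_z_quantile[of a] normal_tail_z_quantile[of b]
    normal_tail_mono[of "z_quantile a" "z_quantile b"] assms
  by (cases "a = b") force+

text \<open>The interval from 0 to 1/2 has mass at most 1/4, so the tail beyond 1/2 is still at
  least 1/4. The bound keeps the reciprocal of the squared quantile below 4 in
  \<open>estimator_excess\<close>.\<close>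

lemma z_quantile_ge_half: assumes "0 < a" "a < 1/4" shows "1/2 \<le> z_quantile a"
proof (rule ccontr)
  assume *: "\<not> 1/2 \<le> z_quantile a"
  have "{0<..} - {1/2<..} = {0<..1/2::real}" by auto
  hence "normal_tail 0 - normal_tail (1/2) = measure std_normal_distribution {0<..1/2}"
    using std_normal.finite_measure_Diff[of "{0<..}" "{1/2<..}"] unfolding normal_tail_def by auto
  also have "\<dots> \<le> 1/4" using measure_std_normal_le[of 0 "1/2"] by simp
  finally have "1/4 \<le> normal_tail (1/2)" by (simp add: normal_tail_0)
  thus False using * normal_tail_mono[of "z_quantile a" "1/2"] normal_tail_z_quantile[of a] assms by auto
qed

text \<open>Since \<open>((x - z) \<phi>(x))' = (1 - z (x - z) - (x - z)\<^sup>2) \<phi>(x)\<close>, the integral of the right hand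
  side over \<open>[z, R]\<close> is nonnegative.\<close>

lemma std_normal_excess:
  assumes "0 < z"
  shows "(\<integral>\<^sup>+x. ennreal (x - z) \<partial>std_normal_distribution) \<le> ennreal (normal_tail z / z)"
proof -
  let ?p = std_normal_density
  \<comment> \<open>The truncation at \<open>z + N\<close> allows the fundamental theorem of
    calculus on a compact interval; monotone convergence removes it at the end.\<close>
  have bound: "(\<integral>\<^sup>+x. ennreal (?p x * (x - z)) * indicator {z..z + real N} x \<partial>lborel)
      \<le> ennreal (normal_tail z / z)" for N :: nat
  proof -
    let ?R = "z + real N"
    have deriv: "((\<lambda>x. (x - z) * ?p x) has_real_derivative (1 - z * (x - z) - (x - z)\<^sup>2) * ?p x) (at x)" for x
    proof -
      have "(?p has_real_derivative - x * ?p x) (at x)"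
        unfolding std_normal_density_def by (auto intro!: derivative_eq_intros simp: field_simps)
      thus ?thesis by (auto intro!: derivative_eq_intros simp: algebra_simps power2_eq_square)
    qed
    have cp: "isCont ?p x" for x unfolding std_normal_density_def by (intro continuous_intros) auto
    have int: "integrable lborel (\<lambda>x. g x * indicator {z..?R} x)" if "\<And>x. isCont g x" for g :: "real \<Rightarrow> real"
      using borel_integrable_atLeastAtMost[of z ?R g] that by simp
    have nn: "(\<integral>\<^sup>+x. ennreal (g x) * indicator {z..?R} x \<partial>lborel) = ennreal (\<integral>x. g x * indicator {z..?R} x \<partial>lborel)"
      if "\<And>x. isCont g x" "\<And>x. z \<le> x \<Longrightarrow> 0 \<le> g x" for g :: "real \<Rightarrow> real"
    proof -
      have "(\<integral>\<^sup>+x. ennreal (g x) * indicator {z..?R} x \<partial>lborel) = (\<integral>\<^sup>+x. ennreal (g x * indicator {z..?R} x) \<partial>lborel)"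
        by (intro nn_integral_cong) (simp add: indicator_def)
      also have "\<dots> = ennreal (\<integral>x. g x * indicator {z..?R} x \<partial>lborel)"
        using that by (intro nn_integral_eq_integral int) (auto simp: indicator_def)
      finally show ?thesis .
    qed
    have "(\<integral>x. ((1 - z * (x - z) - (x - z)\<^sup>2) * ?p x) * indicator {z..?R} x \<partial>lborel)
        = (?R - z) * ?p ?R - (z - z) * ?p z"
      using deriv by (intro integral_FTC_Icc_real) (auto intro!: continuous_intros cp)
    \<comment> \<open>The boundary term at \<open>z\<close> is zero and the one at \<open>?R\<close>
      is nonnegative. Dropping the square afterwards only increases the integral, and what remains
      bounds \<open>z\<close> times the truncated excess by the mass of the interval.\<close>
    hence 1: "0 \<le> (\<integral>x. ((1 - z * (x - z) - (x - z)\<^sup>2) * ?p x) * indicator {z..?R} x \<partial>lborel)" by simp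
    also have "\<dots> \<le> (\<integral>x. ((1 - z * (x - z)) * ?p x) * indicator {z..?R} x \<partial>lborel)"
      by (intro integral_mono int continuous_intros cp) (auto simp: indicator_def intro!: mult_right_mono)
    also have "\<dots> = (\<integral>x. ?p x * indicator {z..?R} x - z * ((?p x * (x - z)) * indicator {z..?R} x) \<partial>lborel)"
      by (intro Bochner_Integration.integral_cong) (auto simp: algebra_simps)
    also have "\<dots> = (\<integral>x. ?p x * indicator {z..?R} x \<partial>lborel) - z * (\<integral>x. (?p x * (x - z)) * indicator {z..?R} x \<partial>lborel)"
      by (subst Bochner_Integration.integral_diff) (auto intro!: int continuous_intros cp)
    finally have 2: "(\<integral>x. (?p x * (x - z)) * indicator {z..?R} x \<partial>lborel) \<le> (\<integral>x. ?p x * indicator {z..?R} x \<partial>lborel) / z"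
      using assms by (simp add: field_simps)
    have "ennreal (\<integral>x. ?p x * indicator {z..?R} x \<partial>lborel) = (\<integral>\<^sup>+x. ennreal (?p x) * indicator {z..?R} x \<partial>lborel)"
      by (intro nn[symmetric] cp) auto
    also have "\<dots> = emeasure std_normal_distribution {z..?R}" by (subst emeasure_density) auto
    finally have "(\<integral>x. ?p x * indicator {z..?R} x \<partial>lborel) = measure std_normal_distribution {z..?R}"
      by (simp add: std_normal.emeasure_eq_measure ennreal_inj integral_nonneg_AE)
    also have "\<dots> \<le> measure std_normal_distribution ({z} \<union> {z<..})"
      by (intro std_normal.finite_measure_mono) auto
    also have "\<dots> \<le> normal_tail z"
      using measure_Un_le[of "{z}" std_normal_distribution "{z<..}"]
      by (simp add: measure_std_normal_singleton normal_tail_def)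
    finally have 3: "(\<integral>x. ?p x * indicator {z..?R} x \<partial>lborel) \<le> normal_tail z" .
    have "(\<integral>\<^sup>+x. ennreal (?p x * (x - z)) * indicator {z..?R} x \<partial>lborel)
      = ennreal (\<integral>x. (?p x * (x - z)) * indicator {z..?R} x \<partial>lborel)"
      by (intro nn continuous_intros cp) auto
    also have "\<dots> \<le> ennreal (normal_tail z / z)"
      using 2 3 assms by (intro ennreal_leI) (smt (verit) divide_right_mono)
    finally show ?thesis .
  qed
  have "(\<integral>\<^sup>+x. ennreal (x - z) \<partial>std_normal_distribution) = (\<integral>\<^sup>+x. ennreal (?p x) * ennreal (x - z) \<partial>lborel)"
    by (subst nn_integral_density) auto
  also have "\<dots> = (\<integral>\<^sup>+x. (SUP N. ennreal (?p x * (x - z)) * indicator {z..z + real N} x) \<partial>lborel)"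
  proof (intro nn_integral_cong)
    fix x :: real
    show "ennreal (?p x) * ennreal (x - z) = (SUP N. ennreal (?p x * (x - z)) * indicator {z..z + real N} x)"
    proof (cases "z \<le> x")
      case True
      obtain N :: nat where N: "x - z \<le> real N" using real_arch_simple by blast
      show ?thesis
      proof (rule SUP_eqI[symmetric])
        fix y assume "\<And>i. i \<in> UNIV \<Longrightarrow> ennreal (?p x * (x - z)) * indicator {z..z + real i} x \<le> y"
        from this[of N] show "ennreal (?p x) * ennreal (x - z) \<le> y" using N True by (auto simp: ennreal_mult)
      qed (use True in \<open>auto simp: indicator_def ennreal_mult\<close>)
    qed (simp add: ennreal_neg)
  qed
  also have "\<dots> = (SUP N. \<integral>\<^sup>+x. ennreal (?p x * (x - z)) * indicator {z..z + real N} x \<partial>lborel)"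
    by (intro nn_integral_monotone_convergence_SUP) (auto simp: incseq_def le_fun_def indicator_def)
  also have "\<dots> \<le> ennreal (normal_tail z / z)" by (intro SUP_least bound)
  finally show ?thesis .
qed

section \<open>Gaussian statistics\<close>

text \<open>An affine image of the standard normal law, rather than a density, so that \<sigma> = 0
  is allowed: a linear estimator may be constant, and limits of normal statistics may
  degenerate.\<close>

definition has_normal :: "'a measure \<Rightarrow> ('a \<Rightarrow> real) \<Rightarrow> real \<Rightarrow> real \<Rightarrow> bool" where
  "has_normal P X \<mu> \<sigma> \<longleftrightarrow> X \<in> borel_measurable P \<and> 0 \<le> \<sigma> \<and>
     distr P borel X = distr std_normal_distribution borel (\<lambda>z. \<mu> + \<sigma> * z)"

lemma (in prob_space) has_normalI_char:
  assumes "X \<in> borel_measurable M" "0 \<le> \<sigma>"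
    and "\<And>t. char (distr M borel X) t = iexp (t * \<mu>) * of_real (exp (- (t * \<sigma>)\<^sup>2 / 2))"
  shows "has_normal M X \<mu> \<sigma>"
  unfolding has_normal_def
proof (intro conjI assms Levy_uniqueness)
  show "char (distr M borel X) = char (distr std_normal_distribution borel (\<lambda>z. \<mu> + \<sigma> * z))"
    by (rule ext) (simp only: assms(3) char_std_normal_affine)
qed (auto intro!: real_distribution_distr std_normal.real_distribution_distr assms)

lemma has_normal_char:
  assumes "has_normal P X \<mu> \<sigma>"
  shows "char (distr P borel X) t = iexp (t * \<mu>) * of_real (exp (- (t * \<sigma>)\<^sup>2 / 2))"
  using assms by (simp only: has_normal_def char_std_normal_affine)

lemma has_normal_measurable: "has_normal P X \<mu> \<sigma> \<Longrightarrow> X \<in> borel_measurable P"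
  by (simp add: has_normal_def)

lemma has_normal_nonneg: "has_normal P X \<mu> \<sigma> \<Longrightarrow> 0 \<le> \<sigma>"
  by (simp add: has_normal_def)

lemma has_normal_nn_integral:
  assumes "has_normal P X \<mu> \<sigma>" and [measurable]: "g \<in> borel_measurable borel"
  shows "(\<integral>\<^sup>+x. g (X x) \<partial>P) = (\<integral>\<^sup>+z. g (\<mu> + \<sigma> * z) \<partial>std_normal_distribution)"
proof -
  have "(\<integral>\<^sup>+x. g (X x) \<partial>P) = (\<integral>\<^sup>+x. g x \<partial>distr P borel X)"
    using assms by (subst nn_integral_distr) (auto simp: has_normal_def)
  also have "\<dots> = (\<integral>\<^sup>+z. g (\<mu> + \<sigma> * z) \<partial>std_normal_distribution)"
    using assms unfolding has_normal_def by (simp add: nn_integral_distr)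
  finally show ?thesis .
qed

lemma has_normal_integral:
  fixes g :: "real \<Rightarrow> real"
  assumes "has_normal P X \<mu> \<sigma>" and [measurable]: "g \<in> borel_measurable borel"
  shows "integrable P (\<lambda>x. g (X x)) \<longleftrightarrow> integrable std_normal_distribution (\<lambda>z. g (\<mu> + \<sigma> * z))"
    and "(\<integral>x. g (X x) \<partial>P) = (\<integral>z. g (\<mu> + \<sigma> * z) \<partial>std_normal_distribution)"
proof -
  have eq: "distr P borel X = distr std_normal_distribution borel (\<lambda>z. \<mu> + \<sigma> * z)"
    and [measurable]: "X \<in> borel_measurable P"
    using assms by (auto simp: has_normal_def)
  show "integrable P (\<lambda>x. g (X x)) \<longleftrightarrow> integrable std_normal_distribution (\<lambda>z. g (\<mu> + \<sigma> * z))"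
    using integrable_distr_eq[of X P borel g]
      integrable_distr_eq[of "\<lambda>z. \<mu> + \<sigma> * z" std_normal_distribution borel g] eq by simp
  show "(\<integral>x. g (X x) \<partial>P) = (\<integral>z. g (\<mu> + \<sigma> * z) \<partial>std_normal_distribution)"
    using integral_distr[of X P borel g]
      integral_distr[of "\<lambda>z. \<mu> + \<sigma> * z" std_normal_distribution borel g] eq by simp
qed

lemma std_normal_moments:
  "integrable std_normal_distribution (\<lambda>z. z)" "(\<integral>z. z \<partial>std_normal_distribution) = 0"
  "integrable std_normal_distribution (\<lambda>z. z\<^sup>2)" "(\<integral>z. z\<^sup>2 \<partial>std_normal_distribution) = 1"
  using integrable_std_normal_distribution_moment[of 1] integral_std_normal_distribution_moment_odd[of 1]
    std_normal_distribution_even_moments[of 1] by auto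

lemma has_normal_moments:
  assumes "has_normal P X \<mu> \<sigma>"
  shows "integrable P X" "(\<integral>x. X x \<partial>P) = \<mu>"
    "integrable P (\<lambda>x. (X x)\<^sup>2)" "(\<integral>x. (X x)\<^sup>2 \<partial>P) = \<mu>\<^sup>2 + \<sigma>\<^sup>2"
    "(\<integral>x. (X x - \<mu>)\<^sup>2 \<partial>P) = \<sigma>\<^sup>2"
proof -
  note [simp] = std_normal_moments
  have sq: "(\<lambda>z. (\<mu> + \<sigma> * z)\<^sup>2) = (\<lambda>z::real. \<mu>\<^sup>2 + ((2 * \<mu> * \<sigma>) * z + \<sigma>\<^sup>2 * z\<^sup>2))"
    by (auto simp: power2_eq_square algebra_simps)
  show "integrable P X" using has_normal_integral(1)[OF assms, of "\<lambda>x. x"] by simp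
  show "(\<integral>x. X x \<partial>P) = \<mu>" using has_normal_integral(2)[OF assms, of "\<lambda>x. x"]
    using std_normal.prob_space by simp
  show "integrable P (\<lambda>x. (X x)\<^sup>2)" using has_normal_integral(1)[OF assms, of "\<lambda>x. x\<^sup>2"] by (simp add: sq)
  show "(\<integral>x. (X x)\<^sup>2 \<partial>P) = \<mu>\<^sup>2 + \<sigma>\<^sup>2" using has_normal_integral(2)[OF assms, of "\<lambda>x. x\<^sup>2"]
    using std_normal.prob_space by (simp add: sq)
  show "(\<integral>x. (X x - \<mu>)\<^sup>2 \<partial>P) = \<sigma>\<^sup>2" using has_normal_integral(2)[OF assms, of "\<lambda>x. (x - \<mu>)\<^sup>2"]
    by (simp add: power_mult_distrib)
qed

lemma has_normal_uminus:
  assumes "has_normal P X \<mu> \<sigma>" shows "has_normal P (\<lambda>x. - X x) (- \<mu>) \<sigma>"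
proof -
  have [measurable]: "X \<in> borel_measurable P" and \<sigma>: "0 \<le> \<sigma>"
    and eq: "distr P borel X = distr std_normal_distribution borel (\<lambda>z. \<mu> + \<sigma> * z)"
    using assms by (auto simp: has_normal_def)
  have fn: "uminus \<circ> (\<lambda>z. \<mu> + \<sigma> * z) = (\<lambda>z. - \<mu> + \<sigma> * z) \<circ> uminus" by (simp add: fun_eq_iff)
  have "distr P borel (\<lambda>x. - X x) = distr (distr P borel X) borel uminus"
    by (subst distr_distr) (auto simp: comp_def)
  also have "\<dots> = distr std_normal_distribution borel (uminus \<circ> (\<lambda>z. \<mu> + \<sigma> * z))"
    unfolding eq by (subst distr_distr) auto
  also note fn
  also have "distr std_normal_distribution borel ((\<lambda>z. - \<mu> + \<sigma> * z) \<circ> uminus)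
    = distr (distr std_normal_distribution borel uminus) borel (\<lambda>z. - \<mu> + \<sigma> * z)"
    by (subst distr_distr) auto
  finally show ?thesis using \<sigma> by (simp add: has_normal_def distr_std_normal_uminus)
qed

lemma has_normal_add_const:
  assumes "has_normal P X \<mu> \<sigma>" shows "has_normal P (\<lambda>x. X x + c) (\<mu> + c) \<sigma>"
proof -
  have [measurable]: "X \<in> borel_measurable P" and \<sigma>: "0 \<le> \<sigma>"
    and eq: "distr P borel X = distr std_normal_distribution borel (\<lambda>z. \<mu> + \<sigma> * z)"
    using assms by (auto simp: has_normal_def)
  have "distr P borel (\<lambda>x. X x + c) = distr (distr P borel X) borel (\<lambda>x. x + c)"
    by (subst distr_distr) (auto simp: comp_def)
  also have "\<dots> = distr std_normal_distribution borel (\<lambda>z. (\<mu> + c) + \<sigma> * z)"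
    unfolding eq by (subst distr_distr) (auto simp: comp_def algebra_simps)
  finally show ?thesis using \<sigma> by (simp add: has_normal_def)
qed

lemma has_normal_distr:
  assumes "Y \<in> measurable P N" "X \<in> borel_measurable N"
  shows "has_normal (distr P N Y) X \<mu> \<sigma> \<longleftrightarrow> has_normal P (\<lambda>x. X (Y x)) \<mu> \<sigma>"
  using assms measurable_compose[OF assms] by (simp add: has_normal_def distr_distr comp_def)

text \<open>For positive \<open>z\<close> a larger standard deviation only makes an upper exceedance
  more likely, so the true \<sigma> can be replaced by a bound \<open>s\<close>. The argument avoids
  division by \<sigma>, which may be zero.\<close>

lemma has_normal_tail:
  assumes "has_normal P X \<mu> \<sigma>" "\<sigma> \<le> s" "0 < z" "\<mu> + s * z \<le> c"
  shows "measure P {x \<in> space P. c < X x} \<le> normal_tail z"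
proof -
  have \<sigma>: "0 \<le> \<sigma>" and [measurable]: "X \<in> borel_measurable P"
    and eq: "distr P borel X = distr std_normal_distribution borel (\<lambda>z. \<mu> + \<sigma> * z)"
    using assms(1) by (auto simp: has_normal_def)
  have "measure P {x \<in> space P. c < X x} = measure (distr P borel X) {c<..}"
    by (subst measure_distr) (auto intro!: arg_cong2[where f = measure])
  also have "\<dots> = measure std_normal_distribution {x. c < \<mu> + \<sigma> * x}"
    unfolding eq by (subst measure_distr) (auto intro!: arg_cong2[where f = measure])
  also have "\<dots> \<le> normal_tail z" unfolding normal_tail_def
  proof (intro std_normal.finite_measure_mono subsetI, safe)
    fix x assume "c < \<mu> + \<sigma> * x"
    hence *: "s * z < \<sigma> * x" using assms by linarith
    show "z < x"
    proof (rule ccontr)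
      assume "\<not> z < x"
      hence "\<sigma> * x \<le> \<sigma> * z" using \<sigma> by (intro mult_left_mono) auto
      also have "\<dots> \<le> s * z" using assms by (intro mult_right_mono) auto
      finally show False using * by simp
    qed
  qed simp
  finally show ?thesis .
qed

text \<open>\<open>ennreal\<close> truncates at 0, so the integrand is a positive part. It is
  dominated pointwise by \<open>s\<close> times the standard excess over \<open>z\<close>: for
  \<open>y\<close> above \<open>z\<close> because \<sigma> is at most \<open>s\<close>, and below
  \<open>z\<close> because \<open>\<sigma> * y - s * z\<close> is not positive.\<close>

lemma has_normal_excess:
  assumes "has_normal P X \<mu> \<sigma>" "\<sigma> \<le> s" "0 < z"
  shows "(\<integral>\<^sup>+x. ennreal (X x - \<mu> - s * z) \<partial>P) \<le> ennreal (s * (normal_tail z / z))"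
proof -
  have \<sigma>: "0 \<le> \<sigma>" using assms(1) by (rule has_normal_nonneg)
  have "(\<integral>\<^sup>+x. ennreal (X x - \<mu> - s * z) \<partial>P) = (\<integral>\<^sup>+y. ennreal (\<sigma> * y - s * z) \<partial>std_normal_distribution)"
    using has_normal_nn_integral[OF assms(1), of "\<lambda>x. ennreal (x - \<mu> - s * z)"] by simp
  also have "\<dots> \<le> (\<integral>\<^sup>+y. ennreal s * ennreal (y - z) \<partial>std_normal_distribution)"
  proof (intro nn_integral_mono)
    fix y :: real
    show "ennreal (\<sigma> * y - s * z) \<le> ennreal s * ennreal (y - z)"
    proof (cases "z \<le> y")
      case True
      have "\<sigma> * y \<le> s * y" using True assms by (intro mult_right_mono) auto
      thus ?thesis using True \<sigma> assms by (simp add: ennreal_mult[symmetric] right_diff_distrib ennreal_leI)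
    next
      case False
      have "\<sigma> * y \<le> \<sigma> * z" using False \<sigma> by (intro mult_left_mono) auto
      also have "\<dots> \<le> s * z" using assms by (intro mult_right_mono) auto
      finally show ?thesis by (simp add: ennreal_neg)
    qed
  qed
  also have "\<dots> = ennreal s * (\<integral>\<^sup>+y. ennreal (y - z) \<partial>std_normal_distribution)"
    by (rule nn_integral_cmult) simp
  also have "\<dots> \<le> ennreal s * ennreal (normal_tail z / z)"
    by (intro mult_left_mono std_normal_excess assms) auto
  also have "\<dots> = ennreal (s * (normal_tail z / z))"
    using \<sigma> assms by (subst ennreal_mult) (auto simp: normal_tail_def)
  finally show ?thesis .
qed

section \<open>Independent standard normal coordinates and mean square limits of normal
  statistics\<close>

abbreviation std_normal_PiM :: "'i set \<Rightarrow> ('i \<Rightarrow> real) measure" where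
  "std_normal_PiM I \<equiv> Pi\<^sub>M I (\<lambda>_. std_normal_distribution)"

lemma prob_space_std_normal_PiM: "prob_space (std_normal_PiM I)"
  by (intro prob_space_PiM std_normal.prob_space_axioms)

interpretation std_normal_prod: product_prob_space "\<lambda>_. std_normal_distribution" I for I
  by (simp add: product_prob_spaceI std_normal.prob_space_axioms)

text \<open>Independence turns the characteristic function into a product, and the variances add up
  in the exponent.\<close>

lemma has_normal_linear_combination:
  fixes c :: "'i \<Rightarrow> real"
  assumes "finite I"
  shows "has_normal (std_normal_PiM I) (\<lambda>z. \<mu> + (\<Sum>i\<in>I. c i * z i)) \<mu> (sqrt (\<Sum>i\<in>I. (c i)\<^sup>2))"
proof -
  have [measurable]: "(\<lambda>z. \<mu> + (\<Sum>i\<in>I. c i * z i)) \<in> borel_measurable (std_normal_PiM I)"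
    by measurable
  show ?thesis
  proof (rule prob_space.has_normalI_char[OF prob_space_std_normal_PiM])
    fix t :: real
    have "char (distr (std_normal_PiM I) borel (\<lambda>z. \<mu> + (\<Sum>i\<in>I. c i * z i))) t
        = (CLINT z|std_normal_PiM I. iexp (t * \<mu>) * (\<Prod>i\<in>I. iexp ((t * c i) * z i)))"
      unfolding char_def by (subst integral_distr)
        (auto simp: exp_sum[symmetric] assms exp_add[symmetric] algebra_simps sum_distrib_left
            intro!: Bochner_Integration.integral_cong)
    also have "\<dots> = iexp (t * \<mu>) * (\<Prod>i\<in>I. CLINT z|std_normal_distribution. iexp ((t * c i) * z))"
      by (subst integral_mult_right_zero, subst std_normal_prod.product_integral_prod)
         (auto simp: assms intro!: std_normal.integrable_iexp)
    also have "\<dots> = iexp (t * \<mu>) * (\<Prod>i\<in>I. char std_normal_distribution (t * c i))"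
      by (simp add: char_def)
    also have "\<dots> = iexp (t * \<mu>) * of_real (exp (- (t * sqrt (\<Sum>i\<in>I. (c i)\<^sup>2))\<^sup>2 / 2))"
      by (simp add: char_std_normal_distribution of_real_prod[symmetric] exp_sum[symmetric] assms
          power_mult_distrib sum_nonneg sum_distrib_left sum_negf sum_divide_distrib del: of_real_prod)
    finally show "char (distr (std_normal_PiM I) borel (\<lambda>z. \<mu> + (\<Sum>i\<in>I. c i * z i))) t
      = iexp (t * \<mu>) * of_real (exp (- (t * sqrt (\<Sum>i\<in>I. (c i)\<^sup>2))\<^sup>2 / 2))" .
  qed (auto intro!: sum_nonneg)
qed

text \<open>Means, variances and characteristic functions all converge.\<close>

lemma (in prob_space) has_normal_L2_limit:
  fixes S :: "nat \<Rightarrow> 'a \<Rightarrow> real"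
  assumes X[measurable]: "X \<in> borel_measurable M"
    and S: "\<And>r. \<exists>\<mu> \<sigma>. has_normal M (S r) \<mu> \<sigma>"
    and lim: "(\<lambda>r. \<integral>\<^sup>+x. ennreal ((X x - S r x)\<^sup>2) \<partial>M) \<longlonglongrightarrow> 0"
  shows "\<exists>\<mu> \<sigma>. has_normal M X \<mu> \<sigma>"
proof -
  obtain m s where N: "\<And>r. has_normal M (S r) (m r) (s r)" using S by metis
  have [measurable]: "S r \<in> borel_measurable M" for r using N has_normal_measurable by blast
  note S1 = has_normal_moments(1)[OF N] and S2 = has_normal_moments(3)[OF N]
  \<comment> \<open>A single index with finite distance already gives \<open>X\<close> a second
    moment, since \<open>X\<close> is the sum of \<open>X - S r0\<close> and
    \<open>S r0\<close>.\<close>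
  have "eventually (\<lambda>r. (\<integral>\<^sup>+x. ennreal ((X x - S r x)\<^sup>2) \<partial>M) < 1) sequentially"
    using lim by (rule order_tendstoD) simp
  then obtain r0 where "(\<integral>\<^sup>+x. ennreal ((X x - S r0 x)\<^sup>2) \<partial>M) < 1"
    unfolding eventually_sequentially by blast
  hence "integrable M (\<lambda>x. (X x - S r0 x)\<^sup>2)"
    by (intro integrableI_nonneg) (auto simp: less_top[symmetric] order_less_imp_not_less intro: order.strict_trans)
  hence "integrable M (\<lambda>x. 2 * (X x - S r0 x)\<^sup>2 + 2 * (S r0 x)\<^sup>2)" using S2 by auto
  hence X2: "integrable M (\<lambda>x. (X x)\<^sup>2)"
  proof (rule Bochner_Integration.integrable_bound)
    have "(X x)\<^sup>2 \<le> 2 * (X x - S r0 x)\<^sup>2 + 2 * (S r0 x)\<^sup>2" for x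
      using sum_squares_bound[of "X x - S r0 x" "S r0 x"] by (simp add: power2_eq_square algebra_simps)
    thus "AE x in M. norm ((X x)\<^sup>2) \<le> norm (2 * (X x - S r0 x)\<^sup>2 + 2 * (S r0 x)\<^sup>2)"
      by (intro AE_I2) auto
  qed simp
  have X1: "integrable M X" using X2 by (rule square_integrable_imp_integrable[OF X])
  have D2: "integrable M (\<lambda>x. (X x - S r x)\<^sup>2)" for r
  proof (rule Bochner_Integration.integrable_bound)
    show "integrable M (\<lambda>x. 2 * (X x)\<^sup>2 + 2 * (S r x)\<^sup>2)" using S2 X2 by auto
    have "(X x - S r x)\<^sup>2 \<le> 2 * (X x)\<^sup>2 + 2 * (S r x)\<^sup>2" for x
      using sum_squares_ge_zero[of "X x + S r x" 0] by (simp add: power2_eq_square algebra_simps)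
    thus "AE x in M. norm ((X x - S r x)\<^sup>2) \<le> norm (2 * (X x)\<^sup>2 + 2 * (S r x)\<^sup>2)" by (intro AE_I2) auto
  qed simp
  have D1: "integrable M (\<lambda>x. X x - S r x)" for r using X1 S1 by auto
  have "(\<lambda>r. ennreal (expectation (\<lambda>x. (X x - S r x)\<^sup>2))) \<longlonglongrightarrow> ennreal 0"
    using lim by (simp add: nn_integral_eq_integral[OF D2])
  hence limD: "(\<lambda>r. expectation (\<lambda>x. (X x - S r x)\<^sup>2)) \<longlonglongrightarrow> 0"
    by (subst (asm) tendsto_ennreal_iff) auto
  \<comment> \<open>Jensen's inequality, obtained from nonnegativity of the variance of the absolute
    difference.\<close>
  have abs_le: "expectation (\<lambda>x. \<bar>X x - S r x\<bar>) \<le> sqrt (expectation (\<lambda>x. (X x - S r x)\<^sup>2))" for r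
  proof -
    have "integrable M (\<lambda>x. \<bar>X x - S r x\<bar>\<^sup>2)" using D2 by simp
    moreover have "integrable M (\<lambda>x. \<bar>X x - S r x\<bar>)" using D1 by simp
    ultimately have "0 \<le> variance (\<lambda>x. \<bar>X x - S r x\<bar>)" and
      "variance (\<lambda>x. \<bar>X x - S r x\<bar>) = expectation (\<lambda>x. \<bar>X x - S r x\<bar>\<^sup>2) - (expectation (\<lambda>x. \<bar>X x - S r x\<bar>))\<^sup>2"
      by (rule_tac [2] variance_eq) auto
    thus ?thesis by (intro real_le_rsqrt) auto
  qed
  have limA: "(\<lambda>r. expectation (\<lambda>x. \<bar>X x - S r x\<bar>)) \<longlonglongrightarrow> 0"
  proof (rule tendsto_sandwich[OF _ _ tendsto_const])
    show "(\<lambda>r. sqrt (expectation (\<lambda>x. (X x - S r x)\<^sup>2))) \<longlonglongrightarrow> 0" using tendsto_real_sqrt[OF limD] by simp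
  qed (auto simp: abs_le)
  have lim_m: "m \<longlonglongrightarrow> expectation X"
  proof (rule LIM_zero_cancel, rule Lim_null_comparison[OF _ limA], rule always_eventually, rule allI)
    fix r
    have "m r - expectation X = - expectation (\<lambda>x. X x - S r x)"
      using X1 S1[of r] has_normal_moments(2)[OF N[of r]] by simp
    thus "norm (m r - expectation X) \<le> expectation (\<lambda>x. \<bar>X x - S r x\<bar>)"
      using integral_abs_bound[of M "\<lambda>x. X x - S r x"] by simp
  qed
  let ?v = "expectation (\<lambda>x. (X x)\<^sup>2) - (expectation X)\<^sup>2"
  \<comment> \<open>With \<open>D = X - S r\<close>, the square of \<open>S r\<close> differs from
    that of \<open>X\<close> by the square of \<open>D\<close> minus \<open>2 * X * D\<close>;
    Cauchy-Schwarz controls the mixed term.\<close>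
  have lim_q: "(\<lambda>r. expectation (\<lambda>x. (S r x)\<^sup>2)) \<longlonglongrightarrow> expectation (\<lambda>x. (X x)\<^sup>2)"
  proof -
    have int: "integrable M (\<lambda>x. \<bar>X x * (X x - S r x)\<bar>)" for r
    proof (rule Bochner_Integration.integrable_bound)
      show "integrable M (\<lambda>x. (X x)\<^sup>2 + (X x - S r x)\<^sup>2)" using X2 D2 by auto
      have "\<bar>X x * (X x - S r x)\<bar> \<le> (X x)\<^sup>2 + (X x - S r x)\<^sup>2" for x
        using sum_squares_bound[of "\<bar>X x\<bar>" "\<bar>X x - S r x\<bar>"] mult_nonneg_nonneg[of "\<bar>X x\<bar>" "\<bar>X x - S r x\<bar>"]
        unfolding abs_mult mult.assoc power2_abs by linarith
      thus "AE x in M. norm \<bar>X x * (X x - S r x)\<bar> \<le> norm ((X x)\<^sup>2 + (X x - S r x)\<^sup>2)" by (intro AE_I2) auto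
    qed simp
    have CS: "expectation (\<lambda>x. \<bar>X x * (X x - S r x)\<bar>)
        \<le> sqrt (expectation (\<lambda>x. (X x)\<^sup>2) * expectation (\<lambda>x. (X x - S r x)\<^sup>2))" for r
    proof -
      have "ennreal ((expectation (\<lambda>x. \<bar>X x * (X x - S r x)\<bar>))\<^sup>2)
          = (\<integral>\<^sup>+x. ennreal \<bar>X x\<bar> * ennreal \<bar>X x - S r x\<bar> \<partial>M)\<^sup>2"
        using nn_integral_eq_integral[OF int[of r]]
        by (simp add: ennreal_power[symmetric] abs_mult ennreal_mult)
      also have "\<dots> \<le> (\<integral>\<^sup>+x. (ennreal \<bar>X x\<bar>)\<^sup>2 \<partial>M) * (\<integral>\<^sup>+x. (ennreal \<bar>X x - S r x\<bar>)\<^sup>2 \<partial>M)"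
        by (rule Cauchy_Schwarz_nn_integral) auto
      also have "\<dots> = ennreal (expectation (\<lambda>x. (X x)\<^sup>2) * expectation (\<lambda>x. (X x - S r x)\<^sup>2))"
        using nn_integral_eq_integral[OF X2] nn_integral_eq_integral[OF D2[of r]]
        by (simp add: ennreal_power ennreal_mult)
      finally show ?thesis
        by (intro real_le_rsqrt) (simp add: ennreal_le_iff)
    qed
    show ?thesis
    proof (rule LIM_zero_cancel, rule Lim_null_comparison, rule always_eventually, rule allI)
      fix r
      have "expectation (\<lambda>x. (S r x)\<^sup>2) - expectation (\<lambda>x. (X x)\<^sup>2) = expectation (\<lambda>x. (S r x)\<^sup>2 - (X x)\<^sup>2)"
        using S2 X2 by simp
      also have "norm \<dots> \<le> expectation (\<lambda>x. norm ((S r x)\<^sup>2 - (X x)\<^sup>2))"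
        by (rule integral_norm_bound)
      also have "\<dots> \<le> expectation (\<lambda>x. (X x - S r x)\<^sup>2 + 2 * \<bar>X x * (X x - S r x)\<bar>)"
      proof (rule integral_mono)
        fix x
        have "(S r x)\<^sup>2 - (X x)\<^sup>2 = (X x - S r x)\<^sup>2 - 2 * (X x * (X x - S r x))"
          by (simp add: power2_eq_square algebra_simps)
        thus "norm ((S r x)\<^sup>2 - (X x)\<^sup>2) \<le> (X x - S r x)\<^sup>2 + 2 * \<bar>X x * (X x - S r x)\<bar>"
          using zero_le_power2[of "X x - S r x"] by (simp only: real_norm_def)
      qed (use S2 X2 D2 int in auto)
      also have "\<dots> = expectation (\<lambda>x. (X x - S r x)\<^sup>2) + 2 * expectation (\<lambda>x. \<bar>X x * (X x - S r x)\<bar>)"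
        using D2 int by simp
      also have "\<dots> \<le> expectation (\<lambda>x. (X x - S r x)\<^sup>2)
          + 2 * sqrt (expectation (\<lambda>x. (X x)\<^sup>2) * expectation (\<lambda>x. (X x - S r x)\<^sup>2))"
        using CS[of r] by simp
      finally show "norm (expectation (\<lambda>x. (S r x)\<^sup>2) - expectation (\<lambda>x. (X x)\<^sup>2)) \<le> \<dots>" .
    next
      have "(\<lambda>r. expectation (\<lambda>x. (X x - S r x)\<^sup>2) + 2 * sqrt (expectation (\<lambda>x. (X x)\<^sup>2)
          * expectation (\<lambda>x. (X x - S r x)\<^sup>2))) \<longlonglongrightarrow> 0 + 2 * sqrt (expectation (\<lambda>x. (X x)\<^sup>2) * 0)"
        by (intro tendsto_intros limD)
      thus "(\<lambda>r. expectation (\<lambda>x. (X x - S r x)\<^sup>2) + 2 * sqrt (expectation (\<lambda>x. (X x)\<^sup>2)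
          * expectation (\<lambda>x. (X x - S r x)\<^sup>2))) \<longlonglongrightarrow> 0" by simp
    qed
  qed
  have "(\<lambda>r. (s r)\<^sup>2) \<longlonglongrightarrow> ?v"
  proof -
    have "(\<lambda>r. expectation (\<lambda>x. (S r x)\<^sup>2) - (m r)\<^sup>2) \<longlonglongrightarrow> ?v"
      by (intro tendsto_intros lim_q lim_m)
    thus ?thesis by (simp add: has_normal_moments(4)[OF N])
  qed
  moreover from this have v: "0 \<le> ?v" by (rule LIMSEQ_le_const) auto
  ultimately have lim_s: "(\<lambda>r. (s r)\<^sup>2) \<longlonglongrightarrow> (sqrt ?v)\<^sup>2" by simp
  have "has_normal M X (expectation X) (sqrt ?v)"
  proof (rule has_normalI_char)
    show "0 \<le> sqrt ?v" using v by simp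
    fix t
    \<comment> \<open>The map \<open>iexp\<close> is Lipschitz with constant 1, so characteristic
      functions at \<open>t\<close> differ by at most \<open>\<bar>t\<bar>\<close> times the mean
      absolute difference.\<close>
    have "(\<lambda>r. char (distr M borel (S r)) t) \<longlonglongrightarrow> char (distr M borel X) t"
    proof (rule LIM_zero_cancel, rule Lim_null_comparison)
      show "(\<lambda>r. \<bar>t\<bar> * expectation (\<lambda>x. \<bar>X x - S r x\<bar>)) \<longlonglongrightarrow> 0"
        using tendsto_mult_right_zero[OF limA] .
      show "\<forall>\<^sub>F r in sequentially. norm (char (distr M borel (S r)) t - char (distr M borel X) t)
          \<le> \<bar>t\<bar> * expectation (\<lambda>x. \<bar>X x - S r x\<bar>)"
      proof (intro always_eventually allI)
        fix r
        have i: "integrable M (\<lambda>x. iexp (t * X x))" "integrable M (\<lambda>x. iexp (t * S r x))"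
          by (auto intro!: integrable_iexp)
        have "norm (char (distr M borel (S r)) t - char (distr M borel X) t)
          = norm (CLINT x|M. iexp (t * S r x) - iexp (t * X x))"
          unfolding char_def using i by (simp add: integral_distr)
        also have "\<dots> \<le> expectation (\<lambda>x. norm (iexp (t * S r x) - iexp (t * X x)))"
          by (rule integral_norm_bound)
        also have "\<dots> \<le> expectation (\<lambda>x. \<bar>t\<bar> * \<bar>X x - S r x\<bar>)"
        proof (rule integral_mono)
          fix x
          have "norm (iexp (t * S r x) - iexp (t * X x))
            = norm (iexp (t * X x)) * norm (iexp (t * (S r x - X x)) - 1)"
            unfolding norm_mult[symmetric] by (simp add: exp_add[symmetric] algebra_simps)
          also have "\<dots> \<le> \<bar>t\<bar> * \<bar>X x - S r x\<bar>"
            using iexp_approx1[of "t * (S r x - X x)" 0] by (simp add: abs_mult abs_minus_commute)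
          finally show "norm (iexp (t * S r x) - iexp (t * X x)) \<le> \<bar>t\<bar> * \<bar>X x - S r x\<bar>" .
        qed (use i D1 in auto)
        finally show "norm (char (distr M borel (S r)) t - char (distr M borel X) t)
          \<le> \<bar>t\<bar> * expectation (\<lambda>x. \<bar>X x - S r x\<bar>)" by simp
      qed
    qed
    moreover have "(\<lambda>r. char (distr M borel (S r)) t)
      \<longlonglongrightarrow> iexp (t * expectation X) * of_real (exp (- (t * sqrt ?v)\<^sup>2 / 2))"
      unfolding has_normal_char[OF N] power_mult_distrib
      by (intro tendsto_intros lim_m lim_s) auto
    ultimately show "char (distr M borel X) t
      = iexp (t * expectation X) * of_real (exp (- (t * sqrt ?v)\<^sup>2 / 2))"
      by (rule LIMSEQ_unique)
  qed simp
  thus ?thesis by blast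
qed

section \<open>Testing between shifts of a Gaussian vector\<close>

text \<open>The Cameron-Martin formula in dimension one: translating the Gaussian density by
  \<open>t\<close> multiplies it by \<open>exp (t * x - t\<^sup>2 / 2)\<close>.\<close>

lemma emeasure_std_normal_shift:
  assumes [measurable]: "A \<in> sets borel"
  shows "emeasure std_normal_distribution {x. x + t \<in> A}
    = (\<integral>\<^sup>+x. ennreal (exp (t * x - t\<^sup>2 / 2)) * indicator A x \<partial>std_normal_distribution)"
proof -
  have "emeasure std_normal_distribution {x. x + t \<in> A}
    = (\<integral>\<^sup>+x. ennreal (std_normal_density x) * indicator {x. x + t \<in> A} x \<partial>lborel)"
    by (subst emeasure_density) auto
  also have "\<dots> = (\<integral>\<^sup>+x. ennreal (std_normal_density (- t + 1 * x)) * indicator {x. x + t \<in> A} (- t + 1 * x) \<partial>lborel)"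
    by (subst nn_integral_real_affine[where c = 1 and t = "- t"]) auto
  also have "\<dots> = (\<integral>\<^sup>+x. ennreal (std_normal_density x) * (ennreal (exp (t * x - t\<^sup>2 / 2)) * indicator A x) \<partial>lborel)"
  proof (rule nn_integral_cong)
    fix x
    have "std_normal_density (- t + x) = std_normal_density x * exp (t * x - t\<^sup>2 / 2)"
      by (simp add: std_normal_density_def exp_add[symmetric] power2_eq_square field_simps)
    thus "ennreal (std_normal_density (- t + 1 * x)) * indicator {x. x + t \<in> A} (- t + 1 * x)
      = ennreal (std_normal_density x) * (ennreal (exp (t * x - t\<^sup>2 / 2)) * indicator A x)"
      by (simp add: ennreal_mult indicator_def)
  qed
  also have "\<dots> = (\<integral>\<^sup>+x. ennreal (exp (t * x - t\<^sup>2 / 2)) * indicator A x \<partial>std_normal_distribution)"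
    by (subst nn_integral_density) auto
  finally show ?thesis .
qed

text \<open>In both models finitely many coordinates are a fixed image of a standard normal vector
  translated in this way, and the truth enters through \<open>b\<close> alone. The restriction to
  \<open>I\<close> keeps the result inside the product space.\<close>

definition shift_on :: "'i set \<Rightarrow> ('i \<Rightarrow> real) \<Rightarrow> ('i \<Rightarrow> real) \<Rightarrow> 'i \<Rightarrow> real" where
  "shift_on I b z = (\<lambda>i\<in>I. z i + b i)"

lemma measurable_shift_on [measurable]: "shift_on I b \<in> measurable (std_normal_PiM I) (std_normal_PiM I)"
  unfolding shift_on_def by measurable

lemma shift_on_add: "shift_on I b (shift_on I a z) = shift_on I (\<lambda>i. a i + b i) z"
  by (auto simp: shift_on_def)

text \<open>On boxes both sides factor into one-dimensional integrals, and boxes determine a finite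
  product measure. The density is the likelihood ratio on which the test below is based.\<close>

lemma distr_shift_on:
  fixes \<theta> :: "'i \<Rightarrow> real"
  assumes "finite I"
  shows "distr (std_normal_PiM I) (std_normal_PiM I) (shift_on I \<theta>)
    = density (std_normal_PiM I) (\<lambda>z. ennreal (exp ((\<Sum>i\<in>I. \<theta> i * z i) - (\<Sum>i\<in>I. (\<theta> i)\<^sup>2) / 2)))"
    (is "?P = ?Q")
proof -
  interpret P: prob_space ?P
    by (intro prob_space.prob_space_distr prob_space_std_normal_PiM measurable_shift_on)
  show ?thesis
  proof (rule measure_eqI_PiM_finite[where A = "\<lambda>_. space (std_normal_PiM I)"])
    fix A :: "'i \<Rightarrow> real set" assume "\<And>i. i \<in> I \<Longrightarrow> A i \<in> sets std_normal_distribution"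
    hence A: "\<And>i. i \<in> I \<Longrightarrow> A i \<in> sets borel" by simp
    have box: "Pi\<^sub>E I A \<in> sets (std_normal_PiM I)"
      using A assms by (intro sets_PiM_I_finite) auto
    have "emeasure ?P (Pi\<^sub>E I A) = emeasure (std_normal_PiM I) (\<Pi>\<^sub>E i\<in>I. {x. x + \<theta> i \<in> A i})"
      using box by (subst emeasure_distr)
        (auto simp: space_PiM shift_on_def PiE_iff extensional_def intro!: arg_cong2[where f = emeasure])
    also have "\<dots> = (\<Prod>i\<in>I. emeasure std_normal_distribution {x. x + \<theta> i \<in> A i})"
      using A assms by (intro std_normal_prod.emeasure_PiM) auto
    also have "\<dots> = (\<Prod>i\<in>I. \<integral>\<^sup>+x. ennreal (exp (\<theta> i * x - (\<theta> i)\<^sup>2 / 2)) * indicator (A i) x \<partial>std_normal_distribution)"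
      using A by (intro prod.cong refl emeasure_std_normal_shift) auto
    also have "\<dots> = (\<integral>\<^sup>+z. (\<Prod>i\<in>I. ennreal (exp (\<theta> i * z i - (\<theta> i)\<^sup>2 / 2)) * indicator (A i) (z i)) \<partial>std_normal_PiM I)"
      using A by (intro std_normal_prod.product_nn_integral_prod[symmetric] assms) auto
    also have "\<dots> = (\<integral>\<^sup>+z. ennreal (exp ((\<Sum>i\<in>I. \<theta> i * z i) - (\<Sum>i\<in>I. (\<theta> i)\<^sup>2) / 2)) * indicator (Pi\<^sub>E I A) z \<partial>std_normal_PiM I)"
    proof (intro nn_integral_cong)
      fix z assume z: "z \<in> space (std_normal_PiM I)"
      have "(\<Prod>i\<in>I. indicator (A i) (z i)) = (indicator (Pi\<^sub>E I A) z :: ennreal)"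
        using z assms by (auto simp: indicator_def space_PiM PiE_iff)
      moreover have "(\<Prod>i\<in>I. ennreal (exp (\<theta> i * z i - (\<theta> i)\<^sup>2 / 2)))
        = ennreal (exp ((\<Sum>i\<in>I. \<theta> i * z i) - (\<Sum>i\<in>I. (\<theta> i)\<^sup>2) / 2))"
        by (simp add: prod_ennreal exp_sum[symmetric] assms sum_subtractf sum_divide_distrib)
      ultimately show "(\<Prod>i\<in>I. ennreal (exp (\<theta> i * z i - (\<theta> i)\<^sup>2 / 2)) * indicator (A i) (z i))
        = ennreal (exp ((\<Sum>i\<in>I. \<theta> i * z i) - (\<Sum>i\<in>I. (\<theta> i)\<^sup>2) / 2)) * indicator (Pi\<^sub>E I A) z"
        by (simp add: prod.distrib)
    qed
    also have "\<dots> = emeasure ?Q (Pi\<^sub>E I A)"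
      using box by (subst emeasure_density) auto
    finally show "emeasure ?P (Pi\<^sub>E I A) = emeasure ?Q (Pi\<^sub>E I A)" .
  qed (use assms space_in_prod_algebra[of I "\<lambda>_. std_normal_distribution"] in \<open>auto simp: space_PiM\<close>)
qed

text \<open>\<open>B\<close> is compared with the Neyman--Pearson test of level \<open>\<alpha>\<close>, which rejects for large values of
  \<open>\<Sum>\<^sub>i \<theta> i * z i\<close>.  The excess of the level of \<open>B\<close> over \<open>\<alpha>\<close> is kept in the statement since cylinder
  sets only approximate the sets of interest.\<close>

lemma neyman_pearson_shift:
  fixes \<theta> :: "'i \<Rightarrow> real"
  assumes I: "finite I" and \<alpha>: "0 < \<alpha>" "\<alpha> < 1/2" and B[measurable]: "B \<in> sets (std_normal_PiM I)"
    and le: "(\<Sum>i\<in>I. (\<theta> i)\<^sup>2) \<le> (z_quantile \<alpha>)\<^sup>2"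
  shows "measure (std_normal_PiM I) (shift_on I \<theta> -` B \<inter> space (std_normal_PiM I))
    \<le> 1/2 + exp ((z_quantile \<alpha>)\<^sup>2 / 2) * max 0 (measure (std_normal_PiM I) B - \<alpha>)"
proof -
  let ?\<mu> = "std_normal_PiM I"
  define \<nu> where "\<nu> = distr ?\<mu> ?\<mu> (shift_on I \<theta>)"
  define \<delta> where "\<delta> = sqrt (\<Sum>i\<in>I. (\<theta> i)\<^sup>2)"
  define q where "q = z_quantile \<alpha>"
  note \<mu>_eq = finite_measure.emeasure_eq_measure[OF prob_space.finite_measure[OF prob_space_std_normal_PiM]]
  interpret \<nu>: prob_space \<nu>
    unfolding \<nu>_def by (intro prob_space.prob_space_distr prob_space_std_normal_PiM measurable_shift_on)
  have [simp]: "sets \<nu> = sets ?\<mu>" "space \<nu> = space ?\<mu>" by (auto simp: \<nu>_def)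
  have q: "0 < q" using \<alpha> unfolding q_def by (rule z_quantile_pos)
  have \<delta>: "0 \<le> \<delta>" "\<delta>\<^sup>2 = (\<Sum>i\<in>I. (\<theta> i)\<^sup>2)" by (auto simp: \<delta>_def sum_nonneg)
  have \<delta>q: "\<delta> \<le> q"
    by (rule power2_le_imp_le) (use le \<delta> q in \<open>auto simp: q_def\<close>)
  have eq: "measure \<nu> B = measure ?\<mu> (shift_on I \<theta> -` B \<inter> space ?\<mu>)"
    unfolding \<nu>_def by (subst measure_distr) auto
  show ?thesis
  \<comment> \<open>For \<delta> = 0 the two laws coincide and the test statistic is degenerate; the
    claim then rests on \<alpha> < 1/2 alone.\<close>
  proof (cases "\<delta> = 0")
    case True
    hence "\<forall>i\<in>I. \<theta> i = 0" using \<delta>(2) I by (simp add: sum_nonneg_eq_0_iff)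
    hence "shift_on I \<theta> z = z" if "z \<in> space ?\<mu>" for z
      using that by (auto simp: shift_on_def space_PiM PiE_def extensional_def)
    hence "shift_on I \<theta> -` B \<inter> space ?\<mu> = B" using sets.sets_into_space[OF B] by auto
    moreover have "1 * max 0 (measure ?\<mu> B - \<alpha>) \<le> exp (q\<^sup>2 / 2) * max 0 (measure ?\<mu> B - \<alpha>)"
      by (intro mult_right_mono) auto
    ultimately show ?thesis using \<alpha> unfolding q_def by auto
  next
    case False
    hence \<delta>0: "0 < \<delta>" using \<delta> by simp
    define S where "S z = (\<Sum>i\<in>I. \<theta> i * z i)" for z
    \<comment> \<open>The rejection region. Since \<open>S\<close> is normal with mean 0 and
      standard deviation \<delta>, the threshold \<open>\<delta> * q\<close> gives it level exactly
      \<alpha>.\<close>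
    define R where "R = {z \<in> space ?\<mu>. \<delta> * q < S z}"
    have [measurable]: "S \<in> borel_measurable ?\<mu>" unfolding S_def by measurable
    have R[measurable]: "R \<in> sets ?\<mu>" unfolding R_def by measurable
    have N: "has_normal ?\<mu> S 0 \<delta>"
      using has_normal_linear_combination[OF I, of 0 \<theta>] by (simp add: S_def[abs_def] \<delta>_def)
    have tail: "measure ?\<mu> {z \<in> space ?\<mu>. \<delta> * c < S z} = normal_tail c" for c
    proof -
      have "measure ?\<mu> {z \<in> space ?\<mu>. \<delta> * c < S z} = measure (distr ?\<mu> borel S) {\<delta> * c<..}"
        by (subst measure_distr) (auto intro!: arg_cong2[where f = measure])
      also have "\<dots> = measure std_normal_distribution {x. \<delta> * c < 0 + \<delta> * x}"
        using N unfolding has_normal_def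
        by (simp add: measure_distr vimage_def)
      finally show ?thesis using \<delta>0 by (simp add: normal_tail_def greaterThan_def)
    qed
    have \<mu>R: "measure ?\<mu> R = \<alpha>"
      using \<alpha> unfolding R_def tail q_def by (intro normal_tail_z_quantile) auto
    \<comment> \<open>The shift raises \<open>S\<close> by \<open>\<delta>\<^sup>2\<close>, so the
      power is the normal tail at \<open>q - \<delta>\<close>, which is at most 1/2 because \<delta>
      is at most \<open>q\<close>.\<close>
    have "measure \<nu> R = measure ?\<mu> {z \<in> space ?\<mu>. \<delta> * (q - \<delta>) < S z}"
    proof -
      have "S (shift_on I \<theta> z) = S z + \<delta>\<^sup>2" for z
        unfolding \<delta>(2) by (simp add: S_def shift_on_def distrib_left sum.distrib power2_eq_square)
      hence "shift_on I \<theta> -` R \<inter> space ?\<mu> = {z \<in> space ?\<mu>. \<delta> * (q - \<delta>) < S z}"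
        using measurable_space[OF measurable_shift_on, of _ I \<theta>]
        by (auto simp: R_def power2_eq_square algebra_simps)
      thus ?thesis unfolding \<nu>_def by (subst measure_distr) auto
    qed
    also have "\<dots> \<le> 1/2" unfolding tail using \<delta>q normal_tail_mono[of 0 "q - \<delta>"] by (simp add: normal_tail_0)
    finally have \<nu>R: "measure \<nu> R \<le> 1/2" .
    define L where "L z = exp (S z - \<delta>\<^sup>2 / 2)" for z
    define l where "l = exp (\<delta> * q - \<delta>\<^sup>2 / 2)"
    have [measurable]: "L \<in> borel_measurable ?\<mu>" unfolding L_def by measurable
    have dens: "emeasure \<nu> A = (\<integral>\<^sup>+z. ennreal (L z) * indicator A z \<partial>?\<mu>)" if "A \<in> sets ?\<mu>" for A
      using that unfolding \<nu>_def distr_shift_on[OF I] L_def S_def \<delta>(2) by (subst emeasure_density) auto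
    \<comment> \<open>The Neyman-Pearson inequality: \<open>L - l\<close> is positive exactly on
      \<open>R\<close>, so exchanging \<open>B\<close> for \<open>R\<close> cannot lower its
      integral. Sums stand on both sides since \<open>ennreal\<close> has only truncated
      subtraction.\<close>
    have "emeasure \<nu> B + ennreal l * emeasure ?\<mu> R
        = (\<integral>\<^sup>+z. ennreal (L z) * indicator B z + ennreal l * indicator R z \<partial>?\<mu>)"
      by (simp add: dens nn_integral_add nn_integral_cmult)
    also have "\<dots> \<le> (\<integral>\<^sup>+z. ennreal (L z) * indicator R z + ennreal l * indicator B z \<partial>?\<mu>)"
    proof (intro nn_integral_mono)
      fix z assume z: "z \<in> space ?\<mu>"
      have "l < L z \<longleftrightarrow> z \<in> R" using z by (auto simp: l_def L_def R_def)
      thus "ennreal (L z) * indicator B z + ennreal l * indicator R z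
        \<le> ennreal (L z) * indicator R z + ennreal l * indicator B z"
        by (auto simp: indicator_def not_less intro!: ennreal_leI)
    qed
    also have "\<dots> = emeasure \<nu> R + ennreal l * emeasure ?\<mu> B"
      by (simp add: dens nn_integral_add nn_integral_cmult)
    finally have "ennreal (measure \<nu> B + l * measure ?\<mu> R) \<le> ennreal (measure \<nu> R + l * measure ?\<mu> B)"
      by (simp add: \<nu>.emeasure_eq_measure \<mu>_eq ennreal_mult[symmetric] ennreal_plus[symmetric] l_def del: ennreal_plus)
    hence "measure \<nu> B + l * measure ?\<mu> R \<le> measure \<nu> R + l * measure ?\<mu> B"
      by (subst (asm) ennreal_le_iff) (auto simp: l_def)
    hence "measure \<nu> B \<le> 1/2 + l * (measure ?\<mu> B - \<alpha>)" using \<nu>R \<mu>R by (simp add: algebra_simps)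
    also have "l * (measure ?\<mu> B - \<alpha>) \<le> l * max 0 (measure ?\<mu> B - \<alpha>)"
      by (intro mult_left_mono) (auto simp: l_def)
    also have "\<dots> \<le> exp (q\<^sup>2 / 2) * max 0 (measure ?\<mu> B - \<alpha>)"
    proof (intro mult_right_mono)
      \<comment> \<open>Completing the square, \<open>(q - \<delta>)\<^sup>2\<close> being
        nonnegative. The bound depends neither on \<theta> nor on \<open>I\<close>, which gives one
        constant for all cylinders.\<close>
      show "l \<le> exp (q\<^sup>2 / 2)"
        using zero_le_power2[of "q - \<delta>"] by (simp add: l_def power2_eq_square algebra_simps)
    qed (auto simp: l_def)
    finally show ?thesis unfolding eq q_def by simp
  qed
qed

text \<open>Pulling \<open>B\<close> back along the shift by \<open>a\<close> reduces the pair to no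
  shift and the shift by \<open>b - a\<close>.\<close>

lemma neyman_pearson_shifts:
  fixes a b :: "'i \<Rightarrow> real"
  assumes I: "finite I" and \<alpha>: "0 < \<alpha>" "\<alpha> < 1/2" and B[measurable]: "B \<in> sets (std_normal_PiM I)"
    and le: "(\<Sum>i\<in>I. (b i - a i)\<^sup>2) \<le> (z_quantile \<alpha>)\<^sup>2"
  shows "measure (std_normal_PiM I) (shift_on I b -` B \<inter> space (std_normal_PiM I))
    \<le> 1/2 + exp ((z_quantile \<alpha>)\<^sup>2 / 2)
        * max 0 (measure (std_normal_PiM I) (shift_on I a -` B \<inter> space (std_normal_PiM I)) - \<alpha>)"
proof -
  have "shift_on I (\<lambda>i. b i - a i) -` (shift_on I a -` B \<inter> space (std_normal_PiM I)) \<inter> space (std_normal_PiM I)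
    = shift_on I b -` B \<inter> space (std_normal_PiM I)"
    using measurable_space[OF measurable_shift_on] by (auto simp: shift_on_add)
  thus ?thesis
    using neyman_pearson_shift[OF I \<alpha> _ le, of "shift_on I a -` B \<inter> space (std_normal_PiM I)"] by simp
qed

subsection \<open>Approximation by cylinder sets\<close>

definition cylinder :: "'i set \<Rightarrow> 'i set \<Rightarrow> ('i \<Rightarrow> real) set \<Rightarrow> ('i \<Rightarrow> real) set" where
  "cylinder K J B = {y \<in> space (Pi\<^sub>M K (\<lambda>_. borel)). restrict y J \<in> B}"

lemma cylinder_measurable:
  assumes "J \<subseteq> K" "B \<in> sets (Pi\<^sub>M J (\<lambda>_. borel))"
  shows "cylinder K J B \<in> sets (Pi\<^sub>M K (\<lambda>_. borel))"
proof -
  have "(\<lambda>y. restrict y J) \<in> measurable (Pi\<^sub>M K (\<lambda>_. borel)) (Pi\<^sub>M J (\<lambda>_. borel))"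
    using assms by (intro measurable_restrict_subset)
  from measurable_sets[OF this assms(2)] show ?thesis by (simp add: cylinder_def vimage_def Int_def conj_commute)
qed

text \<open>A finite union of cylinders is again a cylinder only after all of them are written over
  a common set of coordinates.\<close>

lemma cylinder_enlarge:
  assumes "J \<subseteq> J'" "J' \<subseteq> K" "B \<in> sets (Pi\<^sub>M J (\<lambda>_. borel))"
  obtains B' where "B' \<in> sets (Pi\<^sub>M J' (\<lambda>_. borel))" "cylinder K J' B' = cylinder K J B"
proof
  have "(\<lambda>y. restrict y J) \<in> measurable (Pi\<^sub>M J' (\<lambda>_. borel)) (Pi\<^sub>M J (\<lambda>_. borel))"
    using assms by (intro measurable_restrict_subset)
  from measurable_sets[OF this assms(3)]
  show "(\<lambda>y. restrict y J) -` B \<inter> space (Pi\<^sub>M J' (\<lambda>_. borel)) \<in> sets (Pi\<^sub>M J' (\<lambda>_. borel))" .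
  show "cylinder K J' ((\<lambda>y. restrict y J) -` B \<inter> space (Pi\<^sub>M J' (\<lambda>_. borel))) = cylinder K J B"
    using assms(1,2) by (auto simp: cylinder_def space_PiM Int_absorb1)
qed

text \<open>A single cylinder has to serve both measures, because the testing bound compares
  \<open>P\<close> and \<open>Q\<close> on the same set. The sets that can be approximated in this
  way form a \<sigma>-algebra containing the coordinate events.\<close>

lemma cylinder_approximation:
  fixes P Q :: "('i \<Rightarrow> real) measure"
  assumes P: "prob_space P" "sets P = sets (Pi\<^sub>M K (\<lambda>_. borel))"
    and Q: "prob_space Q" "sets Q = sets (Pi\<^sub>M K (\<lambda>_. borel))"
    and A: "A \<in> sets (Pi\<^sub>M K (\<lambda>_. borel))" and e: "0 < (e::real)"
  shows "\<exists>J B. finite J \<and> J \<subseteq> K \<and> B \<in> sets (Pi\<^sub>M J (\<lambda>_. borel)) \<and>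
    measure P (sym_diff A (cylinder K J B)) < e \<and> measure Q (sym_diff A (cylinder K J B)) < e"
proof -
  interpret P: prob_space P by fact
  interpret Q: prob_space Q by fact
  let ?S = "Pi\<^sub>M K (\<lambda>_. borel) :: ('i \<Rightarrow> real) measure"
  have A': "A \<in> sigma_sets (\<Pi>\<^sub>E i\<in>K. space borel) {{f \<in> \<Pi>\<^sub>E i\<in>K. space borel. f i \<in> A} |i A. i \<in> K \<and> A \<in> sets borel}"
    using A by (simp only: sets_PiM_single)
  show ?thesis using A' e
  proof (induction arbitrary: e rule: sigma_sets.induct)
    case (Basic a)
    then obtain i C where a: "a = {f \<in> \<Pi>\<^sub>E i\<in>K. space borel. f i \<in> C}" "i \<in> K" "C \<in> sets borel" by blast
    have "{f \<in> space (Pi\<^sub>M {i} (\<lambda>_. borel)). f i \<in> C} \<in> sets (Pi\<^sub>M {i} (\<lambda>_. borel))"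
      using a by measurable
    moreover have "cylinder K {i} {f \<in> space (Pi\<^sub>M {i} (\<lambda>_. borel)). f i \<in> C} = a"
      using a by (auto simp: cylinder_def space_PiM)
    ultimately show ?case using a Basic.prems
      by (intro exI[of _ "{i}"] exI[of _ "{f \<in> space (Pi\<^sub>M {i} (\<lambda>_. borel)). f i \<in> C}"]) auto
  next
    case Empty
    thus ?case by (intro exI[of _ "{}"]) (auto simp: cylinder_def)
  next
    case (Compl a)
    from Compl.IH[OF Compl.prems] obtain J B where J: "finite J" "J \<subseteq> K" "B \<in> sets (Pi\<^sub>M J (\<lambda>_. borel))"
      and *: "measure P (sym_diff a (cylinder K J B)) < e" "measure Q (sym_diff a (cylinder K J B)) < e" by blast
    have a: "a \<subseteq> space ?S"
      using Compl.hyps sigma_sets_into_sp[of "{{f \<in> \<Pi>\<^sub>E i\<in>K. space borel. f i \<in> A} |i A. i \<in> K \<and> A \<in> sets borel}" "\<Pi>\<^sub>E i\<in>K. space borel" a]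
      by (auto simp: space_PiM)
    have "sym_diff ((\<Pi>\<^sub>E i\<in>K. space borel) - a) (cylinder K J (space (Pi\<^sub>M J (\<lambda>_. borel)) - B)) = sym_diff a (cylinder K J B)"
      using a J by (auto simp: cylinder_def space_PiM)
    thus ?case using J *
      by (intro exI[of _ J] exI[of _ "space (Pi\<^sub>M J (\<lambda>_. borel)) - B"]) auto
  next
    case (Union a)
    have aS: "a i \<in> sets ?S" for i using Union.hyps[of i] by (simp only: sets_PiM_single)
    have lim: "\<exists>N. measure R ((\<Union>i. a i) - (\<Union>i<N. a i)) < e / 2"
      if R: "prob_space R" "sets R = sets ?S" for R
    proof -
      interpret R: prob_space R by fact
      have "(\<lambda>N. measure R (\<Union>i<N. a i)) \<longlonglongrightarrow> measure R (\<Union>N. \<Union>i<N. a i)"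
        using aS R by (intro R.finite_Lim_measure_incseq) (auto simp: incseq_def, force)
      moreover have "(\<Union>N. \<Union>i<N. a i) = (\<Union>i. a i)" by auto
      ultimately have "eventually (\<lambda>N. measure R (\<Union>i. a i) - e / 2 < measure R (\<Union>i<N. a i)) sequentially"
        using Union.prems by (intro order_tendstoD) auto
      then obtain N where "measure R (\<Union>i. a i) - e / 2 < measure R (\<Union>i<N. a i)"
        unfolding eventually_sequentially by blast
      moreover have "measure R ((\<Union>i. a i) - (\<Union>i<N. a i)) = measure R (\<Union>i. a i) - measure R (\<Union>i<N. a i)"
        using aS R by (intro R.finite_measure_Diff) auto
      ultimately show ?thesis by (intro exI[of _ N]) simp
    qed
    obtain N1 N2 where N1: "measure P ((\<Union>i. a i) - (\<Union>i<N1. a i)) < e / 2"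
      and N2: "measure Q ((\<Union>i. a i) - (\<Union>i<N2. a i)) < e / 2" using lim P Q by meson
    \<comment> \<open>The maximum keeps both tails below \<open>e / 2\<close>, and
      \<open>Suc\<close> makes \<open>N\<close> positive, so that the other half of \<open>e\<close>
      can be split into \<open>N\<close> equal parts.\<close>
    define N where "N = Suc (max N1 N2)"
    have N: "measure P ((\<Union>i. a i) - (\<Union>i<N. a i)) < e / 2" "measure Q ((\<Union>i. a i) - (\<Union>i<N. a i)) < e / 2"
    proof -
      have "measure P ((\<Union>i. a i) - (\<Union>i<N. a i)) \<le> measure P ((\<Union>i. a i) - (\<Union>i<N1. a i))"
        using aS P by (intro P.finite_measure_mono) (auto simp: N_def)
      thus "measure P ((\<Union>i. a i) - (\<Union>i<N. a i)) < e / 2" using N1 by simp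
      have "measure Q ((\<Union>i. a i) - (\<Union>i<N. a i)) \<le> measure Q ((\<Union>i. a i) - (\<Union>i<N2. a i))"
        using aS Q by (intro Q.finite_measure_mono) (auto simp: N_def)
      thus "measure Q ((\<Union>i. a i) - (\<Union>i<N. a i)) < e / 2" using N2 by simp
    qed
    have "0 < e / (2 * real N)" using Union.prems by (simp add: N_def)
    hence "\<forall>i. \<exists>J B. finite J \<and> J \<subseteq> K \<and> B \<in> sets (Pi\<^sub>M J (\<lambda>_. borel)) \<and>
        measure P (sym_diff (a i) (cylinder K J B)) < e / (2 * real N) \<and>
        measure Q (sym_diff (a i) (cylinder K J B)) < e / (2 * real N)"
      using Union.IH by blast
    then obtain J B where J: "\<And>i. finite (J i)" "\<And>i. J i \<subseteq> K" "\<And>i. B i \<in> sets (Pi\<^sub>M (J i) (\<lambda>_. borel))"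
      and *: "\<And>i. measure P (sym_diff (a i) (cylinder K (J i) (B i))) < e / (2 * real N)"
        "\<And>i. measure Q (sym_diff (a i) (cylinder K (J i) (B i))) < e / (2 * real N)" by metis
    define JJ where "JJ = (\<Union>i<N. J i)"
    have JJ: "finite JJ" "JJ \<subseteq> K" using J by (auto simp: JJ_def)
    have "\<forall>i\<in>{..<N}. \<exists>B'. B' \<in> sets (Pi\<^sub>M JJ (\<lambda>_. borel)) \<and> cylinder K JJ B' = cylinder K (J i) (B i)"
    proof
      fix i assume "i \<in> {..<N}"
      hence "J i \<subseteq> JJ" by (auto simp: JJ_def)
      from cylinder_enlarge[OF this JJ(2) J(3)[of i]]
      show "\<exists>B'. B' \<in> sets (Pi\<^sub>M JJ (\<lambda>_. borel)) \<and> cylinder K JJ B' = cylinder K (J i) (B i)" by metis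
    qed
    then obtain B' where B': "\<And>i. i < N \<Longrightarrow> B' i \<in> sets (Pi\<^sub>M JJ (\<lambda>_. borel))"
      "\<And>i. i < N \<Longrightarrow> cylinder K JJ (B' i) = cylinder K (J i) (B i)" by (metis lessThan_iff)
    have un: "cylinder K JJ (\<Union>i<N. B' i) = (\<Union>i<N. cylinder K JJ (B' i))"
      by (auto simp: cylinder_def)
    have meas: "measure R (sym_diff (\<Union>i. a i) (cylinder K JJ (\<Union>i<N. B' i))) < e"
      if R: "prob_space R" "sets R = sets ?S" and R1: "measure R ((\<Union>i. a i) - (\<Union>i<N. a i)) < e / 2"
        and R2: "\<And>i. measure R (sym_diff (a i) (cylinder K (J i) (B i))) < e / (2 * real N)" for R
    proof -
      interpret R: prob_space R by fact
      have c: "cylinder K (J i) (B i) \<in> sets R" for i using J R by (auto intro!: cylinder_measurable)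
      have a: "a i \<in> sets R" for i using aS R by simp
      have "sym_diff (\<Union>i. a i) (cylinder K JJ (\<Union>i<N. B' i))
        \<subseteq> ((\<Union>i. a i) - (\<Union>i<N. a i)) \<union> (\<Union>i<N. sym_diff (a i) (cylinder K (J i) (B i)))"
        unfolding un using B'(2) by auto
      hence "measure R (sym_diff (\<Union>i. a i) (cylinder K JJ (\<Union>i<N. B' i)))
        \<le> measure R (((\<Union>i. a i) - (\<Union>i<N. a i)) \<union> (\<Union>i<N. sym_diff (a i) (cylinder K (J i) (B i))))"
        using c a by (intro R.finite_measure_mono) auto
      also have "\<dots> \<le> measure R ((\<Union>i. a i) - (\<Union>i<N. a i)) + measure R (\<Union>i<N. sym_diff (a i) (cylinder K (J i) (B i)))"
        using c a by (intro measure_Un_le) auto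
      also have "\<dots> \<le> measure R ((\<Union>i. a i) - (\<Union>i<N. a i)) + (\<Sum>i<N. measure R (sym_diff (a i) (cylinder K (J i) (B i))))"
        using c a by (intro add_left_mono measure_UNION_le) auto
      also have "(\<Sum>i<N. measure R (sym_diff (a i) (cylinder K (J i) (B i)))) \<le> (\<Sum>i<N. e / (2 * real N))"
        using R2 by (intro sum_mono) (auto intro: less_imp_le)
      also have "\<dots> = e / 2" by (simp add: N_def field_simps del: of_nat_max)
      finally show ?thesis using R1 by simp
    qed
    show ?case
      using JJ B'(1) meas[OF P N(1) *(1)] meas[OF Q N(2) *(2)]
      by (intro exI[of _ JJ] exI[of _ "\<Union>i<N. B' i"]) auto
  qed
qed

text \<open>A cylinder within \<open>e\<close> of \<open>A\<close> under both measures has level at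
  most \<open>\<alpha> + e\<close>, hence power at most \<open>1/2 + c * e\<close>, and
  \<open>A\<close> itself at most \<open>1/2 + (1 + c) * e\<close>. As \<open>c\<close> is the same
  for all cylinders, \<open>e\<close> can tend to 0.\<close>

lemma testing_by_cylinders:
  fixes P Q :: "('i \<Rightarrow> real) measure"
  assumes P: "prob_space P" "sets P = sets (Pi\<^sub>M K (\<lambda>_. borel))"
    and Q: "prob_space Q" "sets Q = sets (Pi\<^sub>M K (\<lambda>_. borel))"
    and c: "0 \<le> c"
    and cyl: "\<And>J B. finite J \<Longrightarrow> J \<subseteq> K \<Longrightarrow> B \<in> sets (Pi\<^sub>M J (\<lambda>_. borel)) \<Longrightarrow>
      measure Q (cylinder K J B) \<le> 1/2 + c * max 0 (measure P (cylinder K J B) - \<alpha>)"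
    and A: "A \<in> sets (Pi\<^sub>M K (\<lambda>_. borel))" and "measure P A \<le> \<alpha>"
  shows "measure Q A \<le> 1/2"
proof -
  interpret P: prob_space P by fact
  interpret Q: prob_space Q by fact
  have "measure Q A \<le> 1/2 + e * (1 + c)" if e: "0 < e" for e
  proof -
    obtain J B where J: "finite J" "J \<subseteq> K" "B \<in> sets (Pi\<^sub>M J (\<lambda>_. borel))"
      and p: "measure P (sym_diff A (cylinder K J B)) < e" and q: "measure Q (sym_diff A (cylinder K J B)) < e"
      using cylinder_approximation[OF P Q A e] by blast
    let ?C = "cylinder K J B"
    have C: "?C \<in> sets (Pi\<^sub>M K (\<lambda>_. borel))" using J by (intro cylinder_measurable)
    have "measure P ?C \<le> measure P (A \<union> sym_diff A ?C)" using C A P by (intro P.finite_measure_mono) auto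
    also have "\<dots> \<le> measure P A + measure P (sym_diff A ?C)" using C A P by (intro measure_Un_le) auto
    finally have 1: "measure P ?C - \<alpha> \<le> e" using assms p by simp
    have "measure Q A \<le> measure Q (?C \<union> sym_diff A ?C)" using C A Q by (intro Q.finite_measure_mono) auto
    also have "\<dots> \<le> measure Q ?C + measure Q (sym_diff A ?C)" using C A Q by (intro measure_Un_le) auto
    also have "measure Q ?C \<le> 1/2 + c * max 0 (measure P ?C - \<alpha>)" using J by (rule cyl)
    also have "c * max 0 (measure P ?C - \<alpha>) \<le> c * e" using 1 e c by (intro mult_left_mono) auto
    finally show ?thesis using q by (simp add: algebra_simps)
  qed
  hence "measure Q A \<le> 1/2 + e" if "0 < e" for e
  proof -
    have "0 < e / (1 + c)" "e / (1 + c) * (1 + c) = e" using c that by auto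
    thus ?thesis using \<open>\<And>e. 0 < e \<Longrightarrow> measure Q A \<le> 1/2 + e * (1 + c)\<close>[of "e / (1 + c)"] by simp
  qed
  thus ?thesis by (rule field_le_epsilon)
qed

section \<open>Confidence intervals in a Gaussian experiment\<close>

text \<open>The interface between probability and statistics. Normality of stochastic integrals
  feeds coverage and the upper bound on the length; \<open>testing\<close>, which turns closeness of
  two parameters into indistinguishability, feeds the lower bound.\<close>

locale gaussian_experiment =
  fixes m :: "'i gaussian_model" and n :: nat
  assumes n_pos: "0 < n"
    and prob_space_law: "f \<in> L2 (base m) \<Longrightarrow> prob_space (law m f)"
    and sets_law: "f \<in> L2 (base m) \<Longrightarrow> sets (law m f) = sets (obs_space (base m))"
    and stoch_int_measurable: "stoch_int m h X \<Longrightarrow> X \<in> borel_measurable (obs_space (base m))"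
    and stoch_int_normal: "stoch_int m h X \<Longrightarrow> f \<in> L2 (base m) \<Longrightarrow> \<exists>\<mu> \<sigma>. has_normal (law m f) X \<mu> \<sigma>"
    and testing: "0 < a \<Longrightarrow> a < 1/2 \<Longrightarrow> f \<in> L2 (base m) \<Longrightarrow> g \<in> L2 (base m) \<Longrightarrow>
      norm2 (base m) (\<lambda>x. g x - f x) \<le> z_quantile a / sqrt (real n) \<Longrightarrow>
      A \<in> sets (obs_space (base m)) \<Longrightarrow> measure (law m f) A \<le> a \<Longrightarrow> measure (law m g) A \<le> 1/2"
begin

lemma space_law: "f \<in> L2 (base m) \<Longrightarrow> space (law m f) = space (obs_space (base m))"
  by (intro sets_eq_imp_space_eq sets_law)

lemma linear_estimator_measurable:
  assumes "linear_estimator m X" shows "X \<in> borel_measurable (obs_space (base m))"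
proof -
  obtain c h where "stoch_int m h (\<lambda>y. X y - c)" using assms unfolding linear_estimator_def by blast
  hence "(\<lambda>y. (X y - c) + c) \<in> borel_measurable (obs_space (base m))"
    using stoch_int_measurable by (intro borel_measurable_add) auto
  thus ?thesis by simp
qed

lemma linear_estimator_normal:
  assumes "linear_estimator m X" "f \<in> L2 (base m)"
  obtains \<sigma> where "has_normal (law m f) X (integral\<^sup>L (law m f) X) \<sigma>"
    "integral\<^sup>L (law m f) (\<lambda>y. (X y - integral\<^sup>L (law m f) X)\<^sup>2) = \<sigma>\<^sup>2"
proof -
  obtain c h where "stoch_int m h (\<lambda>y. X y - c)" using assms(1) unfolding linear_estimator_def by blast
  then obtain \<mu> \<sigma> where "has_normal (law m f) (\<lambda>y. X y - c) \<mu> \<sigma>"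
    using stoch_int_normal assms(2) by blast
  hence N: "has_normal (law m f) X (\<mu> + c) \<sigma>" using has_normal_add_const[of _ _ \<mu> \<sigma> c] by fastforce
  show ?thesis using that[of \<sigma>] has_normal_moments(2,5)[OF N] N by simp
qed

lemma two_point_bound:
  assumes \<alpha>: "0 < \<alpha>" "\<alpha> < 1/2" and fg: "f \<in> A" "g \<in> A" and A: "A \<subseteq> L2 (base m)"
    and close: "norm2 (base m) (\<lambda>x. g x - f x) \<le> z_quantile \<alpha> / sqrt (real n)"
    and C: "C \<in> conf_intervals m T \<alpha> A"
  shows "ennreal ((1/2 - \<alpha>) * \<bar>T g - T f\<bar>) \<le> (\<integral>\<^sup>+y. interval_length (C y) \<partial>law m g)"
proof -
  let ?\<Omega> = "obs_space (base m)"
  have L2: "f \<in> L2 (base m)" "g \<in> L2 (base m)" using fg A by auto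
  interpret f: prob_space "law m f" by (rule prob_space_law[OF L2(1)])
  interpret g: prob_space "law m g" by (rule prob_space_law[OF L2(2)])
  have RI: "random_interval m C"
    and "ereal (1 - \<alpha>) \<le> (INF f\<in>A. ereal (measure (law m f) {y \<in> space (law m f). T f \<in> C y}))"
    using C by (auto simp: conf_intervals_def)
  hence cov: "1 - \<alpha> \<le> measure (law m h) {y \<in> space (law m h). T h \<in> C y}" if "h \<in> A" for h
    using that by (auto simp: le_INF_iff)
  have mC[measurable]: "{y \<in> space ?\<Omega>. t \<in> C y} \<in> sets ?\<Omega>" for t
    using RI by (simp add: random_interval_def)
  have mC': "{y \<in> space ?\<Omega>. t \<notin> C y} \<in> sets ?\<Omega>" for t by measurable
  have miss: "measure (law m h) {y \<in> space ?\<Omega>. T h \<notin> C y} \<le> \<alpha>" if "h \<in> A" for h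
  proof -
    have h: "h \<in> L2 (base m)" using that A by auto
    interpret h: prob_space "law m h" by (rule prob_space_law[OF h])
    have "{y \<in> space ?\<Omega>. T h \<notin> C y} = space (law m h) - {y \<in> space (law m h). T h \<in> C y}"
      using space_law[OF h] by auto
    moreover have "{y \<in> space (law m h). T h \<in> C y} \<in> sets (law m h)"
      using mC[of "T h"] sets_law[OF h] space_law[OF h] by simp
    ultimately show ?thesis using cov[OF that] by (simp add: h.prob_compl)
  qed
  have "measure (law m g) {y \<in> space ?\<Omega>. T f \<notin> C y} \<le> 1/2"
    using \<alpha> L2 close mC' miss[OF fg(1)] by (rule testing)
  moreover define E where "E = {y \<in> space ?\<Omega>. T f \<in> C y \<and> T g \<in> C y}"
  have mE: "E \<in> sets (law m g)" unfolding E_def sets_law[OF L2(2)] by measurable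
  \<comment> \<open>Under \<open>g\<close> the point \<open>T f\<close> is missed with probability
    at most 1/2 and \<open>T g\<close> with probability at most \<alpha>; the union bound leaves 1/2
    - \<alpha> for covering both.\<close>
  have "space (law m g) - E = {y \<in> space ?\<Omega>. T f \<notin> C y} \<union> {y \<in> space ?\<Omega>. T g \<notin> C y}"
    using space_law[OF L2(2)] by (auto simp: E_def)
  hence "measure (law m g) (space (law m g) - E)
      \<le> measure (law m g) {y \<in> space ?\<Omega>. T f \<notin> C y} + measure (law m g) {y \<in> space ?\<Omega>. T g \<notin> C y}"
    using mC' sets_law[OF L2(2)] by (auto intro!: measure_Un_le)
  ultimately have E: "1/2 - \<alpha> \<le> measure (law m g) E"
    using miss[OF fg(2)] mE by (simp add: g.prob_compl)
  have "ennreal ((1/2 - \<alpha>) * \<bar>T g - T f\<bar>) \<le> ennreal (\<bar>T g - T f\<bar> * measure (law m g) E)"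
    using mult_left_mono[OF E, of "\<bar>T g - T f\<bar>"] by (intro ennreal_leI) (simp add: mult.commute)
  also have "\<dots> = (\<integral>\<^sup>+y. ennreal \<bar>T g - T f\<bar> * indicator E y \<partial>law m g)"
    using mE by (simp add: nn_integral_cmult_indicator g.emeasure_eq_measure ennreal_mult)
  also have "\<dots> \<le> (\<integral>\<^sup>+y. interval_length (C y) \<partial>law m g)"
  proof (rule nn_integral_mono)
    fix y assume "y \<in> space (law m g)"
    show "ennreal \<bar>T g - T f\<bar> * indicator E y \<le> interval_length (C y)"
    proof (cases "y \<in> E")
      case True
      hence y: "is_interval (C y)" "T f \<in> C y" "T g \<in> C y"
        using RI by (auto simp: E_def random_interval_def)
      have "{min (T f) (T g)..max (T f) (T g)} \<subseteq> C y"
      proof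
        fix x assume x: "x \<in> {min (T f) (T g)..max (T f) (T g)}"
        show "x \<in> C y"
        proof (cases "T f \<le> T g")
          case le: True
          show ?thesis by (rule mem_is_interval_1_I[OF y(1,2,3)]) (use x le in simp_all)
        next
          case gt: False
          show ?thesis by (rule mem_is_interval_1_I[OF y(1,3,2)]) (use x gt in simp_all)
        qed
      qed
      moreover have "C y \<in> sets lborel" using y by (simp add: real_interval_borel_measurable)
      ultimately have "emeasure lborel {min (T f) (T g)..max (T f) (T g)} \<le> emeasure lborel (C y)"
        by (intro emeasure_mono)
      moreover have "max (T f) (T g) - min (T f) (T g) = \<bar>T g - T f\<bar>" by auto
      ultimately show ?thesis using True by (simp add: interval_length_def)
    qed simp
  qed
  finally show ?thesis .
qed

end

section \<open>Coverage and expected length of the adaptive interval\<close>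

locale adaptive_setting = gaussian_experiment m n for m :: "'i gaussian_model" and n :: nat +
  fixes D :: "('i \<Rightarrow> real) set" and T :: "('i \<Rightarrow> real) \<Rightarrow> real" and k :: nat
    and F :: "nat \<Rightarrow> ('i \<Rightarrow> real) set" and Th :: "nat \<Rightarrow> nat \<Rightarrow> ('i \<Rightarrow> real) \<Rightarrow> real" and \<alpha> :: real
  assumes setting: "parameter_setting m D T k F"
    and est: "\<And>i j. i \<in> {1..k} \<Longrightarrow> j \<in> {1..k} \<Longrightarrow> admissible_estimator m n T F (\<alpha> / real k) i j (Th i j)"
    and \<alpha>: "0 < \<alpha>" "\<alpha> < 1/2" and k_pos: "0 < k"
begin

abbreviation \<beta> :: real where "\<beta> \<equiv> \<alpha> / real k"
abbreviation \<zeta> :: real where "\<zeta> \<equiv> z_quantile (\<beta> / 2)"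
abbreviation \<omega> :: "nat \<Rightarrow> nat \<Rightarrow> ereal" where "\<omega> \<equiv> modulus_at m n T F \<beta>"
abbreviation CI :: "('i \<Rightarrow> real) \<Rightarrow> real set" where "CI \<equiv> CI_star m n T k F \<alpha> Th"
abbreviation \<G> :: "('i \<Rightarrow> real) set" where "\<G> \<equiv> \<Union>i\<in>{1..k}. F i"

lemma F_L2: "j \<in> {1..k} \<Longrightarrow> f \<in> F j \<Longrightarrow> f \<in> L2 (base m)"
  and F_D: "j \<in> {1..k} \<Longrightarrow> f \<in> F j \<Longrightarrow> f \<in> D"
  using setting unfolding parameter_setting_def by blast+

lemma F_convex:
  assumes "j \<in> {1..k}" "f \<in> F j" "g \<in> F j" "0 \<le> u" "u \<le> 1"
  shows "(\<lambda>x. (1 - u) * f x + u * g x) \<in> F j"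
proof -
  have "convex_space (F j)" using setting assms(1) unfolding parameter_setting_def by blast
  thus ?thesis using assms unfolding convex_space_def by auto
qed

lemma T_linear:
  assumes "f \<in> D" "g \<in> D" shows "T (\<lambda>x. a * f x + b * g x) = a * T f + b * T g"
  using setting assms unfolding parameter_setting_def linear_functional_on_def by blast

lemma \<beta>_bounds: "0 < \<beta>" "\<beta> / 2 < 1/4" "\<beta> / 2 \<le> \<alpha>" "\<beta> \<le> \<alpha>"
proof -
  have "\<beta> \<le> \<alpha>" using \<alpha> k_pos by (simp add: divide_le_eq)
  thus "\<beta> \<le> \<alpha>" "\<beta> / 2 < 1/4" "\<beta> / 2 \<le> \<alpha>" using \<alpha> k_pos by auto
  show "0 < \<beta>" using \<alpha> k_pos by simp
qed

lemma \<zeta>_ge_half: "1/2 \<le> \<zeta>"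
  using \<beta>_bounds by (intro z_quantile_ge_half) auto

lemma \<zeta>_pos: "0 < \<zeta>"
  using \<zeta>_ge_half by simp

lemma normal_tail_\<zeta>: "normal_tail \<zeta> = \<beta> / 2"
  using \<beta>_bounds \<alpha> by (intro normal_tail_z_quantile) auto

text \<open>A common point of the two spaces, paired with itself, contributes 0 to the supremum. In
  particular a modulus is never minus infinity.\<close>

lemma modulus_nonneg:
  assumes "i \<in> {1..k}" "j \<in> {1..k}" shows "0 \<le> \<omega> i j"
proof -
  obtain h where "h \<in> F i" "h \<in> F j" using setting assms unfolding parameter_setting_def by blast
  moreover have "norm2 (base m) (\<lambda>x. h x - h x) \<le> \<zeta> / sqrt (real n)"
    using \<zeta>_pos by (simp add: norm2_def)
  ultimately have "ereal (T h - T h) \<le> \<omega> i j"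
    unfolding modulus_at_def ordered_modulus_def by (intro Sup_upper) blast
  thus ?thesis by (simp add: zero_ereal_def)
qed

lemma Th_measurable [measurable]:
  assumes "i \<in> {1..k}" "j \<in> {1..k}" shows "Th i j \<in> borel_measurable (obs_space (base m))"
  using est[OF assms] by (intro linear_estimator_measurable) (simp add: admissible_estimator_def)

text \<open>With a finite modulus the extended real conditions become real inequalities. The
  variance bound holds for every \<open>f\<close> in \<open>L2\<close>; the bias is bounded from
  below on \<open>F j\<close> and from above on \<open>F i\<close>.\<close>

lemma estimator_normal:
  assumes ij: "i \<in> {1..k}" "j \<in> {1..k}" and f: "f \<in> L2 (base m)" and w: "\<omega> i j = ereal w"
  obtains \<mu> \<sigma> where "has_normal (law m f) (Th i j) \<mu> \<sigma>" "\<sigma> \<le> w / \<zeta>"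
    "f \<in> F j \<Longrightarrow> T f - w / 2 \<le> \<mu>" "f \<in> F i \<Longrightarrow> \<mu> \<le> T f + w / 2"
proof -
  let ?\<mu> = "integral\<^sup>L (law m f) (Th i j)"
  have E: "linear_estimator m (Th i j)"
    "ereal (integral\<^sup>L (law m f) (\<lambda>y. (Th i j y - ?\<mu>)\<^sup>2)) \<le> (ereal w)\<^sup>2 / ereal (\<zeta>\<^sup>2)"
    "- (ereal (1/2) * ereal w) \<le> (INF f\<in>F j. ereal (integral\<^sup>L (law m f) (Th i j) - T f))"
    "(SUP f\<in>F i. ereal (integral\<^sup>L (law m f) (Th i j) - T f)) \<le> ereal (1/2) * ereal w"
    using est[OF ij] f unfolding admissible_estimator_def w by auto
  obtain \<sigma> where N: "has_normal (law m f) (Th i j) ?\<mu> \<sigma>"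
    and var: "integral\<^sup>L (law m f) (\<lambda>y. (Th i j y - ?\<mu>)\<^sup>2) = \<sigma>\<^sup>2"
    using linear_estimator_normal[OF E(1) f] by blast
  have w0: "0 \<le> w" using modulus_nonneg[OF ij] w by simp
  have "ereal (\<sigma>\<^sup>2) \<le> (ereal w)\<^sup>2 / ereal (\<zeta>\<^sup>2)" using E(2) unfolding var .
  hence "\<sigma>\<^sup>2 \<le> (w / \<zeta>)\<^sup>2" using \<zeta>_pos by (simp add: power_divide)
  hence "\<sigma> \<le> w / \<zeta>" by (rule power2_le_imp_le) (use w0 \<zeta>_pos in simp)
  moreover have "T f - w / 2 \<le> ?\<mu>" if "f \<in> F j"
  proof -
    have "- (ereal (1/2) * ereal w) \<le> ereal (?\<mu> - T f)" using E(3) that unfolding le_INF_iff by blast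
    thus ?thesis by simp
  qed
  moreover have "?\<mu> \<le> T f + w / 2" if "f \<in> F i"
  proof -
    have "ereal (?\<mu> - T f) \<le> ereal (1/2) * ereal w" using E(4) that unfolding SUP_le_iff by blast
    thus ?thesis by simp
  qed
  ultimately show ?thesis using N that by blast
qed

text \<open>The origin of the factor 3/2: the bias is at most \<open>w / 2\<close>, and \<zeta>
  standard deviations are at most \<open>w\<close>. An infinite modulus puts this end point at minus
  infinity, where nothing can be missed.\<close>

lemma lower_end_miss:
  assumes ij: "i \<in> {1..k}" "j \<in> {1..k}" and f: "f \<in> F i"
  shows "measure (law m f) {y \<in> space (law m f). ereal (T f) < ereal (Th i j y) - ereal (3/2) * \<omega> i j} \<le> \<beta> / 2"
proof (cases "\<omega> i j")
  case (real w)
  note fL2 = F_L2[OF ij(1) f]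
  obtain \<mu> \<sigma> where N: "has_normal (law m f) (Th i j) \<mu> \<sigma>" "\<sigma> \<le> w / \<zeta>" "\<mu> \<le> T f + w / 2"
    using estimator_normal[OF ij fL2 real] f by metis
  have "measure (law m f) {y \<in> space (law m f). T f + 3/2 * w < Th i j y} \<le> normal_tail \<zeta>"
    using N \<zeta>_pos by (intro has_normal_tail[OF N(1,2)]) auto
  thus ?thesis unfolding normal_tail_\<zeta> by (simp add: real less_diff_eq)
next
  case PInf
  thus ?thesis using \<beta>_bounds by simp
next
  case MInf
  thus ?thesis using modulus_nonneg[OF ij] by simp
qed

lemma upper_end_miss:
  assumes ij: "i \<in> {1..k}" "j \<in> {1..k}" and f: "f \<in> F j"
  shows "measure (law m f) {y \<in> space (law m f). ereal (Th i j y) + ereal (3/2) * \<omega> i j < ereal (T f)} \<le> \<beta> / 2"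
proof (cases "\<omega> i j")
  case (real w)
  note fL2 = F_L2[OF ij(2) f]
  obtain \<mu> \<sigma> where N: "has_normal (law m f) (Th i j) \<mu> \<sigma>" "\<sigma> \<le> w / \<zeta>" "T f - w / 2 \<le> \<mu>"
    using estimator_normal[OF ij fL2 real] f by metis
  have "measure (law m f) {y \<in> space (law m f). - T f + 3/2 * w < - Th i j y} \<le> normal_tail \<zeta>"
    using N \<zeta>_pos by (intro has_normal_tail[OF has_normal_uminus[OF N(1)] N(2)]) auto
  moreover have "- T f + 3/2 * w < - Th i j y \<longleftrightarrow> Th i j y + 3/2 * w < T f" for y by linarith
  ultimately show ?thesis unfolding normal_tail_\<zeta> by (simp add: real)
next
  case PInf
  thus ?thesis using \<beta>_bounds by simp
next
  case MInf
  thus ?thesis using modulus_nonneg[OF ij] by simp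
qed

text \<open>Minimum and maximum become finitely many comparisons in \<open>ereal\<close>.
  Measurability, convexity and coverage can be read off from them, also when end points are infinite
  or cross.\<close>

lemma mem_CI_iff:
  "x \<in> CI y \<longleftrightarrow> (\<forall>j\<in>{1..k}. (\<exists>i\<in>{1..k}. ereal (Th i j y) - ereal (3/2) * \<omega> i j \<le> ereal x) \<and>
     (\<exists>i\<in>{1..k}. ereal x \<le> ereal (Th j i y) + ereal (3/2) * \<omega> j i))"
proof -
  have "{1..k} \<noteq> {}" using k_pos by simp
  thus ?thesis by (simp add: CI_star_def CI_star_component_def Min_le_iff Max_ge_iff)
qed

text \<open>The length at \<open>y\<close> is the Lebesgue measure of the section at
  \<open>y\<close> of a set that is measurable in the product, so no formula for the end points
  enters.\<close>

lemma random_interval_CI: "random_interval m CI"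
proof -
  let ?\<Omega> = "obs_space (base m)"
  define Q where "Q = {p \<in> space (?\<Omega> \<Otimes>\<^sub>M lborel). snd p \<in> CI (fst p)}"
  have Q: "Q \<in> sets (?\<Omega> \<Otimes>\<^sub>M lborel)" unfolding Q_def mem_CI_iff by measurable
  have sec: "{y \<in> space ?\<Omega>. x \<in> CI y} \<in> sets ?\<Omega>" for x unfolding mem_CI_iff by measurable
  have "(\<lambda>y. emeasure lborel (Pair y -` Q)) \<in> borel_measurable ?\<Omega>"
    by (rule lborel.measurable_emeasure_Pair[OF Q])
  also have "?this \<longleftrightarrow> (\<lambda>y. interval_length (CI y)) \<in> borel_measurable ?\<Omega>"
    by (intro measurable_cong) (auto simp: Q_def space_pair_measure interval_length_def intro!: arg_cong[where f = "emeasure lborel"])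
  finally have len: "(\<lambda>y. interval_length (CI y)) \<in> borel_measurable ?\<Omega>" .
  have "is_interval (CI y)" for y
    unfolding is_interval_1
  proof (intro ballI allI impI, elim conjE)
    fix a b x assume "a \<in> CI y" "b \<in> CI y" "a \<le> x" "x \<le> b"
    show "x \<in> CI y" unfolding mem_CI_iff
    proof (intro ballI conjI)
      fix j assume j: "j \<in> {1..k}"
      obtain i where i: "i \<in> {1..k}" "ereal (Th i j y) - ereal (3/2) * \<omega> i j \<le> ereal a"
        using \<open>a \<in> CI y\<close> j unfolding mem_CI_iff by blast
      from i(2) have "ereal (Th i j y) - ereal (3/2) * \<omega> i j \<le> ereal x"
        by (rule order_trans) (use \<open>a \<le> x\<close> in simp)
      thus "\<exists>i\<in>{1..k}. ereal (Th i j y) - ereal (3/2) * \<omega> i j \<le> ereal x" using i(1) by blast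
      obtain i where i: "i \<in> {1..k}" "ereal b \<le> ereal (Th j i y) + ereal (3/2) * \<omega> j i"
        using \<open>b \<in> CI y\<close> j unfolding mem_CI_iff by blast
      have "ereal x \<le> ereal b" using \<open>x \<le> b\<close> by simp
      hence "ereal x \<le> ereal (Th j i y) + ereal (3/2) * \<omega> j i" using i(2) by (rule order_trans)
      thus "\<exists>i\<in>{1..k}. ereal x \<le> ereal (Th j i y) + ereal (3/2) * \<omega> j i" using i(1) by blast
    qed
  qed
  thus ?thesis using sec len by (simp add: random_interval_def)
qed

lemma CI_coverage:
  assumes l: "l \<in> {1..k}" and f: "f \<in> F l"
  shows "1 - \<alpha> \<le> measure (law m f) {y \<in> space (law m f). T f \<in> CI y}"
proof -
  have fL2: "f \<in> L2 (base m)" using F_L2 l f by blast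
  let ?P = "law m f"
  interpret prob_space ?P by (rule prob_space_law[OF fL2])
  \<comment> \<open>For \<open>f\<close> in \<open>F l\<close> only the estimators that involve
    \<open>l\<close> count: if \<open>T f\<close> lies outside the component for \<open>j\<close>,
    then in particular the candidate end point with \<open>i = l\<close> fails on that side.\<close>
  define lo where "lo j = {y \<in> space ?P. ereal (T f) < ereal (Th l j y) - ereal (3/2) * \<omega> l j}" for j
  define up where "up j = {y \<in> space ?P. ereal (Th j l y) + ereal (3/2) * \<omega> j l < ereal (T f)}" for j
  have [measurable]: "Th i j \<in> borel_measurable ?P" if "i \<in> {1..k}" "j \<in> {1..k}" for i j
    using Th_measurable[OF that] measurable_cong_sets[OF sets_law[OF fL2] refl] by blast
  have meas: "lo j \<in> sets ?P" "up j \<in> sets ?P" if "j \<in> {1..k}" for j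
    using l that unfolding lo_def up_def by measurable
  have CIm: "{y \<in> space ?P. T f \<in> CI y} \<in> sets ?P"
    using random_interval_CI sets_law[OF fL2] space_law[OF fL2] by (simp add: random_interval_def)
  have "measure ?P (space ?P - {y \<in> space ?P. T f \<in> CI y}) \<le> measure ?P (\<Union>j\<in>{1..k}. lo j \<union> up j)"
  proof (rule finite_measure_mono)
    show "space ?P - {y \<in> space ?P. T f \<in> CI y} \<subseteq> (\<Union>j\<in>{1..k}. lo j \<union> up j)"
      unfolding mem_CI_iff lo_def up_def using l by (auto simp: not_le)
  qed (use meas in auto)
  also have "\<dots> \<le> (\<Sum>j\<in>{1..k}. measure ?P (lo j \<union> up j))"
    using meas by (intro measure_UNION_le) auto
  also have "\<dots> \<le> (\<Sum>j\<in>{1..k}. \<beta>)"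
  proof (rule sum_mono)
    fix j assume j: "j \<in> {1..k}"
    have "measure ?P (lo j \<union> up j) \<le> measure ?P (lo j) + measure ?P (up j)"
      using meas j by (intro measure_Un_le)
    also have "\<dots> \<le> \<beta>"
      using lower_end_miss[OF l j f] upper_end_miss[OF j l f] by (simp add: lo_def up_def)
    finally show "measure ?P (lo j \<union> up j) \<le> \<beta>" .
  qed
  also have "\<dots> = \<alpha>" using k_pos by simp
  finally show ?thesis using CIm by (simp add: prob_compl)
qed

lemma CI_in_conf_intervals: "CI \<in> conf_intervals m T \<alpha> \<G>"
  using random_interval_CI CI_coverage by (auto simp: conf_intervals_def le_INF_iff)

text \<open>Everything is stated for a common bound \<open>K\<close> of the moduli. With standard
  deviation at most \<open>K / \<zeta>\<close>, the threshold of \<zeta> standard deviations becomes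
  \<open>K\<close> itself.\<close>

lemma estimator_excess:
  assumes ij: "i \<in> {1..k}" "j \<in> {1..k}" and f: "f \<in> L2 (base m)" and K: "\<omega> i j \<le> ereal K"
  obtains \<mu> w where "\<omega> i j = ereal w" "w \<le> K"
    "f \<in> F j \<Longrightarrow> T f - K / 2 \<le> \<mu>" "f \<in> F i \<Longrightarrow> \<mu> \<le> T f + K / 2"
    "(\<integral>\<^sup>+y. ennreal (Th i j y - \<mu> - K) \<partial>law m f) \<le> ennreal (2 * \<beta> * K)"
    "(\<integral>\<^sup>+y. ennreal (\<mu> - Th i j y - K) \<partial>law m f) \<le> ennreal (2 * \<beta> * K)"
proof -
  obtain w where w: "\<omega> i j = ereal w" "0 \<le> w" "w \<le> K"
    using K modulus_nonneg[OF ij] by (cases "\<omega> i j") auto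
  obtain \<mu> \<sigma> where N: "has_normal (law m f) (Th i j) \<mu> \<sigma>" "\<sigma> \<le> w / \<zeta>"
    "f \<in> F j \<Longrightarrow> T f - w / 2 \<le> \<mu>" "f \<in> F i \<Longrightarrow> \<mu> \<le> T f + w / 2"
    using estimator_normal[OF ij f w(1)] by metis
  have \<sigma>: "\<sigma> \<le> K / \<zeta>" using N(2) w \<zeta>_pos by (smt (verit) divide_right_mono)
  \<comment> \<open>The excess bound is \<open>K\<close> times \<open>normal_tail \<zeta>\<close>
    over the square of \<zeta>. The tail is \<open>\<beta> / 2\<close> and the reciprocal square at
    most 4, whence \<open>2 * \<beta> * K\<close>.\<close>
  have "1/4 \<le> \<zeta> * \<zeta>" using mult_mono[OF \<zeta>_ge_half \<zeta>_ge_half] \<zeta>_pos by simp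
  hence "K / \<zeta> * (normal_tail \<zeta> / \<zeta>) \<le> K * (\<beta> / 2) / (1/4)"
    unfolding normal_tail_\<zeta> using w \<beta>_bounds \<zeta>_pos
    by (simp only: times_divide_times_eq, intro divide_left_mono mult_nonneg_nonneg) auto
  hence le: "ennreal (K / \<zeta> * (normal_tail \<zeta> / \<zeta>)) \<le> ennreal (2 * \<beta> * K)"
    by (intro ennreal_leI) (simp add: field_simps)
  have s: "K / \<zeta> * \<zeta> = K" using \<zeta>_pos by simp
  show ?thesis
  proof (rule that[OF w(1,3)])
    show "T f - K / 2 \<le> \<mu>" if "f \<in> F j" using N(3)[OF that] w by simp
    show "\<mu> \<le> T f + K / 2" if "f \<in> F i" using N(4)[OF that] w by simp
    show "(\<integral>\<^sup>+y. ennreal (Th i j y - \<mu> - K) \<partial>law m f) \<le> ennreal (2 * \<beta> * K)"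
      using order_trans[OF has_normal_excess[OF N(1) \<sigma> \<zeta>_pos] le] unfolding s .
    have "(\<integral>\<^sup>+y. ennreal (- Th i j y - - \<mu> - K) \<partial>law m f) \<le> ennreal (2 * \<beta> * K)"
      using order_trans[OF has_normal_excess[OF has_normal_uminus[OF N(1)] \<sigma> \<zeta>_pos] le] unfolding s .
    thus "(\<integral>\<^sup>+y. ennreal (\<mu> - Th i j y - K) \<partial>law m f) \<le> ennreal (2 * \<beta> * K)" by simp
  qed
qed

text \<open>The maxima over the \<open>k\<close> estimators are bounded by their deterministic parts plus the sum of all
  excesses.  The excesses together cost only a constant factor because \<open>k * normal_tail \<zeta> = \<alpha> / 2\<close>.\<close>

lemma CI_length:
  assumes j: "j \<in> {1..k}" and K: "\<And>i. i \<in> {1..k} \<Longrightarrow> \<omega> i j \<le> ereal K" "\<And>i. i \<in> {1..k} \<Longrightarrow> \<omega> j i \<le> ereal K"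
  shows "max_length m CI (F j) \<le> ennreal (8 * K)"
  unfolding max_length_def
proof (rule SUP_least)
  fix f assume f: "f \<in> F j"
  have fL2: "f \<in> L2 (base m)" using F_L2 j f by blast
  interpret prob_space "law m f" by (rule prob_space_law[OF fL2])
  have K0: "0 \<le> K" using modulus_nonneg[OF j j] K(1)[OF j] by (metis ereal_less_eq(5) order_trans)
  have "\<forall>i\<in>{1..k}. \<exists>\<mu> w. \<omega> i j = ereal w \<and> w \<le> K \<and> T f - K / 2 \<le> \<mu> \<and>
      (\<integral>\<^sup>+y. ennreal (\<mu> - Th i j y - K) \<partial>law m f) \<le> ennreal (2 * \<beta> * K)"
  proof
    fix i assume i: "i \<in> {1..k}"
    show "\<exists>\<mu> w. \<omega> i j = ereal w \<and> w \<le> K \<and> T f - K / 2 \<le> \<mu> \<and>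
      (\<integral>\<^sup>+y. ennreal (\<mu> - Th i j y - K) \<partial>law m f) \<le> ennreal (2 * \<beta> * K)"
      by (rule estimator_excess[OF i j fL2 K(1)[OF i]]) (use f in blast)
  qed
  then obtain \<mu> w where lo: "\<And>i. i \<in> {1..k} \<Longrightarrow> \<omega> i j = ereal (w i)" "\<And>i. i \<in> {1..k} \<Longrightarrow> w i \<le> K"
    "\<And>i. i \<in> {1..k} \<Longrightarrow> T f - K / 2 \<le> \<mu> i"
    "\<And>i. i \<in> {1..k} \<Longrightarrow> (\<integral>\<^sup>+y. ennreal (\<mu> i - Th i j y - K) \<partial>law m f) \<le> ennreal (2 * \<beta> * K)"
    by metis
  have "\<forall>i\<in>{1..k}. \<exists>\<mu> w. \<omega> j i = ereal w \<and> w \<le> K \<and> \<mu> \<le> T f + K / 2 \<and>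
      (\<integral>\<^sup>+y. ennreal (Th j i y - \<mu> - K) \<partial>law m f) \<le> ennreal (2 * \<beta> * K)"
  proof
    fix i assume i: "i \<in> {1..k}"
    show "\<exists>\<mu> w. \<omega> j i = ereal w \<and> w \<le> K \<and> \<mu> \<le> T f + K / 2 \<and>
      (\<integral>\<^sup>+y. ennreal (Th j i y - \<mu> - K) \<partial>law m f) \<le> ennreal (2 * \<beta> * K)"
      by (rule estimator_excess[OF j i fL2 K(2)[OF i]]) (use f in blast)
  qed
  then obtain \<nu> v where up: "\<And>i. i \<in> {1..k} \<Longrightarrow> \<omega> j i = ereal (v i)" "\<And>i. i \<in> {1..k} \<Longrightarrow> v i \<le> K"
    "\<And>i. i \<in> {1..k} \<Longrightarrow> \<nu> i \<le> T f + K / 2"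
    "\<And>i. i \<in> {1..k} \<Longrightarrow> (\<integral>\<^sup>+y. ennreal (Th j i y - \<nu> i - K) \<partial>law m f) \<le> ennreal (2 * \<beta> * K)"
    by metis
  define A where "A y = (\<Sum>i\<in>{1..k}. max 0 (\<mu> i - Th i j y - K))" for y
  define B where "B y = (\<Sum>i\<in>{1..k}. max 0 (Th j i y - \<nu> i - K))" for y
  have A0: "0 \<le> A y" and B0: "0 \<le> B y" for y by (auto simp: A_def B_def sum_nonneg)
  have [measurable]: "Th i l \<in> borel_measurable (law m f)" if "i \<in> {1..k}" "l \<in> {1..k}" for i l
    using Th_measurable[OF that] measurable_cong_sets[OF sets_law[OF fL2] refl] by blast
  have excess_measurable:
    "(\<lambda>y. ennreal (\<mu> i - Th i j y - K)) \<in> borel_measurable (law m f)"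
    "(\<lambda>y. ennreal (Th j i y - \<nu> i - K)) \<in> borel_measurable (law m f)" if "i \<in> {1..k}" for i
    using that j by measurable
  have sum_measurable:
    "(\<lambda>y. \<Sum>i\<in>{1..k}. ennreal (\<mu> i - Th i j y - K)) \<in> borel_measurable (law m f)"
    "(\<lambda>y. \<Sum>i\<in>{1..k}. ennreal (Th j i y - \<nu> i - K)) \<in> borel_measurable (law m f)"
    by (intro borel_measurable_sum excess_measurable; assumption)+
  \<comment> \<open>Component \<open>j\<close> alone gives this. Each \<open>3 * K\<close> consists
    of \<open>K / 2\<close> for the bias, \<open>K\<close> for the threshold of the excess and
    \<open>3/2 * K\<close> for the margin in the construction. The index that realises the bound
    varies, so its excess is replaced by the sum of all of them.\<close>
  have "CI y \<subseteq> {T f - (3 * K + A y)..T f + (3 * K + B y)}" for y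
  proof
    fix x assume "x \<in> CI y"
    then obtain i i' where i: "i \<in> {1..k}" "ereal (Th i j y) - ereal (3/2) * \<omega> i j \<le> ereal x"
      and i': "i' \<in> {1..k}" "ereal x \<le> ereal (Th j i' y) + ereal (3/2) * \<omega> j i'"
      using j unfolding mem_CI_iff by blast
    have "max 0 (\<mu> i - Th i j y - K) \<le> A y"
      unfolding A_def by (rule member_le_sum[OF i(1)]) simp_all
    moreover have "Th i j y - 3/2 * w i \<le> x" using i lo(1)[OF i(1)] by simp
    ultimately have 1: "T f - (3 * K + A y) \<le> x" using lo(2,3)[OF i(1)] by simp
    have "max 0 (Th j i' y - \<nu> i' - K) \<le> B y"
      unfolding B_def by (rule member_le_sum[OF i'(1)]) simp_all
    moreover have "x \<le> Th j i' y + 3/2 * v i'" using i' up(1)[OF i'(1)] by simp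
    ultimately have "x \<le> T f + (3 * K + B y)" using up(2,3)[OF i'(1)] by simp
    thus "x \<in> {T f - (3 * K + A y)..T f + (3 * K + B y)}" using 1 by simp
  qed
  hence len: "interval_length (CI y) \<le> ennreal (6 * K + A y + B y)" for y
    using emeasure_mono[of "CI y" "{T f - (3 * K + A y)..T f + (3 * K + B y)}" lborel] A0[of y] B0[of y] K0
    by (simp add: interval_length_def algebra_simps)
  have "(\<integral>\<^sup>+y. interval_length (CI y) \<partial>law m f) \<le> (\<integral>\<^sup>+y. ennreal (6 * K)
      + ((\<Sum>i\<in>{1..k}. ennreal (\<mu> i - Th i j y - K)) + (\<Sum>i\<in>{1..k}. ennreal (Th j i y - \<nu> i - K))) \<partial>law m f)"
  proof (rule nn_integral_mono)
    fix y
    have pos: "ennreal (max 0 x) = ennreal x" for x by (simp add: max_def ennreal_neg)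
    have eq: "ennreal (6 * K + A y + B y) = ennreal (6 * K) + (ennreal (A y) + ennreal (B y))"
      using A0[of y] B0[of y] K0 by (simp add: add.assoc)
    have "ennreal (A y) = (\<Sum>i\<in>{1..k}. ennreal (\<mu> i - Th i j y - K))"
      "ennreal (B y) = (\<Sum>i\<in>{1..k}. ennreal (Th j i y - \<nu> i - K))"
      unfolding A_def B_def by (subst sum_ennreal[symmetric]; simp add: pos)+
    thus "interval_length (CI y) \<le> ennreal (6 * K)
      + ((\<Sum>i\<in>{1..k}. ennreal (\<mu> i - Th i j y - K)) + (\<Sum>i\<in>{1..k}. ennreal (Th j i y - \<nu> i - K)))"
      using len[of y] unfolding eq by simp
  qed
  also have "\<dots> = ennreal (6 * K) + ((\<Sum>i\<in>{1..k}. \<integral>\<^sup>+y. ennreal (\<mu> i - Th i j y - K) \<partial>law m f)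
      + (\<Sum>i\<in>{1..k}. \<integral>\<^sup>+y. ennreal (Th j i y - \<nu> i - K) \<partial>law m f))"
    by (simp only: nn_integral_add nn_integral_sum sum_measurable excess_measurable borel_measurable_const borel_measurable_add)
       (simp add: emeasure_space_1)
  also have "\<dots> \<le> ennreal (6 * K) + ((\<Sum>i\<in>{1..k}. ennreal (2 * \<beta> * K)) + (\<Sum>i\<in>{1..k}. ennreal (2 * \<beta> * K)))"
    using lo(4) up(4) by (intro add_mono sum_mono) auto
  also have "\<dots> = ennreal (6 * K + (real k * (2 * \<beta> * K) + real k * (2 * \<beta> * K)))"
    using K0 \<beta>_bounds by (simp add: ennreal_of_nat_eq_real_of_nat ennreal_mult[symmetric] ennreal_plus[symmetric] del: ennreal_plus)
  \<comment> \<open>The excesses contribute \<open>4 * \<alpha> * K\<close>, at most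
    \<open>2 * K\<close> because \<alpha> < 1/2.\<close>
  also have "\<dots> \<le> ennreal (8 * K)"
    using K0 \<alpha> k_pos mult_right_mono[of \<alpha> "1/2" K] by (intro ennreal_leI) (simp add: ac_simps)
  finally show "(\<integral>\<^sup>+y. interval_length (CI y) \<partial>law m f) \<le> ennreal (8 * K)" .
qed

text \<open>Convexity reduces pairs at distance \<open>\<zeta> / sqrt n\<close> to pairs at distance \<open>z\<^sub>\<alpha> / sqrt n\<close>: shrink both
  points towards a common point of the two parameter spaces.\<close>

lemma minimax_length_ge:
  assumes j: "j \<in> {1..k}" and ab: "a \<in> {1..k}" "b \<in> {1..k}" "a = j \<or> b = j" and f: "f \<in> F a" and g: "g \<in> F b"
    and close: "norm2 (base m) (\<lambda>x. g x - f x) \<le> \<zeta> / sqrt (real n)"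
  shows "ennreal ((1/2 - \<alpha>) * (z_quantile \<alpha> / \<zeta>) * (T g - T f)) \<le> minimax_length m T \<alpha> (F j) \<G>"
  unfolding minimax_length_def
proof (rule INF_greatest)
  fix C assume C: "C \<in> conf_intervals m T \<alpha> \<G>"
  obtain h where h: "h \<in> F a" "h \<in> F b" using setting ab unfolding parameter_setting_def by blast
  \<comment> \<open>The ratio of the two distances. Both points are contracted towards the same
    \<open>h\<close>, so \<open>T g - T f\<close> and the distance are multiplied by exactly
    \<open>u\<close>.\<close>
  define u where "u = z_quantile \<alpha> / \<zeta>"
  have z: "0 < z_quantile \<alpha>" using \<alpha> by (rule z_quantile_pos)
  have "z_quantile \<alpha> \<le> \<zeta>" using \<beta>_bounds \<alpha> by (intro z_quantile_antimono) auto
  hence u: "0 \<le> u" "u \<le> 1" using z \<zeta>_pos by (auto simp: u_def)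
  define f' where "f' x = (1 - u) * h x + u * f x" for x
  define g' where "g' x = (1 - u) * h x + u * g x" for x
  have f': "f' \<in> F a" unfolding f'_def[abs_def] by (intro F_convex ab h f u)
  have g': "g' \<in> F b" unfolding g'_def[abs_def] by (intro F_convex ab h g u)
  have hD: "h \<in> D" "f \<in> D" "g \<in> D" using F_D ab h f g by blast+
  have T: "T g' - T f' = u * (T g - T f)"
    unfolding f'_def[abs_def] g'_def[abs_def] T_linear[OF hD(1,2)] T_linear[OF hD(1,3)] by (simp add: algebra_simps)
  have "norm2 (base m) (\<lambda>x. g' x - f' x) = norm2 (base m) (\<lambda>x. u * (g x - f x))"
    unfolding f'_def g'_def by (simp add: algebra_simps)
  also have "\<dots> = u * norm2 (base m) (\<lambda>x. g x - f x)"
    using u by (simp add: norm2_def power_mult_distrib real_sqrt_mult)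
  also have "\<dots> \<le> u * (\<zeta> / sqrt (real n))" using close u by (intro mult_left_mono)
  also have "\<dots> = z_quantile \<alpha> / sqrt (real n)" using \<zeta>_pos by (simp add: u_def)
  finally have close': "norm2 (base m) (\<lambda>x. g' x - f' x) \<le> z_quantile \<alpha> / sqrt (real n)" .
  have close'': "norm2 (base m) (\<lambda>x. f' x - g' x) \<le> z_quantile \<alpha> / sqrt (real n)"
    using close' by (simp add: norm2_def power2_commute)
  have mem: "f' \<in> \<G>" "g' \<in> \<G>" using f' g' ab by auto
  have sub: "\<G> \<subseteq> L2 (base m)" using F_L2 by auto
  have "(1/2 - \<alpha>) * u * (T g - T f) = (1/2 - \<alpha>) * (T g' - T f')" by (simp add: T)
  also have "\<dots> \<le> (1/2 - \<alpha>) * \<bar>T g' - T f'\<bar>" using \<alpha> by (intro mult_left_mono) auto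
  finally have "ennreal ((1/2 - \<alpha>) * u * (T g - T f)) \<le> ennreal ((1/2 - \<alpha>) * \<bar>T g' - T f'\<bar>)" by (rule ennreal_leI)
  \<comment> \<open>The expected length is taken under whichever of the two points lies in
    \<open>F j\<close>; the cases exchange the roles of \<open>f'\<close> and
    \<open>g'\<close>.\<close>
  also have "\<dots> \<le> max_length m C (F j)"
  proof (cases "b = j")
    case True
    with g' have g'j: "g' \<in> F j" by simp
    show ?thesis unfolding max_length_def
      by (rule order_trans[OF two_point_bound[OF \<alpha> mem sub close' C]], rule SUP_upper[OF g'j])
  next
    case False
    hence f'j: "f' \<in> F j" using ab f' by auto
    show ?thesis unfolding max_length_def abs_minus_commute[of "T g'"]
      by (rule order_trans[OF two_point_bound[OF \<alpha> mem(2,1) sub close'' C]], rule SUP_upper[OF f'j])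
  qed
  finally show "ennreal ((1/2 - \<alpha>) * (z_quantile \<alpha> / \<zeta>) * (T g - T f)) \<le> max_length m C (F j)"
    by (simp add: u_def)
qed

text \<open>If the minimax length is a finite \<open>l\<close>, every admissible pair satisfies
  \<open>T g - T f \<le> c * l\<close>, so all moduli involving \<open>j\<close> are at most
  \<open>c * l\<close> and \<open>CI_length\<close> applies. If it is infinite, the right hand side
  is infinite.\<close>

lemma CI_rate:
  assumes j: "j \<in> {1..k}"
  shows "max_length m CI (F j) \<le> ennreal (12 * \<zeta> / ((1/2 - \<alpha>) * z_quantile \<alpha>)) * minimax_length m T \<alpha> (F j) \<G>"
proof -
  have z: "0 < z_quantile \<alpha>" using \<alpha> by (rule z_quantile_pos)
  define c where "c = \<zeta> / ((1/2 - \<alpha>) * z_quantile \<alpha>)"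
  have c: "0 < c" using z \<zeta>_pos \<alpha> by (simp add: c_def)
  have "max_length m CI (F j) \<le> ennreal (12 * c) * minimax_length m T \<alpha> (F j) \<G>"
  proof (cases "minimax_length m T \<alpha> (F j) \<G>")
    case (real l)
    have le: "\<omega> a b \<le> ereal (c * l)" if ab: "a \<in> {1..k}" "b \<in> {1..k}" "a = j \<or> b = j" for a b
      unfolding modulus_at_def ordered_modulus_def
    proof (rule Sup_least, clarify)
      fix f g assume fg: "norm2 (base m) (\<lambda>x. g x - f x) \<le> \<zeta> / sqrt (real n)" "f \<in> F a" "g \<in> F b"
      have "ennreal ((1/2 - \<alpha>) * (z_quantile \<alpha> / \<zeta>) * (T g - T f)) \<le> ennreal l"
        using minimax_length_ge[OF j ab fg(2,3,1)] real by simp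
      hence "(T g - T f) / c \<le> l" using real by (simp add: ennreal_le_iff c_def ac_simps)
      thus "ereal (T g - T f) \<le> ereal (c * l)" using c by (simp add: divide_le_eq mult.commute)
    qed
    have "max_length m CI (F j) \<le> ennreal (8 * (c * l))" using j by (intro CI_length le) auto
    also have "\<dots> \<le> ennreal (12 * c * l)" using c real by (intro ennreal_leI) auto
    also have "\<dots> = ennreal (12 * c) * ennreal l" using c real by (simp add: ennreal_mult[symmetric])
    finally show ?thesis using real by simp
  next
    case top
    thus ?thesis using c by (simp add: ennreal_mult_top)
  qed
  thus ?thesis by (simp add: c_def)
qed

theorem CI_adaptive:
  "CI \<in> conf_intervals m T \<alpha> \<G> \<and>
    (\<forall>j\<in>{1..k}. minimax_length m T \<alpha> (F j) \<G> \<le> max_length m CI (F j) \<and>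
      max_length m CI (F j) \<le> ennreal (12 * z_quantile (\<alpha> / (2 * real k)) / ((1/2 - \<alpha>) * z_quantile \<alpha>))
        * minimax_length m T \<alpha> (F j) \<G>)"
proof -
  have eq: "\<alpha> / (2 * real k) = \<beta> / 2" by simp
  show ?thesis unfolding eq
  proof (intro conjI ballI CI_in_conf_intervals CI_rate)
    show "minimax_length m T \<alpha> (F j) \<G> \<le> max_length m CI (F j)" for j
      unfolding minimax_length_def by (rule INF_lower[OF CI_in_conf_intervals])
  qed
qed

end

text \<open>The form in which each model verifies \<open>testing\<close>. The normal vector has its
  own index type because it need not be indexed like the coordinates: for white noise the
  coordinates are times and the vector consists of increments.\<close>

lemma testing_by_coordinates:
  fixes P Q :: "('i \<Rightarrow> real) measure"
  assumes P: "prob_space P" "sets P = sets (Pi\<^sub>M K (\<lambda>_. borel))"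
    and Q: "prob_space Q" "sets Q = sets (Pi\<^sub>M K (\<lambda>_. borel))"
    and \<alpha>: "0 < \<alpha>" "\<alpha> < 1/2"
    and coord: "\<And>J. finite J \<Longrightarrow> J \<subseteq> K \<Longrightarrow> \<exists>(I::'j set) (S :: ('j \<Rightarrow> real) \<Rightarrow> 'i \<Rightarrow> real) a b. finite I \<and>
      S \<in> measurable (std_normal_PiM I) (Pi\<^sub>M J (\<lambda>_. borel)) \<and> (\<Sum>i\<in>I. (b i - a i)\<^sup>2) \<le> (z_quantile \<alpha>)\<^sup>2 \<and>
      (\<forall>B\<in>sets (Pi\<^sub>M J (\<lambda>_. borel)).
        measure P (cylinder K J B) = measure (std_normal_PiM I) {z \<in> space (std_normal_PiM I). S (shift_on I a z) \<in> B} \<and>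
        measure Q (cylinder K J B) = measure (std_normal_PiM I) {z \<in> space (std_normal_PiM I). S (shift_on I b z) \<in> B})"
    and A: "A \<in> sets (Pi\<^sub>M K (\<lambda>_. borel))" and le: "measure P A \<le> \<alpha>"
  shows "measure Q A \<le> 1/2"
proof (rule testing_by_cylinders[OF P Q _ _ A le])
  fix J and B :: "('i \<Rightarrow> real) set" assume J: "finite J" "J \<subseteq> K" and B: "B \<in> sets (Pi\<^sub>M J (\<lambda>_. borel))"
  obtain I :: "'j set" and S :: "('j \<Rightarrow> real) \<Rightarrow> 'i \<Rightarrow> real" and a b where I: "finite I" "S \<in> measurable (std_normal_PiM I) (Pi\<^sub>M J (\<lambda>_. borel))"
    "(\<Sum>i\<in>I. (b i - a i)\<^sup>2) \<le> (z_quantile \<alpha>)\<^sup>2"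
    and P_eq: "measure P (cylinder K J B) = measure (std_normal_PiM I) {z \<in> space (std_normal_PiM I). S (shift_on I a z) \<in> B}"
    and Q_eq: "measure Q (cylinder K J B) = measure (std_normal_PiM I) {z \<in> space (std_normal_PiM I). S (shift_on I b z) \<in> B}"
    using coord[OF J] B by blast
  let ?B = "S -` B \<inter> space (std_normal_PiM I)"
  have B': "?B \<in> sets (std_normal_PiM I)" using I(2) B by (rule measurable_sets)
  have "shift_on I c -` ?B \<inter> space (std_normal_PiM I) = {z \<in> space (std_normal_PiM I). S (shift_on I c z) \<in> B}" for c
    using measurable_space[OF measurable_shift_on] by blast
  thus "measure Q (cylinder K J B) \<le> 1/2 + exp ((z_quantile \<alpha>)\<^sup>2 / 2) * max 0 (measure P (cylinder K J B) - \<alpha>)"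
    using neyman_pearson_shifts[OF I(1) \<alpha> B' I(3)] by (simp only: P_eq Q_eq)
qed simp

lemma norm2_squared: "(norm2 \<mu> f)\<^sup>2 = (\<integral>x. (f x)\<^sup>2 \<partial>\<mu>)"
  by (simp add: norm2_def integral_nonneg_AE)

lemma scaled_norm2_le:
  assumes "norm2 \<mu> f \<le> z / sqrt (real n)" "0 < n" "0 \<le> z"
  shows "real n * (\<integral>x. (f x)\<^sup>2 \<partial>\<mu>) \<le> z\<^sup>2"
proof -
  have "0 \<le> norm2 \<mu> f" by (simp add: norm2_def integral_nonneg_AE)
  hence "(norm2 \<mu> f)\<^sup>2 \<le> (z / sqrt (real n))\<^sup>2" using assms by (intro power_mono)
  thus ?thesis using assms(2) by (simp add: norm2_squared power_divide field_simps)
qed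

lemma L2_diff:
  assumes "f \<in> L2 \<mu>" "g \<in> L2 \<mu>" shows "(\<lambda>x. g x - f x) \<in> L2 \<mu>"
proof -
  have [measurable]: "f \<in> borel_measurable \<mu>" "g \<in> borel_measurable \<mu>" using assms by (auto simp: L2_def)
  have "integrable \<mu> (\<lambda>x. (g x - f x)\<^sup>2)"
  proof (rule Bochner_Integration.integrable_bound)
    show "integrable \<mu> (\<lambda>x. 2 * (g x)\<^sup>2 + 2 * (f x)\<^sup>2)" using assms by (auto simp: L2_def)
    have "(g x - f x)\<^sup>2 \<le> 2 * (g x)\<^sup>2 + 2 * (f x)\<^sup>2" for x
      using sum_squares_ge_zero[of "g x + f x" 0] by (simp add: power2_eq_square algebra_simps)
    thus "AE x in \<mu>. norm ((g x - f x)\<^sup>2) \<le> norm (2 * (g x)\<^sup>2 + 2 * (f x)\<^sup>2)" by (intro AE_I2) auto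
  qed simp
  thus ?thesis by (simp add: L2_def)
qed

section \<open>The Gaussian sequence model\<close>

lemma measurable_sequence_path:
  "(\<lambda>z. \<lambda>i\<in>M. f i + z i / sqrt (real n)) \<in> measurable (std_normal_PiM M) (Pi\<^sub>M M (\<lambda>_. borel))"
  by measurable

lemma sequence_law_eq:
  "sequence_law n M f = distr (std_normal_PiM M) (Pi\<^sub>M M (\<lambda>_. borel)) (\<lambda>z. \<lambda>i\<in>M. f i + z i / sqrt (real n))"
  by (simp add: sequence_law_def obs_space_def)

lemma prob_space_sequence_law: "prob_space (sequence_law n M f)"
  unfolding sequence_law_eq
  by (intro prob_space.prob_space_distr prob_space_std_normal_PiM measurable_sequence_path)

lemma sets_sequence_law: "sets (sequence_law n M f) = sets (Pi\<^sub>M M (\<lambda>_. borel))"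
  by (simp add: sequence_law_eq)

lemma sequence_law_linear_combination:
  assumes "finite A" "A \<subseteq> M"
  shows "\<exists>\<mu> \<sigma>. has_normal (sequence_law n M f) (\<lambda>y. \<Sum>i\<in>A. h i * y i) \<mu> \<sigma>"
proof -
  have meas: "(\<lambda>y. \<Sum>i\<in>A. h i * y i) \<in> borel_measurable (Pi\<^sub>M M (\<lambda>_. borel))"
    using assms by (intro borel_measurable_sum borel_measurable_times borel_measurable_const measurable_component_singleton) auto
  let ?\<mu> = "\<Sum>i\<in>A. h i * f i" and ?c = "\<lambda>i. h i / sqrt (real n)"
  let ?X = "\<lambda>z. ?\<mu> + (\<Sum>i\<in>A. ?c i * z i)"
  have restr: "(\<lambda>z. restrict z A) \<in> measurable (std_normal_PiM M) (std_normal_PiM A)"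
    using assms by (intro measurable_restrict_subset)
  have "has_normal (distr (std_normal_PiM M) (std_normal_PiM A) (\<lambda>z. restrict z A)) ?X ?\<mu> (sqrt (\<Sum>i\<in>A. (?c i)\<^sup>2))"
    using has_normal_linear_combination[OF assms(1)] by (simp only: std_normal_prod.distr_PiM_restrict_finite[OF assms])
  hence N: "has_normal (std_normal_PiM M) (\<lambda>z. ?X (restrict z A)) ?\<mu> (sqrt (\<Sum>i\<in>A. (?c i)\<^sup>2))"
    by (subst (asm) has_normal_distr) (use restr assms in auto)
  have "?X (restrict z A) = (\<Sum>i\<in>A. h i * (\<lambda>i\<in>M. f i + z i / sqrt (real n)) i)" for z
  proof -
    have "(\<Sum>i\<in>A. h i * (\<lambda>i\<in>M. f i + z i / sqrt (real n)) i) = (\<Sum>i\<in>A. h i * f i + ?c i * z i)"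
      using assms by (intro sum.cong) (auto simp: algebra_simps)
    thus ?thesis by (simp add: sum.distrib)
  qed
  thus ?thesis using N unfolding sequence_law_eq has_normal_distr[OF measurable_sequence_path meas] by auto
qed

text \<open>The series converges along the directed set of finite subsets, whereas the limit lemma
  speaks of sequences. So for each \<open>r\<close> a finite set with mean square error below
  \<open>1 / Suc r\<close> is picked, for the given \<open>f\<close>.\<close>

lemma sequence_int_normal:
  assumes X: "sequence_int n M h X" and f: "f \<in> L2 (count_space M)"
  shows "\<exists>\<mu> \<sigma>. has_normal (sequence_law n M f) X \<mu> \<sigma>"
proof -
  interpret prob_space "sequence_law n M f" by (rule prob_space_sequence_law)
  let ?F = "finite_subsets_at_top M"
  have lim: "((\<lambda>A. \<integral>\<^sup>+y. ennreal ((X y - (\<Sum>i\<in>A. h i * y i))\<^sup>2) \<partial>sequence_law n M f) \<longlongrightarrow> 0) ?F"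
    using X f by (simp add: sequence_int_def)
  have "\<forall>r. \<exists>A. finite A \<and> A \<subseteq> M \<and>
    (\<integral>\<^sup>+y. ennreal ((X y - (\<Sum>i\<in>A. h i * y i))\<^sup>2) \<partial>sequence_law n M f) < ennreal (1 / real (Suc r))"
  proof
    fix r
    have "eventually (\<lambda>A. (\<integral>\<^sup>+y. ennreal ((X y - (\<Sum>i\<in>A. h i * y i))\<^sup>2) \<partial>sequence_law n M f) < ennreal (1 / real (Suc r))) ?F"
      using lim by (rule order_tendstoD) simp
    moreover have "eventually (\<lambda>A. finite A \<and> A \<subseteq> M) ?F"
      by (rule eventually_finite_subsets_at_top_weakI) simp
    ultimately have "eventually (\<lambda>A. finite A \<and> A \<subseteq> M \<and>
      (\<integral>\<^sup>+y. ennreal ((X y - (\<Sum>i\<in>A. h i * y i))\<^sup>2) \<partial>sequence_law n M f) < ennreal (1 / real (Suc r))) ?F"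
      by eventually_elim simp
    thus "\<exists>A. finite A \<and> A \<subseteq> M \<and>
      (\<integral>\<^sup>+y. ennreal ((X y - (\<Sum>i\<in>A. h i * y i))\<^sup>2) \<partial>sequence_law n M f) < ennreal (1 / real (Suc r))"
      by (rule eventually_happens'[OF finite_subsets_at_top_neq_bot])
  qed
  then obtain A where A: "\<And>r. finite (A r)" "\<And>r. A r \<subseteq> M"
    "\<And>r. (\<integral>\<^sup>+y. ennreal ((X y - (\<Sum>i\<in>A r. h i * y i))\<^sup>2) \<partial>sequence_law n M f) < ennreal (1 / real (Suc r))"
    by metis
  show ?thesis
  proof (rule has_normal_L2_limit[where S = "\<lambda>r y. \<Sum>i\<in>A r. h i * y i"])
    show "X \<in> borel_measurable (sequence_law n M f)"
      using X by (simp add: sequence_int_def sequence_law_eq obs_space_def)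
    show "(\<lambda>r. \<integral>\<^sup>+y. ennreal ((X y - (\<Sum>i\<in>A r. h i * y i))\<^sup>2) \<partial>sequence_law n M f) \<longlonglongrightarrow> 0"
    proof (rule tendsto_sandwich[OF _ _ tendsto_const])
      have "(\<lambda>r. ennreal (1 / real (Suc r))) \<longlonglongrightarrow> ennreal 0"
        by (intro tendsto_ennrealI lim_1_over_n[THEN filterlim_compose] filterlim_Suc)
      thus "(\<lambda>r. ennreal (1 / real (Suc r))) \<longlonglongrightarrow> 0" by simp
    qed (use A(3) in \<open>auto intro!: always_eventually less_imp_le\<close>)
  qed (rule sequence_law_linear_combination[OF A(1,2)])
qed

text \<open>Writing \<open>f i + z i / sqrt n\<close> as
  \<open>(z i + sqrt n * f i) / sqrt n\<close> separates a shift that depends on \<open>f\<close>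
  from a scaling that does not.\<close>

lemma sequence_law_cylinder:
  assumes J: "finite J" "J \<subseteq> M" and B: "B \<in> sets (Pi\<^sub>M J (\<lambda>_. borel))" and n: "0 < n"
  shows "measure (sequence_law n M f) (cylinder M J B) = measure (std_normal_PiM J)
    {z \<in> space (std_normal_PiM J). (\<lambda>i\<in>J. shift_on J (\<lambda>i. sqrt (real n) * f i) z i / sqrt (real n)) \<in> B}"
proof -
  let ?S = "\<lambda>z. \<lambda>i\<in>J. shift_on J (\<lambda>i. sqrt (real n) * f i) z i / sqrt (real n)"
  have restr: "(\<lambda>z. restrict z J) \<in> measurable (std_normal_PiM M) (std_normal_PiM J)"
    using J by (intro measurable_restrict_subset)
  have "(\<lambda>z. \<lambda>i\<in>J. z i / sqrt (real n)) \<in> measurable (std_normal_PiM J) (Pi\<^sub>M J (\<lambda>_. borel))"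
    by measurable
  hence "?S \<in> measurable (std_normal_PiM J) (Pi\<^sub>M J (\<lambda>_. borel))"
    by (rule measurable_compose[OF measurable_shift_on])
  from measurable_sets[OF this B] have S: "{z \<in> space (std_normal_PiM J). ?S z \<in> B} \<in> sets (std_normal_PiM J)"
    by (simp add: vimage_def Int_def conj_commute)
  have eq: "restrict (\<lambda>i\<in>M. f i + z i / sqrt (real n)) J = ?S (restrict z J)" for z
    using J n by (auto simp: shift_on_def fun_eq_iff restrict_def field_simps)
  have "measure (sequence_law n M f) (cylinder M J B)
    = measure (std_normal_PiM M) {z \<in> space (std_normal_PiM M). ?S (restrict z J) \<in> B}"
    unfolding sequence_law_eq using measurable_space[OF measurable_sequence_path]
    by (subst measure_distr[OF measurable_sequence_path cylinder_measurable[OF J(2) B]])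
       (auto simp: cylinder_def eq simp del: restrict_restrict intro!: arg_cong2[where f = measure])
  also have "\<dots> = measure (distr (std_normal_PiM M) (std_normal_PiM J) (\<lambda>z. restrict z J)) {z \<in> space (std_normal_PiM J). ?S z \<in> B}"
    using measurable_space[OF restr] by (subst measure_distr[OF restr S]) (auto intro!: arg_cong2[where f = measure])
  finally show ?thesis by (simp only: std_normal_prod.distr_PiM_restrict_finite[OF J])
qed

theorem gaussian_experiment_sequence:
  fixes M :: "'i set"
  assumes n: "0 < n"
  shows "gaussian_experiment (gaussian_sequence n M) n"
proof (rule gaussian_experiment.intro)
  fix a f g A
  assume a: "0 < a" "a < 1/2" and f: "f \<in> L2 (base (gaussian_sequence n M))" and g: "g \<in> L2 (base (gaussian_sequence n M))"
    and close: "norm2 (base (gaussian_sequence n M)) (\<lambda>x. g x - f x) \<le> z_quantile a / sqrt (real n)"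
    and A: "A \<in> sets (obs_space (base (gaussian_sequence n M)))" "measure (law (gaussian_sequence n M) f) A \<le> a"
  let ?u = "\<lambda>x. (g x - f x)\<^sup>2"
  have int: "integrable (count_space M) ?u"
    using L2_diff[OF f g] by (simp add: L2_def gaussian_sequence_def)
  have le: "real n * (\<integral>x. ?u x \<partial>count_space M) \<le> (z_quantile a)\<^sup>2"
    using close n z_quantile_pos[OF a] by (intro scaled_norm2_le) (auto simp: gaussian_sequence_def)
  have "measure (sequence_law n M g) A \<le> 1/2"
  proof (rule testing_by_coordinates[where P = "sequence_law n M f" and K = M and \<alpha> = a])
    fix J assume J: "finite J" "J \<subseteq> M"
    have "(\<Sum>i\<in>J. ?u i) = (\<integral>x. ?u x \<partial>restrict_space (count_space M) J)"
      using J by (simp add: restrict_count_space Int_absorb2 lebesgue_integral_count_space_finite)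
    also have "\<dots> = (\<integral>x. indicator J x * ?u x \<partial>count_space M)"
      using J by (subst integral_restrict_space) (auto simp: Int_absorb1)
    also have "\<dots> \<le> (\<integral>x. ?u x \<partial>count_space M)"
      using int J by (intro integral_mono integrable_mult_indicator[where 'b = real, simplified]) (auto simp: indicator_def)
    finally have "real n * (\<Sum>i\<in>J. ?u i) \<le> real n * (\<integral>x. ?u x \<partial>count_space M)" by (intro mult_left_mono) auto
    also have "\<dots> \<le> (z_quantile a)\<^sup>2" by (rule le)
    also have "real n * (\<Sum>i\<in>J. ?u i) = (\<Sum>i\<in>J. (sqrt (real n) * g i - sqrt (real n) * f i)\<^sup>2)"
      by (simp add: sum_distrib_left right_diff_distrib[symmetric] power_mult_distrib)
    finally have sum: "(\<Sum>i\<in>J. (sqrt (real n) * g i - sqrt (real n) * f i)\<^sup>2) \<le> (z_quantile a)\<^sup>2" .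
    show "\<exists>(I::'i set) S b c. finite I \<and>
      S \<in> measurable (std_normal_PiM I) (Pi\<^sub>M J (\<lambda>_. borel)) \<and> (\<Sum>i\<in>I. (c i - b i)\<^sup>2) \<le> (z_quantile a)\<^sup>2 \<and>
      (\<forall>B\<in>sets (Pi\<^sub>M J (\<lambda>_. borel)).
        measure (sequence_law n M f) (cylinder M J B) = measure (std_normal_PiM I) {z \<in> space (std_normal_PiM I). S (shift_on I b z) \<in> B} \<and>
        measure (sequence_law n M g) (cylinder M J B) = measure (std_normal_PiM I) {z \<in> space (std_normal_PiM I). S (shift_on I c z) \<in> B})"
      using J sum sequence_law_cylinder[OF J _ n]
      by (intro exI[of _ J] exI[of _ "\<lambda>z. \<lambda>i\<in>J. z i / sqrt (real n)"] exI[of _ "\<lambda>i. sqrt (real n) * f i"]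
          exI[of _ "\<lambda>i. sqrt (real n) * g i"]) auto
  qed (use a A in \<open>auto simp: prob_space_sequence_law sets_sequence_law gaussian_sequence_def obs_space_def\<close>)
  thus "measure (law (gaussian_sequence n M) g) A \<le> 1/2" by (simp add: gaussian_sequence_def)
next
  show "0 < n" by (rule n)
  show "prob_space (law (gaussian_sequence n M) f)" for f
    by (simp add: gaussian_sequence_def prob_space_sequence_law)
  show "sets (law (gaussian_sequence n M) f) = sets (obs_space (base (gaussian_sequence n M)))" for f
    by (simp add: gaussian_sequence_def sets_sequence_law obs_space_def)
  show "X \<in> borel_measurable (obs_space (base (gaussian_sequence n M)))" if "stoch_int (gaussian_sequence n M) h X" for h X
    using that by (simp add: gaussian_sequence_def sequence_int_def)
  show "\<exists>\<mu> \<sigma>. has_normal (law (gaussian_sequence n M) f) X \<mu> \<sigma>"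
    if "stoch_int (gaussian_sequence n M) h X" "f \<in> L2 (base (gaussian_sequence n M))" for h X f
    using that sequence_int_normal[of n M h X f] by (simp add: gaussian_sequence_def)
qed

section \<open>The white noise model\<close>

abbreviation unit_interval :: "real set" where "unit_interval \<equiv> {-1/2..1/2}"

lemma finite_measure_unit_base: "finite_measure unit_base"
  by (intro finite_measure_lebesgue_on) auto

lemma unit_base_integrable: "f \<in> L2 unit_base \<Longrightarrow> integrable unit_base f"
  using finite_measure.square_integrable_imp_integrable[OF finite_measure_unit_base] by (auto simp: L2_def)

lemma measurable_unit_base:
  fixes f :: "real \<Rightarrow> real"
  shows "f \<in> borel_measurable borel \<Longrightarrow> f \<in> borel_measurable unit_base"
  by (intro measurable_restrict_space1 measurable_completion) simp

text \<open>All drifts become integrals against the one measure \<open>unit_base\<close>, so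
  differences in the time or in \<open>f\<close> become differences of integrands.\<close>

lemma integral_upto:
  fixes f :: "real \<Rightarrow> real"
  assumes "t \<in> unit_interval"
  shows "integral\<^sup>L (lebesgue_on {-1/2..t}) f = (\<integral>x. indicator {..t} x * f x \<partial>unit_base)"
proof -
  have "integral\<^sup>L (lebesgue_on {-1/2..t}) f = (\<integral>x. indicator {-1/2..t} x *\<^sub>R f x \<partial>lebesgue)"
    by (subst integral_restrict_space) auto
  also have "\<dots> = (\<integral>x. indicator unit_interval x *\<^sub>R (indicator {..t} x * f x) \<partial>lebesgue)"
    using assms by (intro Bochner_Integration.integral_cong) (auto simp: indicator_def)
  also have "\<dots> = (\<integral>x. indicator {..t} x * f x \<partial>unit_base)"
    by (subst integral_restrict_space) auto
  finally show ?thesis .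
qed

lemma integrable_indicator_mult:
  fixes f :: "real \<Rightarrow> real"
  assumes "integrable unit_base f" "A \<in> sets borel"
  shows "integrable unit_base (\<lambda>x. indicator A x * f x)"
proof (rule Bochner_Integration.integrable_bound[OF assms(1)])
  have "(indicator A :: real \<Rightarrow> real) \<in> borel_measurable unit_base" using assms(2) by (intro measurable_unit_base) auto
  thus "(\<lambda>x. indicator A x * f x) \<in> borel_measurable unit_base" using assms(1) by auto
qed (auto simp: indicator_def)

section \<open>The drift of the path and partitions of the time interval\<close>

definition drift :: "(real \<Rightarrow> real) \<Rightarrow> real \<Rightarrow> real" where
  "drift f t = integral\<^sup>L (lebesgue_on {-1/2..t}) f"

lemma drift_increment:
  assumes "f \<in> L2 unit_base" "s \<in> unit_interval" "t \<in> unit_interval" "s \<le> t"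
  shows "drift f t - drift f s = (\<integral>x. indicator {s<..t} x * f x \<partial>unit_base)"
proof -
  note f = unit_base_integrable[OF assms(1)]
  have "drift f t - drift f s = (\<integral>x. indicator {..t} x * f x - indicator {..s} x * f x \<partial>unit_base)"
    unfolding drift_def integral_upto[OF assms(2)] integral_upto[OF assms(3)]
    by (rule Bochner_Integration.integral_diff[symmetric]; rule integrable_indicator_mult[OF f]; simp)
  also have "\<dots> = (\<integral>x. indicator {s<..t} x * f x \<partial>unit_base)"
    using assms(4) by (intro Bochner_Integration.integral_cong) (auto simp: indicator_def)
  finally show ?thesis .
qed

lemma drift_start: "drift f (-1/2) = 0"
proof -
  have "drift f (-1/2) = (\<integral>x. indicator {-1/2..-1/2} x *\<^sub>R f x \<partial>lebesgue)"
    unfolding drift_def by (subst integral_restrict_space) auto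
  also have "\<dots> = 0"
  proof (rule integral_eq_zero_AE)
    have "AE x in lebesgue. x \<noteq> (-1/2 :: real)"
      by (rule AE_I'[of "{-1/2}"]) (auto simp: null_sets_completionI)
    thus "AE x in lebesgue. indicator {-1/2..-1/2} x *\<^sub>R f x = 0" by eventually_elim auto
  qed
  finally show ?thesis .
qed

text \<open>A partition starts at -1/2, where Brownian motion vanishes almost surely. Having at
  least one cell makes the family of increments nonempty, as the product form of their joint law in
  \<open>distr_Z\<close> requires.\<close>

locale time_partition =
  fixes t :: "nat \<Rightarrow> real" and N :: nat
  assumes mono: "strict_mono_on {..N} t" and range: "t ` {..N} \<subseteq> unit_interval"
    and start: "t 0 = -1/2" and N_pos: "0 < N"
begin

definition width :: "nat \<Rightarrow> real" where "width i = t (Suc i) - t i"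

lemma t_unit: "i \<le> N \<Longrightarrow> t i \<in> unit_interval"
  using range by auto

lemma t_less: "i < N \<Longrightarrow> t i < t (Suc i)"
  by (rule strict_mono_onD[OF mono]) auto

lemma width_pos: "i < N \<Longrightarrow> 0 < width i"
  using t_less by (simp add: width_def)

text \<open>Cauchy-Schwarz on each cell. Equivalently, the left hand side is the squared norm of the
  projection of \<open>u\<close> onto the step functions on the cells.\<close>

lemma drift_energy:
  assumes u: "u \<in> L2 unit_base"
  shows "(\<Sum>i<N. (drift u (t (Suc i)) - drift u (t i))\<^sup>2 / width i) \<le> (\<integral>x. (u x)\<^sup>2 \<partial>unit_base)"
proof -
  let ?e = "\<lambda>i x. indicator {t i<..t (Suc i)} x :: real"
  note int_u = unit_base_integrable[OF u]
  have int_u2: "integrable unit_base (\<lambda>x. (u x)\<^sup>2)" using u by (simp add: L2_def)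
  have int_1: "integrable unit_base (\<lambda>_. 1::real)"
    using finite_measure.integrable_const[OF finite_measure_unit_base] .
  have "(drift u (t (Suc i)) - drift u (t i))\<^sup>2 / width i \<le> (\<integral>x. ?e i x * (u x)\<^sup>2 \<partial>unit_base)" if i: "i < N" for i
  proof -
    define d where "d = drift u (t (Suc i)) - drift u (t i)"
    \<comment> \<open>The mean of \<open>u\<close> over the cell; expanding the integral of the
      square of \<open>u - c\<close> then leaves exactly the term
      \<open>d\<^sup>2 / width i\<close>.\<close>
    define c where "c = d / width i"
    have d: "(\<integral>x. ?e i x * u x \<partial>unit_base) = d"
      unfolding d_def using i t_unit t_less[OF i] by (intro drift_increment[symmetric] u) auto
    have w: "(\<integral>x. ?e i x * 1 \<partial>unit_base) = width i"
    proof -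
      have "(\<integral>x. ?e i x * 1 \<partial>unit_base) = (\<integral>x. indicator unit_interval x *\<^sub>R (?e i x * 1) \<partial>lebesgue)"
        by (subst integral_restrict_space) auto
      also have "\<dots> = (\<integral>x. ?e i x \<partial>lebesgue)"
        using t_unit[of i] t_unit[of "Suc i"] i by (intro Bochner_Integration.integral_cong) (auto simp: indicator_def)
      also have "\<dots> = width i" using t_less[OF i] by (simp add: width_def)
      finally show ?thesis .
    qed
    have "0 \<le> (\<integral>x. ?e i x * (u x - c)\<^sup>2 \<partial>unit_base)" by (intro integral_nonneg_AE) auto
    also have "\<dots> = (\<integral>x. ?e i x * (u x)\<^sup>2 - (2 * c) * (?e i x * u x) + c\<^sup>2 * (?e i x * 1) \<partial>unit_base)"
      by (intro Bochner_Integration.integral_cong) (auto simp: power2_eq_square algebra_simps)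
    also have "\<dots> = (\<integral>x. ?e i x * (u x)\<^sup>2 \<partial>unit_base) - (2 * c) * d + c\<^sup>2 * width i"
    proof -
      have "integrable unit_base (\<lambda>x. ?e i x * (u x)\<^sup>2)"
        by (rule integrable_indicator_mult[OF int_u2]) simp
      moreover have "integrable unit_base (\<lambda>x. ?e i x * u x)"
        by (rule integrable_indicator_mult[OF int_u]) simp
      moreover have "integrable unit_base (\<lambda>x. ?e i x * 1)"
        by (rule integrable_indicator_mult[OF int_1]) simp
      ultimately show ?thesis unfolding d[symmetric] w[symmetric] by simp
    qed
    also have "\<dots> = (\<integral>x. ?e i x * (u x)\<^sup>2 \<partial>unit_base) - d\<^sup>2 / width i"
      using width_pos[OF i] by (simp add: c_def power2_eq_square field_simps)
    finally show ?thesis by (simp add: d_def)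
  qed
  hence "(\<Sum>i<N. (drift u (t (Suc i)) - drift u (t i))\<^sup>2 / width i) \<le> (\<Sum>i<N. \<integral>x. ?e i x * (u x)\<^sup>2 \<partial>unit_base)"
    by (intro sum_mono) auto
  also have "\<dots> = (\<integral>x. (\<Sum>i<N. ?e i x * (u x)\<^sup>2) \<partial>unit_base)"
    by (rule Bochner_Integration.integral_sum[symmetric], rule integrable_indicator_mult[OF int_u2]) simp
  also have "\<dots> \<le> (\<integral>x. (u x)\<^sup>2 \<partial>unit_base)"
  proof (rule integral_mono)
    fix x
    \<comment> \<open>Disjointness of the cells, in the form of a telescoping sum of indicators of
      half lines.\<close>
    have "(\<Sum>i<N. ?e i x) = (\<Sum>i<N. indicator {..t (Suc i)} x - indicator {..t i} x)"
      using t_less by (intro sum.cong) (force simp: indicator_def)+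
    also have "\<dots> = indicator {..t N} x - indicator {..t 0} x"
      by (rule sum_lessThan_telescope)
    also have "\<dots> \<le> 1" by (simp add: indicator_def)
    finally have "(\<Sum>i<N. ?e i x) * (u x)\<^sup>2 \<le> 1 * (u x)\<^sup>2" by (intro mult_right_mono) auto
    thus "(\<Sum>i<N. ?e i x * (u x)\<^sup>2) \<le> (u x)\<^sup>2" by (simp add: sum_distrib_right)
  qed (rule Bochner_Integration.integrable_sum, rule integrable_indicator_mult[OF int_u2], simp, rule int_u2)
  finally show ?thesis .
qed

end

lemma time_partition_exists:
  assumes "finite J" "J \<subseteq> unit_interval"
  obtains t N where "time_partition t N" "J \<subseteq> t ` {..N}"
proof -
  \<comment> \<open>Adding -1/2 gives the required starting point; adding 1/2 as well guarantees two
    distinct points and so at least one cell.\<close>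
  define J' where "J' = insert (-1/2) (insert (1/2) J)"
  have J': "finite J'" "J' \<subseteq> unit_interval" using assms by (auto simp: J'_def)
  define xs where "xs = sorted_list_of_set J'"
  have xs: "set xs = J'" "sorted_wrt (<) xs" using J' by (auto simp: xs_def)
  define N where "N = length xs - 1"
  have "card {-1/2, 1/2::real} \<le> card J'" using J' by (intro card_mono) (auto simp: J'_def)
  hence len: "2 \<le> length xs" using J' by (simp add: xs_def)
  have img: "(!) xs ` {..N} = J'"
    unfolding xs(1)[symmetric] set_conv_nth using len by (auto simp: N_def image_iff)
  have "time_partition ((!) xs) N"
  proof
    show "strict_mono_on {..N} ((!) xs)"
      using xs(2) len by (intro strict_mono_onI) (auto simp: sorted_wrt_iff_nth_less N_def)
    show "(!) xs ` {..N} \<subseteq> unit_interval" using img J' by simp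
    have "-1/2 \<in> (!) xs ` {..N}" unfolding img by (simp add: J'_def)
    then obtain p where p: "p \<le> N" "xs ! p = -1/2" by auto
    have "xs ! 0 \<in> unit_interval" using img J' by auto
    hence "\<not> xs ! 0 < xs ! p" using p by simp
    moreover have "p < length xs" using p(1) len unfolding N_def by linarith
    ultimately have "\<not> 0 < p" using xs(2)[unfolded sorted_wrt_iff_nth_less, rule_format, of 0 p] by blast
    thus "xs ! 0 = -1/2" using p by simp
    show "0 < N" using len by (simp add: N_def)
  qed
  thus ?thesis using that img by (auto simp: J'_def)
qed

text \<open>The intervals of a step function may overlap. Over a common partition a triple
  \<open>(a, t p, t q)\<close> contributes \<open>a\<close> to the increments from \<open>p\<close>
  up to \<open>q - 1\<close>, so the integral becomes a linear combination of independent
  increments.\<close>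

lemma step_int_increments:
  assumes "\<And>a u v. (a, u, v) \<in> set s \<Longrightarrow> u \<in> t ` {..N} \<and> v \<in> t ` {..N}"
  shows "\<exists>c. \<forall>y. step_int s y = (\<Sum>i<N. c i * (y (t (Suc i)) - y (t i)))"
  using assms
proof (induction s)
  case Nil
  show ?case by (intro exI[of _ "\<lambda>_. 0"]) (simp add: step_int_def)
next
  case (Cons x s)
  obtain a u v where x: "x = (a, u, v)" by (cases x)
  obtain c where c: "\<And>y. step_int s y = (\<Sum>i<N. c i * (y (t (Suc i)) - y (t i)))" using Cons by force
  obtain p q where pq: "p \<le> N" "q \<le> N" "u = t p" "v = t q" using Cons.prems[of a u v] x by auto
  have upto: "y (t r) = y (t 0) + (\<Sum>i<N. (if i < r then 1 else 0) * (y (t (Suc i)) - y (t i)))" if "r \<le> N" for y :: "real \<Rightarrow> real" and r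
  proof -
    have "(\<Sum>i<N. (if i < r then 1 else 0) * (y (t (Suc i)) - y (t i))) = (\<Sum>i<r. y (t (Suc i)) - y (t i))"
      using that by (intro sum.mono_neutral_cong_right) auto
    also have "\<dots> = y (t r) - y (t 0)" by (rule sum_lessThan_telescope)
    finally show ?thesis by simp
  qed
  have "step_int (x # s) y = (\<Sum>i<N. (a * ((if i < q then 1 else 0) - (if i < p then 1 else 0)) + c i) * (y (t (Suc i)) - y (t i)))" for y
  proof -
    have "step_int (x # s) y = a * (y v - y u) + step_int s y" by (simp add: step_int_def x)
    also have "y v - y u = (\<Sum>i<N. (if i < q then 1 else 0) * (y (t (Suc i)) - y (t i))) - (\<Sum>i<N. (if i < p then 1 else 0) * (y (t (Suc i)) - y (t i)))"
      unfolding pq using upto[OF pq(1), of y] upto[OF pq(2), of y] by linarith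
    also have "\<dots> = (\<Sum>i<N. ((if i < q then 1 else 0) - (if i < p then 1 else 0)) * (y (t (Suc i)) - y (t i)))"
      by (simp only: sum_subtractf[symmetric] left_diff_distrib[symmetric])
    also have "a * \<dots> + step_int s y = (\<Sum>i<N. a * (((if i < q then 1 else 0) - (if i < p then 1 else 0)) * (y (t (Suc i)) - y (t i))) + c i * (y (t (Suc i)) - y (t i)))"
      by (simp only: sum_distrib_left c sum.distrib)
    finally show ?thesis by (simp only: distrib_right mult.assoc)
  qed
  thus ?case
    by (intro exI[of _ "\<lambda>i. a * ((if i < q then 1 else 0) - (if i < p then 1 else 0)) + c i"] allI)
qed

section \<open>Finite-dimensional distributions of the observed path\<close>

locale white_noise_model =
  fixes \<Omega> :: "'w measure" and W :: "real \<Rightarrow> 'w \<Rightarrow> real" and n :: nat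
  assumes bm: "brownian_motion \<Omega> W" and n: "0 < n"
begin

sublocale prob_space \<Omega>
  using bm by (simp add: brownian_motion_def)

lemma W_measurable: "t \<in> unit_interval \<Longrightarrow> W t \<in> borel_measurable \<Omega>"
  using bm by (simp add: brownian_motion_def)

definition path :: "(real \<Rightarrow> real) \<Rightarrow> 'w \<Rightarrow> real \<Rightarrow> real" where
  "path f \<omega> = (\<lambda>t\<in>unit_interval. drift f t + W t \<omega> / sqrt (real n))"

lemma measurable_path: "path f \<in> measurable \<Omega> (Pi\<^sub>M unit_interval (\<lambda>_. borel))"
  unfolding path_def
  by (intro measurable_restrict borel_measurable_add borel_measurable_divide W_measurable borel_measurable_const)

lemma white_noise_law_eq: "white_noise_law n \<Omega> W f = distr \<Omega> (Pi\<^sub>M unit_interval (\<lambda>_. borel)) (path f)"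
  by (simp add: white_noise_law_def obs_space_def path_def[abs_def] drift_def)

lemma sets_white_noise_law: "sets (white_noise_law n \<Omega> W f) = sets (Pi\<^sub>M unit_interval (\<lambda>_. borel))"
  by (simp add: white_noise_law_eq)

lemma prob_space_white_noise_law: "prob_space (white_noise_law n \<Omega> W f)"
  unfolding white_noise_law_eq by (intro prob_space_distr measurable_path)

end

locale partitioned_white_noise = white_noise_model \<Omega> W n + time_partition t N
  for \<Omega> :: "'w measure" and W :: "real \<Rightarrow> 'w \<Rightarrow> real" and n :: nat and t :: "nat \<Rightarrow> real" and N :: nat
begin

definition Z :: "'w \<Rightarrow> nat \<Rightarrow> real" where
  "Z \<omega> = (\<lambda>i\<in>{..<N}. (W (t (Suc i)) \<omega> - W (t i) \<omega>) / sqrt (width i))"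

text \<open>The drift increment in units of the noise: over one cell the noise of
  \<open>path f\<close> has standard deviation \<open>sqrt (width i) / sqrt n\<close>.\<close>

definition shift :: "(real \<Rightarrow> real) \<Rightarrow> nat \<Rightarrow> real" where
  "shift f i = sqrt (real n) * (drift f (t (Suc i)) - drift f (t i)) / sqrt (width i)"

lemma measurable_Z: "Z \<in> measurable \<Omega> (std_normal_PiM {..<N})"
proof -
  have "(\<lambda>\<omega>. (W (t (Suc i)) \<omega> - W (t i) \<omega>) / sqrt (width i)) \<in> measurable \<Omega> std_normal_distribution" if "i < N" for i
    using W_measurable[of "t i"] W_measurable[of "t (Suc i)"] t_unit[of i] t_unit[of "Suc i"] that by simp
  thus ?thesis unfolding Z_def[abs_def] by (intro measurable_restrict) auto
qed

text \<open>Division by \<open>sqrt (width i)\<close> makes each increment standard normal, and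
  independence identifies the joint law with the product of the marginals.\<close>

lemma distr_Z: "distr \<Omega> (std_normal_PiM {..<N}) Z = std_normal_PiM {..<N}"
proof -
  let ?D = "\<lambda>i \<omega>. W (t (Suc i)) \<omega> - W (t i) \<omega>"
  let ?Z = "\<lambda>i \<omega>. ?D i \<omega> / sqrt (width i)"
  have "indep_vars (\<lambda>_. borel) ?D {..<N}"
    using bm mono range unfolding brownian_motion_def by blast
  from indep_vars_compose2[OF this, of "\<lambda>i x. x / sqrt (width i)" "\<lambda>_. borel"]
  have ind: "indep_vars (\<lambda>_. borel) ?Z {..<N}" by simp
  have rv: "random_variable borel (?Z i)" if "i \<in> {..<N}" for i
    using ind that by (simp add: indep_vars_def)
  have std: "distr \<Omega> borel (?Z i) = std_normal_distribution" if "i \<in> {..<N}" for i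
  proof -
    have i: "i < N" using that by simp
    have "distributed \<Omega> lborel (?D i) (normal_density 0 (sqrt (width i)))"
      using bm t_unit[of i] t_unit[of "Suc i"] t_less[OF i] i unfolding brownian_motion_def width_def by auto
    hence "distributed \<Omega> lborel (?Z i) std_normal_density"
      using normal_standard_normal_convert[of "sqrt (width i)" "?D i" 0] width_pos[OF i] by simp
    hence "distr \<Omega> lborel (?Z i) = std_normal_distribution" by (simp add: distributed_def)
    moreover have "distr \<Omega> borel (?Z i) = distr \<Omega> lborel (?Z i)" by (intro distr_cong) auto
    ultimately show ?thesis by simp
  qed
  have "distr \<Omega> (std_normal_PiM {..<N}) Z = distr \<Omega> (Pi\<^sub>M {..<N} (\<lambda>_. borel)) (\<lambda>\<omega>. \<lambda>i\<in>{..<N}. ?Z i \<omega>)"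
    by (intro distr_cong sets_PiM_cong) (auto simp: Z_def)
  also have "\<dots> = Pi\<^sub>M {..<N} (\<lambda>i. distr \<Omega> borel (?Z i))"
    using ind N_pos rv by (subst indep_vars_iff_distr_eq_PiM'[symmetric]) auto
  also have "\<dots> = std_normal_PiM {..<N}" by (intro PiM_cong refl std)
  finally show ?thesis .
qed

lemma path_increment:
  assumes "i < N"
  shows "path f \<omega> (t (Suc i)) - path f \<omega> (t i) = sqrt (width i) / sqrt (real n) * shift_on {..<N} (shift f) (Z \<omega>) i"
proof -
  have pos: "0 < sqrt (width i)" "0 < sqrt (real n)" using width_pos[OF assms] n by auto
  have alg: "(d1 + w1 / r) - (d0 + w0 / r) = s / r * ((w1 - w0) / s + r * (d1 - d0) / s)"
    if "0 < s" "0 < r" for d0 d1 w0 w1 r s :: real using that by (simp add: field_simps)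
  have "t i \<in> unit_interval" "t (Suc i) \<in> unit_interval" using t_unit assms by auto
  thus ?thesis using assms unfolding path_def shift_on_def Z_def shift_def by (simp add: alg[OF pos])
qed

text \<open>Discretising never increases the distance: drifts are linear in \<open>f\<close>, and
  \<open>drift_energy\<close> applied to \<open>g - f\<close> bounds the sum uniformly over all
  partitions.\<close>

lemma shift_distance:
  assumes f: "f \<in> L2 unit_base" and g: "g \<in> L2 unit_base"
  shows "(\<Sum>i<N. (shift g i - shift f i)\<^sup>2) \<le> real n * (\<integral>x. (g x - f x)\<^sup>2 \<partial>unit_base)"
proof -
  let ?u = "\<lambda>x. g x - f x"
  have "drift ?u (t i) = drift g (t i) - drift f (t i)" if "i \<le> N" for i
    unfolding drift_def integral_upto[OF t_unit[OF that]] right_diff_distrib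
    by (rule Bochner_Integration.integral_diff; rule integrable_indicator_mult[OF unit_base_integrable]; (rule f | rule g | simp))
  hence "shift g i - shift f i = sqrt (real n) * (drift ?u (t (Suc i)) - drift ?u (t i)) / sqrt (width i)" if "i < N" for i
    using that by (simp add: shift_def diff_divide_distrib[symmetric] right_diff_distrib[symmetric])
  hence "(\<Sum>i<N. (shift g i - shift f i)\<^sup>2) = (\<Sum>i<N. real n * ((drift ?u (t (Suc i)) - drift ?u (t i))\<^sup>2 / width i))"
    using width_pos by (intro sum.cong) (auto simp: power_mult_distrib power_divide less_imp_le)
  also have "\<dots> \<le> real n * (\<integral>x. (?u x)\<^sup>2 \<partial>unit_base)"
    unfolding sum_distrib_left[symmetric] by (intro mult_left_mono drift_energy L2_diff f g) auto
  finally show ?thesis .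
qed

lemma step_int_normal:
  assumes "\<And>a u v. (a, u, v) \<in> set s \<Longrightarrow> u \<in> t ` {..N} \<and> v \<in> t ` {..N}"
  shows "\<exists>\<mu> \<sigma>. has_normal (white_noise_law n \<Omega> W f) (step_int s) \<mu> \<sigma>"
proof -
  obtain c where c: "\<And>y. step_int s y = (\<Sum>i<N. c i * (y (t (Suc i)) - y (t i)))"
  proof -
    have "\<exists>c. \<forall>y. step_int s y = (\<Sum>i<N. c i * (y (t (Suc i)) - y (t i)))"
      by (rule step_int_increments) (rule assms)
    thus ?thesis using that by blast
  qed
  have comp: "(\<lambda>y. y (t i)) \<in> borel_measurable (Pi\<^sub>M unit_interval (\<lambda>_. borel))" if "i \<le> N" for i
    using t_unit[OF that] by (intro measurable_component_singleton)
  have meas: "step_int s \<in> borel_measurable (Pi\<^sub>M unit_interval (\<lambda>_. borel))"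
    unfolding c[abs_def] by (intro borel_measurable_sum borel_measurable_times borel_measurable_diff comp borel_measurable_const) auto
  let ?k = "\<lambda>i. c i * (sqrt (width i) / sqrt (real n))"
  let ?X = "\<lambda>z. (\<Sum>i<N. ?k i * shift f i) + (\<Sum>i<N. ?k i * z i)"
  have eq: "step_int s (path f \<omega>) = ?X (Z \<omega>)" for \<omega>
  proof -
    have "step_int s (path f \<omega>) = (\<Sum>i<N. ?k i * shift_on {..<N} (shift f) (Z \<omega>) i)"
      unfolding c by (intro sum.cong refl) (simp add: path_increment)
    also have "\<dots> = (\<Sum>i<N. ?k i * shift f i + ?k i * Z \<omega> i)"
      by (intro sum.cong refl) (simp add: shift_on_def distrib_left)
    finally show ?thesis by (simp only: sum.distrib)
  qed
  have "has_normal (distr \<Omega> (std_normal_PiM {..<N}) Z) ?X (\<Sum>i<N. ?k i * shift f i) (sqrt (\<Sum>i<N. (?k i)\<^sup>2))"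
    unfolding distr_Z by (rule has_normal_linear_combination) simp
  hence "has_normal \<Omega> (\<lambda>\<omega>. step_int s (path f \<omega>)) (\<Sum>i<N. ?k i * shift f i) (sqrt (\<Sum>i<N. (?k i)\<^sup>2))"
    unfolding eq by (subst (asm) has_normal_distr[OF measurable_Z]) auto
  thus ?thesis unfolding white_noise_law_eq has_normal_distr[OF measurable_path meas] by blast
qed

text \<open>Up to a null set the path vanishes at \<open>t 0 = -1/2\<close>, hence it is recovered from its increments.\<close>

definition rebuild :: "real set \<Rightarrow> (nat \<Rightarrow> real) \<Rightarrow> real \<Rightarrow> real" where
  "rebuild J z = (\<lambda>s\<in>J. \<Sum>i<N. (if t i < s then sqrt (width i) / sqrt (real n) * z i else 0))"

lemma measurable_rebuild: "rebuild J \<in> measurable (std_normal_PiM {..<N}) (Pi\<^sub>M J (\<lambda>_. borel))"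
  unfolding rebuild_def by measurable

lemma path_rebuild:
  assumes J: "J \<subseteq> t ` {..N}"
  shows "AE \<omega> in \<Omega>. restrict (path f \<omega>) J = rebuild J (shift_on {..<N} (shift f) (Z \<omega>))"
proof -
  have "AE \<omega> in \<Omega>. W (-1/2) \<omega> = 0" using bm by (simp add: brownian_motion_def)
  thus ?thesis
  proof eventually_elim
    fix \<omega> assume "W (-1/2) \<omega> = 0"
    hence 0: "path f \<omega> (t 0) = 0" using drift_start[of f] by (simp add: path_def start)
    show "restrict (path f \<omega>) J = rebuild J (shift_on {..<N} (shift f) (Z \<omega>))"
    proof
      fix s
      show "restrict (path f \<omega>) J s = rebuild J (shift_on {..<N} (shift f) (Z \<omega>)) s"
      proof (cases "s \<in> J")
        case True
        then obtain p where p: "p \<le> N" "s = t p" using J by auto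
        \<comment> \<open>At \<open>s = t p\<close> the strict inequality in \<open>rebuild\<close>
          selects exactly the increments with index below \<open>p\<close>, which telescope to the
          value at \<open>t p\<close>.\<close>
        have less: "t i < t p \<longleftrightarrow> i < p" if "i < N" for i
          using strict_mono_on_less[OF mono, of i p] that p by auto
        have "(\<Sum>i<N. (if t i < s then sqrt (width i) / sqrt (real n) * shift_on {..<N} (shift f) (Z \<omega>) i else 0))
          = (\<Sum>i<p. path f \<omega> (t (Suc i)) - path f \<omega> (t i))"
          using p less by (intro sum.mono_neutral_cong_right) (auto simp: path_increment)
        also have "\<dots> = path f \<omega> s" using sum_lessThan_telescope[of "\<lambda>i. path f \<omega> (t i)" p] by (simp add: 0 p)
        finally show ?thesis using True by (simp add: rebuild_def)
      qed (simp add: rebuild_def)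
    qed
  qed
qed

text \<open>The path and its reconstruction agree only almost surely, so the two preimages are
  compared up to a null set. The map \<open>rebuild J\<close> is the same for every
  \<open>f\<close>; only the shift varies.\<close>

lemma white_noise_law_cylinder:
  assumes J: "J \<subseteq> t ` {..N}" and B: "B \<in> sets (Pi\<^sub>M J (\<lambda>_. borel))"
  shows "measure (white_noise_law n \<Omega> W f) (cylinder unit_interval J B) = measure (std_normal_PiM {..<N})
    {z \<in> space (std_normal_PiM {..<N}). rebuild J (shift_on {..<N} (shift f) z) \<in> B}"
proof -
  let ?R = "\<lambda>z. rebuild J (shift_on {..<N} (shift f) z)"
  have JU: "J \<subseteq> unit_interval" using J range by blast
  have S: "{z \<in> space (std_normal_PiM {..<N}). ?R z \<in> B} \<in> sets (std_normal_PiM {..<N})"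
  proof -
    have "{z \<in> space (std_normal_PiM {..<N}). ?R z \<in> B} = ?R -` B \<inter> space (std_normal_PiM {..<N})" by blast
    also have "\<dots> \<in> sets (std_normal_PiM {..<N})"
      by (rule measurable_sets[OF measurable_compose[OF measurable_shift_on measurable_rebuild] B])
    finally show ?thesis .
  qed
  have C: "path f -` cylinder unit_interval J B \<inter> space \<Omega> \<in> sets \<Omega>"
    by (rule measurable_sets[OF measurable_path cylinder_measurable[OF JU B]])
  have "measure (white_noise_law n \<Omega> W f) (cylinder unit_interval J B)
    = measure \<Omega> (path f -` cylinder unit_interval J B \<inter> space \<Omega>)"
    unfolding white_noise_law_eq by (rule measure_distr[OF measurable_path cylinder_measurable[OF JU B]])
  also have "\<dots> = measure \<Omega> (Z -` {z \<in> space (std_normal_PiM {..<N}). ?R z \<in> B} \<inter> space \<Omega>)"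
  proof (rule finite_measure_eq_AE)
    show "AE \<omega> in \<Omega>. \<omega> \<in> path f -` cylinder unit_interval J B \<inter> space \<Omega> \<longleftrightarrow>
        \<omega> \<in> Z -` {z \<in> space (std_normal_PiM {..<N}). ?R z \<in> B} \<inter> space \<Omega>"
      using path_rebuild[OF J, of f] AE_space
      by eventually_elim (use measurable_space[OF measurable_path] measurable_space[OF measurable_Z] in \<open>simp add: cylinder_def\<close>)
  qed (use C measurable_sets[OF measurable_Z S] in simp_all)
  also have "\<dots> = measure (distr \<Omega> (std_normal_PiM {..<N}) Z) {z \<in> space (std_normal_PiM {..<N}). ?R z \<in> B}"
    by (rule measure_distr[OF measurable_Z S, symmetric])
  finally show ?thesis by (simp only: distr_Z)
qed

end

context white_noise_model
begin

lemma step_int_has_normal: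
  assumes "valid_step s" shows "\<exists>\<mu> \<sigma>. has_normal (white_noise_law n \<Omega> W f) (step_int s) \<mu> \<sigma>"
proof -
  let ?J = "(\<lambda>(a, u, v). u) ` set s \<union> (\<lambda>(a, u, v). v) ` set s"
  have "finite ?J" "?J \<subseteq> unit_interval" using assms by (force simp: valid_step_def)+
  then obtain t N where tN: "time_partition t N" "?J \<subseteq> t ` {..N}" by (rule time_partition_exists)
  interpret time_partition t N by fact
  interpret partitioned_white_noise \<Omega> W n t N ..
  show ?thesis by (rule step_int_normal) (use tN(2) in force)
qed

lemma wiener_int_normal:
  assumes X: "wiener_int n \<Omega> W h X" and f: "f \<in> L2 unit_base"
  shows "\<exists>\<mu> \<sigma>. has_normal (white_noise_law n \<Omega> W f) X \<mu> \<sigma>"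
proof -
  interpret P: prob_space "white_noise_law n \<Omega> W f" by (rule prob_space_white_noise_law)
  obtain s where s: "\<And>r. valid_step (s r)"
    "(\<lambda>r. \<integral>\<^sup>+y. ennreal ((X y - step_int (s r) y)\<^sup>2) \<partial>white_noise_law n \<Omega> W f) \<longlonglongrightarrow> 0"
    using X f unfolding wiener_int_def by blast
  have "X \<in> borel_measurable (white_noise_law n \<Omega> W f)"
    using X by (simp add: wiener_int_def white_noise_law_eq obs_space_def)
  thus ?thesis using step_int_has_normal[OF s(1)] s(2) by (rule P.has_normal_L2_limit)
qed

theorem gaussian_experiment_white_noise: "gaussian_experiment (white_noise n \<Omega> W) n"
proof (rule gaussian_experiment.intro)
  fix a f g A
  assume a: "0 < a" "a < 1/2" and fg: "f \<in> L2 (base (white_noise n \<Omega> W))" "g \<in> L2 (base (white_noise n \<Omega> W))"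
    and close: "norm2 (base (white_noise n \<Omega> W)) (\<lambda>x. g x - f x) \<le> z_quantile a / sqrt (real n)"
    and A: "A \<in> sets (obs_space (base (white_noise n \<Omega> W)))" "measure (law (white_noise n \<Omega> W) f) A \<le> a"
  have f: "f \<in> L2 unit_base" and g: "g \<in> L2 unit_base" using fg by (simp_all add: white_noise_def)
  have le: "real n * (\<integral>x. (g x - f x)\<^sup>2 \<partial>unit_base) \<le> (z_quantile a)\<^sup>2"
    using close n z_quantile_pos[OF a] by (intro scaled_norm2_le) (auto simp: white_noise_def)
  have "measure (white_noise_law n \<Omega> W g) A \<le> 1/2"
  proof (rule testing_by_coordinates[where P = "white_noise_law n \<Omega> W f" and K = unit_interval and \<alpha> = a])
    fix J assume "finite J" "J \<subseteq> unit_interval"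
    then obtain t N where tN: "time_partition t N" "J \<subseteq> t ` {..N}" by (rule time_partition_exists)
    interpret time_partition t N by fact
    interpret partitioned_white_noise \<Omega> W n t N ..
    show "\<exists>(I::nat set) S b c. finite I \<and>
      S \<in> measurable (std_normal_PiM I) (Pi\<^sub>M J (\<lambda>_. borel)) \<and> (\<Sum>i\<in>I. (c i - b i)\<^sup>2) \<le> (z_quantile a)\<^sup>2 \<and>
      (\<forall>B\<in>sets (Pi\<^sub>M J (\<lambda>_. borel)).
        measure (white_noise_law n \<Omega> W f) (cylinder unit_interval J B) = measure (std_normal_PiM I) {z \<in> space (std_normal_PiM I). S (shift_on I b z) \<in> B} \<and>
        measure (white_noise_law n \<Omega> W g) (cylinder unit_interval J B) = measure (std_normal_PiM I) {z \<in> space (std_normal_PiM I). S (shift_on I c z) \<in> B})"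
      using order_trans[OF shift_distance[OF f g] le] white_noise_law_cylinder[OF tN(2)] measurable_rebuild
      by (intro exI[of _ "{..<N}"] exI[of _ "rebuild J"] exI[of _ "shift f"] exI[of _ "shift g"]) simp
  qed (use a A in \<open>auto simp: prob_space_white_noise_law sets_white_noise_law white_noise_def obs_space_def\<close>)
  thus "measure (law (white_noise n \<Omega> W) g) A \<le> 1/2" by (simp add: white_noise_def)
next
  show "0 < n" by (rule n)
  show "prob_space (law (white_noise n \<Omega> W) f)" for f
    by (simp add: white_noise_def prob_space_white_noise_law)
  show "sets (law (white_noise n \<Omega> W) f) = sets (obs_space (base (white_noise n \<Omega> W)))" for f
    by (simp add: white_noise_def sets_white_noise_law obs_space_def)
  show "X \<in> borel_measurable (obs_space (base (white_noise n \<Omega> W)))" if "stoch_int (white_noise n \<Omega> W) h X" for h X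
    using that by (simp add: white_noise_def wiener_int_def)
  show "\<exists>\<mu> \<sigma>. has_normal (law (white_noise n \<Omega> W) f) X \<mu> \<sigma>"
    if "stoch_int (white_noise n \<Omega> W) h X" "f \<in> L2 (base (white_noise n \<Omega> W))" for h X f
    using that wiener_int_normal[of h X f] by (simp add: white_noise_def)
qed

end

lemma adaptive_CI:
  assumes "gaussian_experiment m n" "parameter_setting m D T k F"
    "\<forall>i\<in>{1..k}. \<forall>j\<in>{1..k}. admissible_estimator m n T F (\<alpha> / real k) i j (Th i j)"
    "0 < \<alpha>" "\<alpha> < 1/2" "0 < k"
  shows "CI_star m n T k F \<alpha> Th \<in> conf_intervals m T \<alpha> (\<Union>i\<in>{1..k}. F i) \<and>
    (\<forall>j\<in>{1..k}. minimax_length m T \<alpha> (F j) (\<Union>i\<in>{1..k}. F i) \<le> max_length m (CI_star m n T k F \<alpha> Th) (F j) \<and>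
      max_length m (CI_star m n T k F \<alpha> Th) (F j)
        \<le> ennreal (12 * z_quantile (\<alpha> / (2 * real k)) / ((1/2 - \<alpha>) * z_quantile \<alpha>))
          * minimax_length m T \<alpha> (F j) (\<Union>i\<in>{1..k}. F i))"
  by (rule adaptive_setting.CI_adaptive[of m n D])
    (use assms in \<open>auto simp: adaptive_setting_def adaptive_setting_axioms_def\<close>)

theorem theorem3:
  fixes \<alpha> :: real and n k :: nat
    and \<Omega> :: "'w measure" and W :: "real \<Rightarrow> 'w \<Rightarrow> real"
    and M :: "'i set"
  assumes "0 < \<alpha>" and "\<alpha> < 1/2" and "0 < n" and "0 < k"
  shows
    "(brownian_motion \<Omega> W \<longrightarrow>
       (\<forall>D T F Th.
          parameter_setting (white_noise n \<Omega> W) D T k F \<and>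
          (\<forall>i\<in>{1..k}. \<forall>j\<in>{1..k}. admissible_estimator (white_noise n \<Omega> W) n T F (\<alpha> / real k) i j (Th i j)) \<longrightarrow>
          CI_star (white_noise n \<Omega> W) n T k F \<alpha> Th \<in> conf_intervals (white_noise n \<Omega> W) T \<alpha> (\<Union>i\<in>{1..k}. F i) \<and>
          (\<forall>j\<in>{1..k}.
             minimax_length (white_noise n \<Omega> W) T \<alpha> (F j) (\<Union>i\<in>{1..k}. F i)
               \<le> max_length (white_noise n \<Omega> W) (CI_star (white_noise n \<Omega> W) n T k F \<alpha> Th) (F j) \<and>
             max_length (white_noise n \<Omega> W) (CI_star (white_noise n \<Omega> W) n T k F \<alpha> Th) (F j)
               \<le> ennreal (12 * z_quantile (\<alpha> / (2 * real k)) / ((1/2 - \<alpha>) * z_quantile \<alpha>))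
                  * minimax_length (white_noise n \<Omega> W) T \<alpha> (F j) (\<Union>i\<in>{1..k}. F i))))
     \<and>
     (countable M \<longrightarrow>
       (\<forall>D T F Th.
          parameter_setting (gaussian_sequence n M) D T k F \<and>
          (\<forall>i\<in>{1..k}. \<forall>j\<in>{1..k}. admissible_estimator (gaussian_sequence n M) n T F (\<alpha> / real k) i j (Th i j)) \<longrightarrow>
          CI_star (gaussian_sequence n M) n T k F \<alpha> Th \<in> conf_intervals (gaussian_sequence n M) T \<alpha> (\<Union>i\<in>{1..k}. F i) \<and>
          (\<forall>j\<in>{1..k}.
             minimax_length (gaussian_sequence n M) T \<alpha> (F j) (\<Union>i\<in>{1..k}. F i)
               \<le> max_length (gaussian_sequence n M) (CI_star (gaussian_sequence n M) n T k F \<alpha> Th) (F j) \<and>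
             max_length (gaussian_sequence n M) (CI_star (gaussian_sequence n M) n T k F \<alpha> Th) (F j)
               \<le> ennreal (12 * z_quantile (\<alpha> / (2 * real k)) / ((1/2 - \<alpha>) * z_quantile \<alpha>))
                  * minimax_length (gaussian_sequence n M) T \<alpha> (F j) (\<Union>i\<in>{1..k}. F i))))"
proof ((rule conjI; intro impI allI; elim conjE), goal_cases)
  case (1 D T F Th)
  have "gaussian_experiment (white_noise n \<Omega> W) n" using 1(1) assms(3)
    by (intro white_noise_model.gaussian_experiment_white_noise white_noise_model.intro)
  thus ?case using 1(2,3) assms(1,2,4) by (rule adaptive_CI)
next
  case (2 D T F Th)
  show ?case using gaussian_experiment_sequence[OF assms(3)] 2(2,3) assms(1,2,4) by (rule adaptive_CI)
qed

end
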